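(* With $L_{p+q}=-2iv^2\frac{\partial}{\partial\bar\tau}$ the Maass lowering operator and $d=\frac12(\partial+\bar\partial)$, $d^c=\frac1{4\pi i}(\partial-\bar\partial)$ the exterior derivatives on $\mathcal A^\bullet(\mathbb D)$, one has for all $x\in V$, $\tau=u+iv\in\mathbb H$, $z\in\mathbb D$: $L_{p+q}\varphi_{KM}(x,\tau,z)=dd^c\psi(x,\tau,z)$, and consequently $v\frac{\partial}{\partial v}\varphi^0_{KM}(\sqrt v x,z)=dd^c\psi^0(\sqrt v x,z)$.
   Context: Let $p,q\ge 1$, $m=p+q$, and let $V$ be a complex vector space of dimension $m$ with a non-degenerate Hermitian form $(\cdot,\cdot)$ of signature $(p,q)$, $\mathbb C$-antilinear in the first and $\mathbb C$-linear in the second variable. Fix a basis $v_1,\dots,v_m$ with $(v_r,v_s)=0$ for $r\ne s$, $(v_\alpha,v_\alpha)=1$ for $1\le\alpha\le p$, $(v_\mu,v_\mu)=-1$ for $p<\mu\le m$; write $x=\sum_rz_rv_r$. Let $G=\mathrm U(V)$, $z_0=\mathrm{span}(v_{p+1},\dots,v_m)$, $K$ its stabilizer, $\mathbb D=G/K$ the space of negative definite complex $q$-planes $z\subset V$. Let $X_{rs}(x)=(v_r,x)v_s-(v_s,x)v_r$, $Y_{rs}(x)=(iv_r,x)v_s-(v_s,x)iv_r$ in $\mathfrak u(V)$; $\mathfrak p^+$ is spanned by $Z'_{\alpha\mu}=\frac12(X_{\alpha\mu}-Y_{\alpha\mu}i)$, $\mathfrak p^-$ by $Z''_{\alpha\mu}=\frac12(X_{\alpha\mu}+Y_{\alpha\mu}i)$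 ($1\le\alpha\le p<\mu\le m$), with dual bases $\xi'_{\alpha\mu},\xi''_{\alpha\mu}$; $G$-invariant elements of $\mathcal S(V)\otimes\mathcal A^\bullet(\mathbb D)$ are identified with $K$-invariant elements of $\mathcal S(V)\otimes\wedge^\bullet\mathfrak p^*$ by evaluation at $z_0$ (the $\xi'$ being $(1,0)$- and the $\xi''$ $(0,1)$-forms at $z_0$). Let $\varphi_0(x)=e^{-\pi\sum_r|z_r|^2}$, $\mathcal D_\alpha=\bar z_\alpha-\frac1\pi\frac{\partial}{\partial z_\alpha}$, $\bar{\mathcal D}_\alpha=z_\alpha-\frac1\pi\frac{\partial}{\partial\bar z_\alpha}$, $\mathcal D_{\underline\alpha}=\prod_j\mathcal D_{\alpha_j}$. The Kudla–Millson form is $\varphi_{KM}=2^{-2q}\sum_{\underline\alpha,\underline\beta\in\{1..p\}^q}\mathcal D_{\underline\alpha}\bar{\mathcal D}_{\underline\beta}\varphi_0\otimes\xi'_{\alpha_1,p+1}\wedge\cdots\wedge\xi'_{\alpha_q,p+q}\wedge\xi''_{\beta_1,p+1}\wedge\cdots\wedge\xi''_{\beta_q,p+q}$. For $\underline\alpha,\underline\beta\in\{1..p\}^{q-1}$ let $\Omega_{q-1}(\underline\alpha;\underline\beta)=(-1)^{q(q-1)/2}\sum_{j=1}^q\bigwedge_{k\ne j}(\xi'_{\alpha_{\sigma_j(k)},p+k}\wedge\xi''_{\beta_{\sigma_j(k)},p+k})$ (increasing $k$), with $\sigma_j(k)=k$ for $k<j$, $k-1$ for $k>j$, and $\psi=\frac{2i(-1)^{q-1}}{2^{2(q-1)}}\sum_{\underline\alpha,\underline\beta}\mathcal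 D_{\underline\alpha}\bar{\mathcal D}_{\underline\beta}\varphi_0\otimes\Omega_{q-1}(\underline\alpha;\underline\beta)$. These are $K$-invariant and hence define $G$-invariant forms $\varphi_{KM}(x,z)$, $\psi(x,z)$. Put $\varphi^0_{KM}(x,z)=e^{\pi(x,x)}\varphi_{KM}(x,z)$, $\psi^0(x,z)=e^{\pi(x,x)}\psi(x,z)$, and for $\tau=u+iv\in\mathbb H$: $\varphi_{KM}(x,\tau,z)=\varphi^0_{KM}(\sqrt vx,z)e^{\pi i(x,x)\tau}$, $\psi(x,\tau,z)=v\,\psi^0(\sqrt vx,z)e^{\pi i(x,x)\tau}$.
   Formalization: The sign in Ω_{q-1} is taken as (-1)^{(q-1)(q-2)/2} instead of the printed (-1)^{q(q-1)/2}; they agree for odd q, and for even q the printed sign yields dd^c ψ equal to minus L φ_KM, so the identity fails as printed. *)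

theory Defs
  imports "HOL-Analysis.Analysis"
begin

text \<open>
  After the choice of the orthogonal basis, \<open>V\<close> is \<open>\<complex>^(p+q)\<close> with its standard form of signature
  \<open>(p, q)\<close>. The index type is the sum \<open>'p + 'q\<close> with \<open>p = CARD('p)\<close> and \<open>q = CARD('q)\<close>:
  \<open>axis (Inl \<alpha>) 1\<close> are the positive and \<open>axis (Inr \<mu>) 1\<close> the negative basis vectors. The linear
  order on \<open>'q\<close> is that of \<open>p + 1 < \<dots> < p + q\<close>; it fixes the order of the factors in the wedge
  products below.
\<close>

definition herm :: "complex ^ ('p::finite + 'q::finite) \<Rightarrow> complex ^ ('p + 'q) \<Rightarrow> complex" where
  "herm x y = (\<Sum>\<alpha>\<in>UNIV. cnj (x $ Inl \<alpha>) * y $ Inl \<alpha>) - (\<Sum>\<mu>\<in>UNIV. cnj (x $ Inr \<mu>) * y $ Inr \<mu>)"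

definition unitary_group :: "(complex ^ ('p::finite + 'q::finite) ^ ('p + 'q)) set" where
  "unitary_group = {g. \<forall>x y. herm (g *v x) (g *v y) = herm x y}"

definition base_plane :: "(complex ^ ('p::finite + 'q::finite)) set" where
  "base_plane = vec.span (range (\<lambda>\<mu>. axis (Inr \<mu>) 1))"

definition neg_planes :: "(complex ^ ('p::finite + 'q::finite)) set set" where
  "neg_planes = {z. vec.subspace z \<and> vec.dim z = CARD('q) \<and> (\<forall>x\<in>z. x \<noteq> 0 \<longrightarrow> Re (herm x x) < 0)}"

definition act :: "complex ^ ('p::finite + 'q::finite) ^ ('p + 'q) \<Rightarrow>
    (complex ^ ('p + 'q)) set \<Rightarrow> (complex ^ ('p + 'q)) set" where
  "act g z = (\<lambda>x. g *v x) ` z"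

text \<open>
  The complex manifold structure of \<open>neg_planes\<close>, an open subset of the Grassmannian of \<open>q\<close>-planes:
  every negative definite \<open>q\<close>-plane is the graph of a unique \<open>p \<times> q\<close> matrix, so that one
  holomorphic chart suffices, and all tangent spaces are \<open>complex ^ 'q ^ 'p\<close>.
\<close>

definition graph :: "complex ^ 'q ^ 'p \<Rightarrow> (complex ^ ('p::finite + 'q::finite)) set" where
  "graph Z = {x. \<forall>\<alpha>. x $ Inl \<alpha> = (\<Sum>\<mu>\<in>UNIV. Z $ \<alpha> $ \<mu> * x $ Inr \<mu>)}"

definition coord :: "(complex ^ ('p::finite + 'q::finite)) set \<Rightarrow> complex ^ 'q ^ 'p" where
  "coord z = (THE Z. graph Z = z)"

lemma graph_inj: "graph Z = graph Z' \<Longrightarrow> Z = Z'"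
proof -
  assume eq: "graph Z = graph Z'"
  have "Z $ \<alpha> $ \<mu> = Z' $ \<alpha> $ \<mu>" for \<alpha> \<mu>
  proof -
    define x :: "complex ^ ('a + 'b)" where
      "x = (\<chi> r. case r of Inl \<beta> \<Rightarrow> Z $ \<beta> $ \<mu> | Inr \<nu> \<Rightarrow> if \<nu> = \<mu> then 1 else 0)"
    have "x \<in> graph Z"
      by (simp add: graph_def x_def if_distrib cong: if_cong)
    with eq have "x \<in> graph Z'" by simp
    then show ?thesis
      by (simp add: graph_def x_def if_distrib cong: if_cong)
  qed
  then show ?thesis by (simp add: vec_eq_iff)
qed

lemma coord_graph [simp]: "coord (graph Z) = Z"
  unfolding coord_def by (rule the_equality) (auto dest: graph_inj)

lemma neg_plane_is_graph:
  fixes z :: "(complex ^ ('p::finite + 'q::finite)) set"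
  assumes "z \<in> neg_planes"
  shows "\<exists>!Z. graph Z = z"
proof -
  have sub: "vec.subspace z" and dim: "vec.dim z = CARD('q)"
    and neg: "\<And>x. x \<in> z \<Longrightarrow> x \<noteq> 0 \<Longrightarrow> Re (herm x x) < 0"
    using assms by (auto simp: neg_planes_def)
  define P :: "complex ^ ('p + 'q) \<Rightarrow> complex ^ 'q" where "P = (\<lambda>x. \<chi> \<mu>. x $ Inr \<mu>)"
  have lin: "Vector_Spaces.linear (*s) (*s) P"
    by unfold_locales (simp_all add: P_def vec_eq_iff algebra_simps)
  have zero: "x = 0" if "x \<in> z" "P x = 0" for x
  proof (rule ccontr)
    assume "x \<noteq> 0"
    with neg that have "Re (herm x x) < 0" by blast
    moreover have "x $ Inr \<mu> = 0" for \<mu>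
      using that(2) by (simp add: P_def vec_eq_iff)
    then have "Re (herm x x) \<ge> 0"
      by (simp add: herm_def sum_nonneg)
    ultimately show False by simp
  qed
  have inj: "inj_on P z"
    using vec.linear_inj_on_iff_eq_0[OF lin sub] zero by blast
  have "vec.dim (P ` z) = CARD('q)"
    using vec.dim_image_eq[OF lin] inj sub dim by (metis vec.span_eq_iff)
  then have "vec.span (P ` z) = UNIV"
    using vec.dim_eq_full[of "P ` z"] by (simp add: vec.dimension_def card_cart_basis)
  moreover have "vec.subspace (P ` z)"
    using vec.linear_subspace_image[OF lin sub] .
  ultimately have surj: "P ` z = UNIV" by (metis vec.span_eq_iff)
  define b :: "'q \<Rightarrow> complex ^ ('p + 'q)" where "b \<mu> = inv_into z P (axis \<mu> 1)" for \<mu>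
  have b: "b \<mu> \<in> z" "P (b \<mu>) = axis \<mu> 1" for \<mu>
    by (auto simp: b_def surj inv_into_into f_inv_into_f)
  define Z :: "complex ^ 'q ^ 'p" where "Z = (\<chi> \<alpha> \<mu>. b \<mu> $ Inl \<alpha>)"
  have comb: "(\<Sum>\<mu>\<in>UNIV. x $ Inr \<mu> *s b \<mu>) \<in> z" for x :: "complex ^ ('p + 'q)"
    by (intro vec.subspace_sum[OF sub] vec.subspace_scale[OF sub] b)
  have bInr: "b \<mu> $ Inr \<nu> = (if \<nu> = \<mu> then 1 else 0)" for \<mu> \<nu>
    using b(2)[of \<mu>] by (simp add: P_def vec_eq_iff axis_def)
  have Pcomb: "P (\<Sum>\<mu>\<in>UNIV. x $ Inr \<mu> *s b \<mu>) = P x" for x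
    by (simp add: P_def vec_eq_iff bInr if_distrib cong: if_cong)
  have "graph Z = z"
  proof
    show "z \<subseteq> graph Z"
    proof
      fix x assume "x \<in> z"
      then have "(\<Sum>\<mu>\<in>UNIV. x $ Inr \<mu> *s b \<mu>) = x"
        by (rule inj_onD[OF inj Pcomb comb])
      then have "(\<Sum>\<mu>\<in>UNIV. x $ Inr \<mu> *s b \<mu>) $ Inl \<alpha> = x $ Inl \<alpha>" for \<alpha> by (rule arg_cong)
      then show "x \<in> graph Z"
        by (simp add: graph_def Z_def mult.commute)
    qed
    show "graph Z \<subseteq> z"
    proof
      fix x assume x: "x \<in> graph Z"
      have "(\<Sum>\<mu>\<in>UNIV. x $ Inr \<mu> *s b \<mu>) $ r = x $ r" for r
        using x by (cases r) (simp_all add: graph_def Z_def mult.commute bInr if_distrib cong: if_cong)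
      then have "(\<Sum>\<mu>\<in>UNIV. x $ Inr \<mu> *s b \<mu>) = x" by (simp add: vec_eq_iff)
      with comb[of x] show "x \<in> z" by simp
    qed
  qed
  then show ?thesis using graph_inj by blast
qed

lemma graph_0: "graph 0 = (base_plane :: (complex ^ ('p::finite + 'q::finite)) set)" (is "?G = ?B")
proof
  show "?B \<subseteq> ?G"
    unfolding base_plane_def
  proof (rule vec.span_minimal)
    show "range (\<lambda>\<mu>. axis (Inr \<mu>) 1 :: complex ^ ('p + 'q)) \<subseteq> ?G"
      by (auto simp: graph_def axis_def)
    show "vec.subspace ?G"
      by (auto simp: graph_def vec.subspace_def)
  qed
  show "?G \<subseteq> ?B"
  proof
    fix x assume x: "x \<in> ?G"
    have "(\<Sum>\<mu>\<in>UNIV. x $ Inr \<mu> *s (axis (Inr \<mu>) 1 :: complex ^ ('p + 'q))) $ r = x $ r" for r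
      using x by (cases r) (simp_all add: graph_def axis_def if_distrib cong: if_cong)
    then have "(\<Sum>\<mu>\<in>UNIV. x $ Inr \<mu> *s (axis (Inr \<mu>) 1 :: complex ^ ('p + 'q))) = x" by (simp add: vec_eq_iff)
    moreover have "(\<Sum>\<mu>\<in>UNIV. x $ Inr \<mu> *s (axis (Inr \<mu>) 1 :: complex ^ ('p + 'q))) \<in> base_plane"
      unfolding base_plane_def by (intro vec.span_sum vec.span_scale vec.span_base) auto
    ultimately show "x \<in> base_plane" by simp
  qed
qed

definition dact :: "complex ^ ('p::finite + 'q::finite) ^ ('p + 'q) \<Rightarrow>
    (complex ^ ('p + 'q)) set \<Rightarrow> complex ^ 'q ^ 'p \<Rightarrow> complex ^ 'q ^ 'p" where
  "dact g z = frechet_derivative (\<lambda>Z. coord (act g (graph Z))) (at (coord z))"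

text \<open>
  A complex-valued differential \<open>n\<close>-form on \<open>neg_planes\<close> sends a point to an alternating
  real-multilinear function of \<open>n\<close> tangent vectors, given as a list; it vanishes on lists of
  length other than \<open>n\<close>.
\<close>

type_synonym ('p, 'q) covector = "(complex ^ 'q ^ 'p) list \<Rightarrow> complex"
type_synonym ('p, 'q) diff_form = "(complex ^ ('p + 'q)) set \<Rightarrow> ('p, 'q) covector"

definition wedge :: "('t \<Rightarrow> complex) list \<Rightarrow> 't list \<Rightarrow> complex" where
  "wedge \<xi>s w = (if length w = length \<xi>s
     then \<Sum>\<pi> | \<pi> permutes {..<length w}. of_int (sign \<pi>) * (\<Prod>i<length w. (\<xi>s ! i) (w ! \<pi> i))
     else 0)"

definition mult_i :: "complex ^ 'q ^ 'p \<Rightarrow> complex ^ 'q ^ 'p" where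
  "mult_i w = (\<chi> \<alpha> \<mu>. \<i> * w $ \<alpha> $ \<mu>)"

text \<open>
  For a function \<open>f\<close> of the chart coordinate, \<open>\<partial>f(w) = (Df(w) - i Df(iw)) / 2\<close> and
  \<open>\<partial>bar f(w) = (Df(w) + i Df(iw)) / 2\<close>. In the chart, \<open>\<partial>(f dZ_I \<and> dZbar_J) = \<partial>f \<and> dZ_I \<and> dZbar_J\<close>;
  evaluating the product with the one-form \<open>\<partial>f\<close> on tangent vectors gives the alternating sum.
\<close>

definition del :: "('p::finite, 'q::finite) diff_form \<Rightarrow> ('p, 'q) diff_form" where
  "del \<omega> z w = (\<Sum>i<length w. (-1) ^ i *
     (let D = frechet_derivative (\<lambda>Z. \<omega> (graph Z) (take i w @ drop (Suc i) w)) (at (coord z))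
      in (D (w ! i) - \<i> * D (mult_i (w ! i))) / 2))"

definition delbar :: "('p::finite, 'q::finite) diff_form \<Rightarrow> ('p, 'q) diff_form" where
  "delbar \<omega> z w = (\<Sum>i<length w. (-1) ^ i *
     (let D = frechet_derivative (\<lambda>Z. \<omega> (graph Z) (take i w @ drop (Suc i) w)) (at (coord z))
      in (D (w ! i) + \<i> * D (mult_i (w ! i))) / 2))"

definition ext_d :: "('p::finite, 'q::finite) diff_form \<Rightarrow> ('p, 'q) diff_form" where
  "ext_d \<omega> z w = 1 / 2 * (del \<omega> z w + delbar \<omega> z w)"

definition ext_dc :: "('p::finite, 'q::finite) diff_form \<Rightarrow> ('p, 'q) diff_form" where
  "ext_dc \<omega> z w = 1 / (4 * of_real pi * \<i>) * (del \<omega> z w - delbar \<omega> z w)"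

text \<open>
  \<open>lie_X\<close> and \<open>lie_Y\<close> generate the one-parameter groups \<open>boost 1\<close> and \<open>boost \<i>\<close> (\<open>boost_flow\<close>), whose
  orbits through the base plane have velocities \<open>unit_vec 1\<close> and \<open>unit_vec \<i>\<close> in the chart
  (\<open>boost_velocity\<close>). Hence, on the complexified tangent space at the base plane, the basis dual to
  \<open>(X - Y i)/2\<close>, \<open>(X + Y i)/2\<close> consists of the matrix entries and their conjugates (\<open>xi_dual\<close>).
\<close>

definition lie_X :: "('p::finite + 'q::finite) \<Rightarrow> 'p + 'q \<Rightarrow> complex ^ ('p + 'q) \<Rightarrow> complex ^ ('p + 'q)" where
  "lie_X r s x = herm (axis r 1) x *s axis s 1 - herm (axis s 1) x *s axis r 1"

definition lie_Y :: "('p::finite + 'q::finite) \<Rightarrow> 'p + 'q \<Rightarrow> complex ^ ('p + 'q) \<Rightarrow> complex ^ ('p + 'q)" where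
  "lie_Y r s x = herm (\<i> *s axis r 1) x *s axis s 1 - herm (axis s 1) x *s (\<i> *s axis r 1)"

definition xi1 :: "'p \<Rightarrow> 'q \<Rightarrow> complex ^ 'q ^ 'p \<Rightarrow> complex" where
  "xi1 \<alpha> \<mu> w = w $ \<alpha> $ \<mu>"

definition xi2 :: "'p \<Rightarrow> 'q \<Rightarrow> complex ^ 'q ^ 'p \<Rightarrow> complex" where
  "xi2 \<alpha> \<mu> w = cnj (w $ \<alpha> $ \<mu>)"

definition unit_vec :: "complex \<Rightarrow> 'p \<Rightarrow> 'q \<Rightarrow> complex ^ 'q ^ 'p" where
  "unit_vec c \<alpha> \<mu> = (\<chi> \<beta> \<nu>. if \<beta> = \<alpha> \<and> \<nu> = \<mu> then c else 0)"

definition boost :: "complex \<Rightarrow> 'p \<Rightarrow> 'q \<Rightarrow> real \<Rightarrow> complex ^ ('p::finite + 'q::finite) ^ ('p + 'q)" where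
  "boost c \<alpha> \<mu> t = matrix (\<lambda>x. \<chi> r. case r of
     Inl \<beta> \<Rightarrow> if \<beta> = \<alpha> then of_real (cosh t) * x $ Inl \<alpha> + of_real (sinh t) * c * x $ Inr \<mu> else x $ Inl \<beta>
   | Inr \<nu> \<Rightarrow> if \<nu> = \<mu> then of_real (cosh t) * x $ Inr \<mu> + of_real (sinh t) * cnj c * x $ Inl \<alpha> else x $ Inr \<nu>)"

lemma boost_mult:
  "(boost c \<alpha> \<mu> t *v x) $ Inl \<beta> =
     (if \<beta> = \<alpha> then of_real (cosh t) * x $ Inl \<alpha> + of_real (sinh t) * c * x $ Inr \<mu> else x $ Inl \<beta>)"
  "(boost c \<alpha> \<mu> t *v x) $ Inr \<nu> =
     (if \<nu> = \<mu> then of_real (cosh t) * x $ Inr \<mu> + of_real (sinh t) * cnj c * x $ Inl \<alpha> else x $ Inr \<nu>)"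
  unfolding boost_def
  by (subst matrix_works; (unfold_locales)?; auto simp: vec_eq_iff algebra_simps split: sum.split)+

lemma lie_component:
  "lie_X (Inl \<alpha>) (Inr \<mu>) x $ Inl \<beta> = (if \<beta> = \<alpha> then x $ Inr \<mu> else 0)"
  "lie_X (Inl \<alpha>) (Inr \<mu>) x $ Inr \<nu> = (if \<nu> = \<mu> then x $ Inl \<alpha> else 0)"
  "lie_Y (Inl \<alpha>) (Inr \<mu>) x $ Inl \<beta> = (if \<beta> = \<alpha> then \<i> * x $ Inr \<mu> else 0)"
  "lie_Y (Inl \<alpha>) (Inr \<mu>) x $ Inr \<nu> = (if \<nu> = \<mu> then - \<i> * x $ Inl \<alpha> else 0)"
  by (auto simp: lie_X_def lie_Y_def herm_def axis_def if_distrib if_distribR cong: if_cong)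

lemma boost_0: "boost c \<alpha> \<mu> 0 = mat 1"
proof -
  have "boost c \<alpha> \<mu> 0 *v x = mat 1 *v x" for x
    unfolding vec_eq_iff
  proof
    show "(boost c \<alpha> \<mu> 0 *v x) $ r = (mat 1 *v x) $ r" for r
      by (cases r) (simp_all add: boost_mult)
  qed
  then show ?thesis using matrix_eq by blast
qed

lemma has_vector_derivative_vec:
  fixes f :: "real \<Rightarrow> 'a::euclidean_space ^ 'n"
  assumes "\<And>i. ((\<lambda>t. f t $ i) has_vector_derivative f' $ i) (at t)"
  shows "(f has_vector_derivative f') (at t)"
  unfolding has_vector_derivative_def
proof (subst has_derivative_componentwise_within, rule ballI)
  fix b :: "'a ^ 'n" assume "b \<in> Basis"
  then obtain i u where b: "b = axis i u" by (auto simp: Basis_vec_def)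
  have "((\<lambda>t. f t $ i) has_derivative (\<lambda>h. h *\<^sub>R f' $ i)) (at t)"
    using assms by (simp add: has_vector_derivative_def)
  then show "((\<lambda>t. f t \<bullet> b) has_derivative (\<lambda>h. (h *\<^sub>R f') \<bullet> b)) (at t)"
    unfolding b inner_axis using bounded_linear.has_derivative[OF bounded_linear_inner_left[of u]] by fastforce
qed

lemma boost_flow:
  assumes "c = 1 \<and> A = lie_X (Inl \<alpha>) (Inr \<mu>) \<or> c = \<i> \<and> A = lie_Y (Inl \<alpha>) (Inr \<mu>)"
  shows "((\<lambda>t. boost c \<alpha> \<mu> t *v x) has_vector_derivative A (boost c \<alpha> \<mu> t *v x)) (at t)"
proof (rule has_vector_derivative_vec)
  have cosh: "((\<lambda>t. complex_of_real (cosh t)) has_vector_derivative of_real (sinh t)) (at t)"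
    and sinh: "((\<lambda>t. complex_of_real (sinh t)) has_vector_derivative of_real (cosh t)) (at t)"
    by (auto intro!: has_vector_derivative_of_real derivative_eq_intros simp flip: has_real_derivative_iff_has_vector_derivative)
  have lin: "((\<lambda>t. of_real (cosh t) * a + of_real (sinh t) * u * b) has_vector_derivative
      of_real (sinh t) * a + of_real (cosh t) * u * b) (at t)" for a b u :: complex
    by (intro has_vector_derivative_add has_vector_derivative_mult_left cosh sinh)
  show "((\<lambda>t. (boost c \<alpha> \<mu> t *v x) $ r) has_vector_derivative A (boost c \<alpha> \<mu> t *v x) $ r) (at t)" for r
  proof (cases r)
    case (Inl \<beta>)
    then show ?thesis
      using assms lin[of "x $ Inl \<alpha>" c "x $ Inr \<mu>"]
      by (auto simp: boost_mult lie_component algebra_simps)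
  next
    case (Inr \<nu>)
    then show ?thesis
      using assms lin[of "x $ Inr \<mu>" "cnj c" "x $ Inl \<alpha>"]
      by (auto simp: boost_mult lie_component algebra_simps)
  qed
qed

lemma boost_orbit:
  "act (boost c \<alpha> \<mu> t) base_plane =
     graph (unit_vec (of_real (tanh t) * c) \<alpha> \<mu>)" (is "?L = graph ?Z")
proof
  have ch: "complex_of_real (cosh t) \<noteq> 0" by simp
  have th: "complex_of_real (sinh t) = of_real (tanh t) * of_real (cosh t)"
    unfolding of_real_mult[symmetric] by (simp add: tanh_def)
  have Z: "x \<in> graph ?Z \<longleftrightarrow>
      (\<forall>\<beta>. x $ Inl \<beta> = (if \<beta> = \<alpha> then of_real (tanh t) * c * x $ Inr \<mu> else 0))" for x
  proof -
    have "(\<Sum>\<nu>\<in>UNIV. ?Z $ \<beta> $ \<nu> * x $ Inr \<nu>) = (if \<beta> = \<alpha> then of_real (tanh t) * c * x $ Inr \<mu> else 0)" for \<beta>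
      by (cases "\<beta> = \<alpha>") (simp_all add: unit_vec_def if_distrib if_distribR cong: if_cong)
    then show ?thesis by (simp add: graph_def)
  qed
  have B: "x \<in> base_plane \<longleftrightarrow> (\<forall>\<beta>. x $ Inl \<beta> = 0)" for x :: "complex ^ ('a + 'b)"
    by (simp add: graph_def flip: graph_0)
  show "?L \<subseteq> graph ?Z"
    by (auto simp: act_def Z B boost_mult th)
  show "graph ?Z \<subseteq> ?L"
  proof
    fix y assume y: "y \<in> graph ?Z"
    define x :: "complex ^ ('a + 'b)" where
      "x = (\<chi> r. case r of Inl \<beta> \<Rightarrow> 0 | Inr \<nu> \<Rightarrow> if \<nu> = \<mu> then y $ Inr \<mu> / of_real (cosh t) else y $ Inr \<nu>)"
    have "y $ r = (boost c \<alpha> \<mu> t *v x) $ r" for r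
      using y ch by (cases r) (auto simp: Z boost_mult x_def th)
    then have "y = boost c \<alpha> \<mu> t *v x" by (simp add: vec_eq_iff)
    moreover have "x \<in> base_plane" by (simp add: B x_def)
    ultimately show "y \<in> ?L" by (auto simp: act_def)
  qed
qed

lemma boost_velocity:
  "((\<lambda>t. coord (act (boost c \<alpha> \<mu> t) base_plane)) has_vector_derivative
     unit_vec c \<alpha> \<mu>) (at 0)"
proof -
  have "((\<lambda>t. complex_of_real (tanh t) * c) has_vector_derivative c) (at 0)"
    by (auto intro!: has_vector_derivative_eq_rhs[OF has_vector_derivative_mult_left[OF has_vector_derivative_of_real]]
        derivative_eq_intros simp flip: has_real_derivative_iff_has_vector_derivative)
  then show ?thesis
    unfolding boost_orbit coord_graph
    by (intro has_vector_derivative_vec) (auto simp: unit_vec_def)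
qed

lemma xi_dual:
  "(xi1 \<beta> \<nu> (unit_vec 1 \<alpha> \<mu>) - \<i> * xi1 \<beta> \<nu> (unit_vec \<i> \<alpha> \<mu>)) / 2 = (if \<beta> = \<alpha> \<and> \<nu> = \<mu> then 1 else 0)"
  "(xi1 \<beta> \<nu> (unit_vec 1 \<alpha> \<mu>) + \<i> * xi1 \<beta> \<nu> (unit_vec \<i> \<alpha> \<mu>)) / 2 = 0"
  "(xi2 \<beta> \<nu> (unit_vec 1 \<alpha> \<mu>) - \<i> * xi2 \<beta> \<nu> (unit_vec \<i> \<alpha> \<mu>)) / 2 = 0"
  "(xi2 \<beta> \<nu> (unit_vec 1 \<alpha> \<mu>) + \<i> * xi2 \<beta> \<nu> (unit_vec \<i> \<alpha> \<mu>)) / 2 = (if \<beta> = \<alpha> \<and> \<nu> = \<mu> then 1 else 0)"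
  by (auto simp: xi1_def xi2_def unit_vec_def)


definition phi_zero :: "complex ^ ('p::finite + 'q::finite) \<Rightarrow> complex" where
  "phi_zero x = exp (- of_real (pi * (\<Sum>r\<in>UNIV. (cmod (x $ r))\<^sup>2)))"

definition D_op :: "'p \<Rightarrow> (complex ^ ('p::finite + 'q::finite) \<Rightarrow> complex) \<Rightarrow>
    complex ^ ('p + 'q) \<Rightarrow> complex" where
  "D_op \<alpha> f x = cnj (x $ Inl \<alpha>) * f x - 1 / of_real pi *
     ((frechet_derivative f (at x) (axis (Inl \<alpha>) 1) -
       \<i> * frechet_derivative f (at x) (axis (Inl \<alpha>) \<i>)) / 2)"

definition Dbar_op :: "'p \<Rightarrow> (complex ^ ('p::finite + 'q::finite) \<Rightarrow> complex) \<Rightarrow>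
    complex ^ ('p + 'q) \<Rightarrow> complex" where
  "Dbar_op \<alpha> f x = x $ Inl \<alpha> * f x - 1 / of_real pi *
     ((frechet_derivative f (at x) (axis (Inl \<alpha>) 1) +
       \<i> * frechet_derivative f (at x) (axis (Inl \<alpha>) \<i>)) / 2)"

definition D_phi :: "'p list \<Rightarrow> 'p list \<Rightarrow> complex ^ ('p::finite + 'q::finite) \<Rightarrow> complex" where
  "D_phi \<alpha>s \<beta>s = foldr D_op \<alpha>s (foldr Dbar_op \<beta>s phi_zero)"

text \<open>Multi-indices are lists, counted from \<open>0\<close>; \<open>neg_index k\<close> is the index \<open>p + k + 1\<close>.\<close>

definition neg_index :: "nat \<Rightarrow> 'q::{finite, linorder}" where
  "neg_index k = sorted_list_of_set UNIV ! k"

definition phi_KM_base :: "complex ^ ('p::finite + 'q::{finite, linorder}) \<Rightarrow> ('p, 'q) covector" where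
  "phi_KM_base x w = 1 / 2 ^ (2 * CARD('q)) *
     (\<Sum>\<alpha>s | length \<alpha>s = CARD('q). \<Sum>\<beta>s | length \<beta>s = CARD('q). D_phi \<alpha>s \<beta>s x *
        wedge ([xi1 (\<alpha>s ! k) (neg_index k). k \<leftarrow> [0..<CARD('q)]] @
               [xi2 (\<beta>s ! k) (neg_index k). k \<leftarrow> [0..<CARD('q)]]) w)"

definition skip :: "nat \<Rightarrow> nat \<Rightarrow> nat" where
  "skip j k = (if k < j then k else k - 1)"

text \<open>
  The sign of \<open>Omega\<close> is \<open>(-1)^(n(n-1)/2)\<close> with \<open>n = q - 1\<close>, the sign that reorders \<open>n\<close> pairs
  \<open>\<xi>'\<^sub>1 \<and> \<xi>''\<^sub>1 \<and> \<dots> \<and> \<xi>'\<^sub>n \<and> \<xi>''\<^sub>n\<close> to \<open>\<xi>'\<^sub>1 \<and> \<dots> \<and> \<xi>'\<^sub>n \<and> \<xi>''\<^sub>1 \<and> \<dots> \<and> \<xi>''\<^sub>n\<close>. The source prints it as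
  \<open>(-1)^(q(q-1)/2)\<close>; the two differ for even \<open>q\<close>, where the printed sign makes the asserted identity
  fail: on a product of \<open>q\<close> copies of the \<open>U(1,1)\<close> domain inside that of \<open>U(q,q)\<close>, with
  \<open>\<phi>\<^sub>i\<close>, \<open>\<psi>\<^sub>i\<close> the forms of the factors, \<open>\<phi>\<close> restricts to \<open>(-1)^(q(q-1)/2) \<phi>\<^sub>1 \<and> \<dots> \<and> \<phi>\<^sub>q\<close>, so \<open>\<psi>\<close> has to
  restrict to \<open>(-1)^(q(q-1)/2) (\<Sum>\<^sub>j \<psi>\<^sub>j \<and> (\<And>\<^sub>i\<^sub>\<noteq>\<^sub>j \<phi>\<^sub>i))\<close>, with no further factor \<open>(-1)^(q-1)\<close>.
\<close>

definition Omega :: "'p list \<Rightarrow> 'p list \<Rightarrow> ('p::finite, 'q::{finite, linorder}) covector" where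
  "Omega \<alpha>s \<beta>s w = (-1) ^ ((CARD('q) - 1) * (CARD('q) - 2) div 2) *
     (\<Sum>j<CARD('q). wedge (concat
        [[xi1 (\<alpha>s ! skip j k) (neg_index k), xi2 (\<beta>s ! skip j k) (neg_index k)].
           k \<leftarrow> [0..<CARD('q)], k \<noteq> j]) w)"

definition psi_base :: "complex ^ ('p::finite + 'q::{finite, linorder}) \<Rightarrow> ('p, 'q) covector" where
  "psi_base x w = 2 * \<i> * (-1) ^ (CARD('q) - 1) / 2 ^ (2 * (CARD('q) - 1)) *
     (\<Sum>\<alpha>s | length \<alpha>s = CARD('q) - 1. \<Sum>\<beta>s | length \<beta>s = CARD('q) - 1.
        D_phi \<alpha>s \<beta>s x * Omega \<alpha>s \<beta>s w)"

text \<open>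
  The invariant form with value \<open>F\<close> at the base plane: \<open>\<Phi>(x, z) = g\<^sup>* \<Phi>(gx, gz)\<close> for any \<open>g\<close> with
  \<open>gz\<close> the base plane; the choice of \<open>g\<close> does not matter when \<open>F\<close> is invariant under the stabilizer.
\<close>

definition invariant_form :: "(complex ^ ('p::finite + 'q::finite) \<Rightarrow> ('p, 'q) covector) \<Rightarrow>
    complex ^ ('p + 'q) \<Rightarrow> ('p, 'q) diff_form" where
  "invariant_form F x z w =
     (let g = (SOME g. g \<in> unitary_group \<and> act g z = base_plane)
      in F (g *v x) (map (dact g z) w))"

definition phi_KM :: "complex ^ ('p::finite + 'q::{finite, linorder}) \<Rightarrow> ('p, 'q) diff_form" where
  "phi_KM = invariant_form phi_KM_base"

definition psi :: "complex ^ ('p::finite + 'q::{finite, linorder}) \<Rightarrow> ('p, 'q) diff_form" where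
  "psi = invariant_form psi_base"

definition phi_KM0 :: "complex ^ ('p::finite + 'q::{finite, linorder}) \<Rightarrow> ('p, 'q) diff_form" where
  "phi_KM0 x z w = exp (of_real pi * herm x x) * phi_KM x z w"

definition psi0 :: "complex ^ ('p::finite + 'q::{finite, linorder}) \<Rightarrow> ('p, 'q) diff_form" where
  "psi0 x z w = exp (of_real pi * herm x x) * psi x z w"

definition phi_KM_tau ::
    "complex ^ ('p::finite + 'q::{finite, linorder}) \<Rightarrow> complex \<Rightarrow> ('p, 'q) diff_form" where
  "phi_KM_tau x \<tau> z w = phi_KM0 (sqrt (Im \<tau>) *\<^sub>R x) z w * exp (of_real pi * \<i> * herm x x * \<tau>)"

definition psi_tau ::
    "complex ^ ('p::finite + 'q::{finite, linorder}) \<Rightarrow> complex \<Rightarrow> ('p, 'q) diff_form" where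
  "psi_tau x \<tau> z w = of_real (Im \<tau>) * psi0 (sqrt (Im \<tau>) *\<^sub>R x) z w * exp (of_real pi * \<i> * herm x x * \<tau>)"

definition lowering :: "(complex \<Rightarrow> complex) \<Rightarrow> complex \<Rightarrow> complex" where
  "lowering f \<tau> = - 2 * \<i> * (of_real (Im \<tau>))\<^sup>2 *
     ((frechet_derivative f (at \<tau>) 1 + \<i> * frechet_derivative f (at \<tau>) \<i>) / 2)"

end

theory Submission
  imports Defs
begin

text \<open>
  Both forms are Berezin integrals over odd variables \<open>\<theta>\<close>, \<open>\<chi>\<close> (a coframe of the tautological
  \<open>q\<close>-plane bundle and of its conjugate). A further odd variable \<open>\<epsilon>\<^sub>j\<close> is attached to each tangent
  vector \<open>w\<^sub>j\<close>, so that the value of a form on the \<open>w\<^sub>j\<close> is the coefficient of the product of the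
  \<open>\<epsilon>\<^sub>j\<close>, and \<open>\<partial>\<close>, \<open>\<partial>bar\<close> become directional derivatives along the odd tangent vector
  \<open>W = \<Sum>\<^sub>j \<epsilon>\<^sub>j w\<^sub>j\<close>. In the chart \<open>Z\<close> put \<open>H = (1 - Z\<^sup>*Z)\<^sup>-\<^sup>1\<close>, \<open>G = 1 + Z H Z\<^sup>*\<close>,
  \<open>s = x\<^sub>- - Z\<^sup>*x\<^sub>+\<close>, \<open>t = H s\<close>, \<open>n\<^sup>* = x\<^sub>+\<^sup>* - t\<^sup>*Z\<^sup>*\<close>, \<open>m = x\<^sub>+ - Z x\<^sub>-\<close>, \<open>a = n\<^sup>*W\<close>, \<open>b = H W\<^sup>*G m\<close>,
  \<open>C = H W\<^sup>*G W\<close> and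
  \<open>E = - 2\<pi> s\<^sup>*t - 2 (a\<theta> + \<chi>b) - (2/\<pi>) \<chi>C\<theta>\<close>. Up to constants
  \<open>\<phi>\<^sup>0 = \<integral> exp E\<close> and \<open>\<psi>\<^sup>0 = - \<integral> \<chi>\<theta> exp E\<close>: at the base plane this is the generating function of the
  Hermite functions \<open>D\<^sub>\<alpha> Dbar\<^sub>\<beta> \<phi>\<^sub>0\<close>, and elsewhere it follows because the Berezin integral does not
  change under \<open>\<theta> \<mapsto> P\<theta>\<close>, \<open>\<chi> \<mapsto> \<chi>P\<^sup>-\<^sup>1\<close>.

  There are divergence-free odd derivations \<open>\<delta>'\<close>, \<open>\<delta>''\<close> in \<open>\<theta>\<close>, \<open>\<chi>\<close> with
  \<open>(\<partial> + \<delta>')E = (\<partial>bar + \<delta>'')E = 0\<close>. Integration by parts then gives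
  \<open>\<partial> \<integral> Y exp E = \<integral> (\<partial>Y + \<delta>'Y) exp E\<close> and likewise for \<open>\<partial>bar\<close>, so that \<open>dd\<^sup>c\<psi>\<^sup>0\<close> is computed from
  \<open>\<chi>\<theta>\<close> alone; the result is \<open>- \<integral> (2\<pi> s\<^sup>*t + a\<theta> + \<chi>b) exp E\<close>, which is \<open>v \<partial>/\<partial>v\<close> of
  \<open>\<integral> exp E(\<surd>v x)\<close>.
\<close>

text \<open>The derivations exist because \<open>E\<close> is the exponent of a superconnection. In
  the frame v \<mapsto> (Z v, v) of \<open>graph Z\<close> the negated form has Gram matrix
  \<open>Kmat Z\<close>, the inverse of H; \<open>om\<close> = H ct(Z) W is minus its Chern
  connection form, and C is the \<partial>bar-derivative of \<open>om\<close>. Both odd variables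
  are moved by the connection under \<delta>', which also shifts \<theta> by -\<pi> t, while
  \<delta>'' shifts \<chi> by \<pi> ct(s). The constants of \<open>E\<close> are visible at the base
  plane: the weight exp(\<pi>(x,x)) leaves -2\<pi> |x_-|^2 of the Gaussian, a raising operator
  applied to the Gaussian doubles a coordinate, and D meets Dbar with the contraction -1/\<pi>. Two
  obstacles shape the rest. \<open>psi\<close> takes only 2q - 2 tangent vectors, whereas
  \<open>E\<close> involves all 2q; a prefactor of two tangent variables repairs this, because odd
  squares vanish and it cannot see whether the removed vectors are still part of W. And the forms
  are transported by an unspecified unitary g, of which only two products, ct(a) a = G and ct(d) d =
  H, are determined; the remaining freedom is a change of frame, invisible to the Berezin
  integral.\<close>

section \<open>The Grassmann algebra\<close>

text \<open>
  \<open>gcoef x S\<close> is the coefficient of the product of the generators in \<open>S\<close>, taken in the order of an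
  arbitrary fixed enumeration of the index type.
\<close>

typedef 'i grassmann = "UNIV :: ('i::finite set \<Rightarrow> complex) set"
  morphisms gcoef Grassmann by simp

lemma gcoef_Grassmann [simp]: "gcoef (Grassmann f) = f"
  by (simp add: Grassmann_inverse)

lemma grassmann_eqI: "(\<And>S. gcoef x S = gcoef y S) \<Longrightarrow> x = y"
  by (metis ext gcoef_inject)

lemma grassmann_eq_iff: "x = y \<longleftrightarrow> (\<forall>S. gcoef x S = gcoef y S)"
  using grassmann_eqI by auto

definition rank :: "'i::finite \<Rightarrow> nat" where
  "rank = to_nat_on UNIV"

lemma rank_eq_iff [simp]: "rank i = rank j \<longleftrightarrow> i = (j::'i::finite)"
  unfolding rank_def using inj_on_to_nat_on[OF countable_finite[OF finite], of "UNIV::'i set"]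
  by (auto dest: injD)

definition inversions :: "'i::finite set \<Rightarrow> 'i set \<Rightarrow> ('i \<times> 'i) set" where
  "inversions A B = {(a, b). a \<in> A \<and> b \<in> B \<and> rank b < rank a}"

text \<open>For disjoint \<open>A\<close> and \<open>B\<close> this is the sign between the ordered
  product over \<open>A\<close> times the ordered product over \<open>B\<close> and the ordered
  product over their union.\<close>

definition gsign :: "'i::finite set \<Rightarrow> 'i set \<Rightarrow> complex" where
  "gsign A B = (-1) ^ card (inversions A B)"

lemma gsign_Un_left:
  assumes "A \<inter> A' = {}" shows "gsign (A \<union> A') B = gsign A B * gsign A' B"
proof -
  have "inversions (A \<union> A') B = inversions A B \<union> inversions A' B"
    "inversions A B \<inter> inversions A' B = {}"
    using assms by (auto simp: inversions_def)
  then show ?thesis by (simp add: gsign_def card_Un_disjoint power_add)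
qed

lemma gsign_Un_right:
  assumes "B \<inter> B' = {}" shows "gsign A (B \<union> B') = gsign A B * gsign A B'"
proof -
  have "inversions A (B \<union> B') = inversions A B \<union> inversions A B'"
    "inversions A B \<inter> inversions A B' = {}"
    using assms by (auto simp: inversions_def)
  then show ?thesis by (simp add: gsign_def card_Un_disjoint power_add)
qed

lemma gsign_square [simp]: "gsign A B * gsign A B = 1" "gsign A B * (gsign A B * c) = c"
proof -
  show *: "gsign A B * gsign A B = 1"
    by (simp add: gsign_def flip: power_add mult_2)
  show "gsign A B * (gsign A B * c) = c"
    using * by (metis mult.assoc mult.left_neutral)
qed

lemma gsign_empty [simp]: "gsign {} B = 1" "gsign A {} = 1"
  by (simp_all add: gsign_def inversions_def)

lemma cmod_gsign [simp]: "cmod (gsign A B) = 1"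
  by (simp add: gsign_def norm_power)

lemma gsign_nonzero [simp]: "gsign A B \<noteq> 0"
  by (simp add: gsign_def)

text \<open>Every pair in \<open>A \<times> B\<close> is an inversion of \<open>A\<close> before
  \<open>B\<close> or, read backwards, one of \<open>B\<close> before \<open>A\<close>, so the two
  inversion numbers add up to \<open>card A * card B\<close>.\<close>

lemma gsign_swap:
  assumes "A \<inter> B = {}" shows "gsign A B = (-1) ^ (card A * card B) * gsign B A"
proof -
  have swap: "prod.swap ` inversions B A = {(a, b). a \<in> A \<and> b \<in> B \<and> rank a < rank b}"
    by (auto simp: inversions_def image_iff)
  have "rank a < rank b \<or> rank b < rank a" if "a \<in> A" "b \<in> B" for a b
    using assms that by (metis disjoint_iff linorder_neqE_nat rank_eq_iff)
  then have "A \<times> B = inversions A B \<union> prod.swap ` inversions B A"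
    unfolding swap by (auto simp: inversions_def)
  moreover have "inversions A B \<inter> prod.swap ` inversions B A = {}"
    unfolding swap by (auto simp: inversions_def)
  ultimately have "card A * card B = card (inversions A B) + card (inversions B A)"
    by (metis card_Un_disjoint card_cartesian_product card_image finite inj_swap)
  then have "(-1) ^ (card A * card B) * gsign B A = gsign A B * (gsign B A * gsign B A)"
    by (simp add: gsign_def power_add mult_ac)
  then show ?thesis by simp
qed

instantiation grassmann :: (finite) real_algebra_1
begin

definition "0 = (Grassmann (\<lambda>S. 0) :: 'a grassmann)"
definition "1 = (Grassmann (\<lambda>S. if S = {} then 1 else 0) :: 'a grassmann)"
definition "x + y = Grassmann (\<lambda>S. gcoef x S + gcoef y S)" for x y :: "'a grassmann"
definition "x - y = Grassmann (\<lambda>S. gcoef x S - gcoef y S)" for x y :: "'a grassmann"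
definition "- x = Grassmann (\<lambda>S. - gcoef x S)" for x :: "'a grassmann"
definition "r *\<^sub>R x = Grassmann (\<lambda>S. r *\<^sub>R gcoef x S)" for x :: "'a grassmann"
definition "x * y = Grassmann (\<lambda>S. \<Sum>A\<in>Pow S. gsign A (S - A) * gcoef x A * gcoef y (S - A))"
  for x y :: "'a grassmann"

lemma gcoef_simps:
  "gcoef (0 :: 'a grassmann) S = 0"
  "gcoef (1 :: 'a grassmann) S = (if S = {} then 1 else 0)"
  "gcoef (x + y) S = gcoef x S + gcoef y S"
  "gcoef (x - y) S = gcoef x S - gcoef y S"
  "gcoef (- x) S = - gcoef x S"
  "gcoef (r *\<^sub>R x) S = r *\<^sub>R gcoef x S"
  by (simp_all add: zero_grassmann_def one_grassmann_def plus_grassmann_def minus_grassmann_def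
      uminus_grassmann_def scaleR_grassmann_def)

lemma gcoef_mult: "gcoef (x * y) S = (\<Sum>A\<in>Pow S. gsign A (S - A) * gcoef x A * gcoef y (S - A))"
  by (simp add: times_grassmann_def)

text \<open>Both bracketings are the same sum over ordered splittings of \<open>S\<close> into three
  blocks \<open>A\<close>, \<open>B\<close>, \<open>C\<close>, with the sign
  \<open>gsign A B * gsign A C * gsign B C\<close>; only the order in which the blocks are cut off
  differs.\<close>

lemma grassmann_mult_assoc: "x * y * z = x * (y * z)" for x y z :: "'a grassmann"
proof (rule grassmann_eqI)
  fix S :: "'a set"
  let ?f = "\<lambda>A B C. gsign A B * gsign A C * gsign B C * gcoef x A * gcoef y B * gcoef z C"
  have "gcoef (x * y * z) S = (\<Sum>A\<in>Pow S. \<Sum>B\<in>Pow A. ?f B (A - B) (S - A))"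
    unfolding gcoef_mult sum_distrib_left sum_distrib_right
  proof (intro sum.cong refl)
    fix A B assume "A \<in> Pow S" "B \<in> Pow A"
    then have "A = B \<union> (A - B)" by auto
    then have "gsign A (S - A) = gsign B (S - A) * gsign (A - B) (S - A)"
      by (metis Diff_disjoint gsign_Un_left)
    then show "gsign A (S - A) * (gsign B (A - B) * gcoef x B * gcoef y (A - B)) * gcoef z (S - A)
        = ?f B (A - B) (S - A)" by simp
  qed
  also have "\<dots> = (\<Sum>(A, B)\<in>Sigma (Pow S) Pow. ?f B (A - B) (S - A))"
    by (simp add: sum.Sigma)
  also have "\<dots> = (\<Sum>(A, B)\<in>(SIGMA A : Pow S. Pow (S - A)). ?f A B (S - A - B))"
    by (rule sum.reindex_bij_witness[of _ "\<lambda>(A, B). (A \<union> B, A)" "\<lambda>(A, B). (B, A - B)"])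
      (auto intro!: arg_cong2[where f="(*)"] arg_cong2[where f=gsign] arg_cong[where f="gcoef _"])
  also have "\<dots> = (\<Sum>A\<in>Pow S. \<Sum>B\<in>Pow (S - A). ?f A B (S - A - B))"
    by (simp add: sum.Sigma)
  also have "\<dots> = gcoef (x * (y * z)) S"
    unfolding gcoef_mult sum_distrib_left sum_distrib_right
  proof (intro sum.cong refl)
    fix A B assume "A \<in> Pow S" "B \<in> Pow (S - A)"
    then have "S - A = B \<union> (S - A - B)" by auto
    then have "gsign A (S - A) = gsign A B * gsign A (S - A - B)"
      by (metis Diff_disjoint gsign_Un_right)
    then show "?f A B (S - A - B) =
        gsign A (S - A) * gcoef x A * (gsign B (S - A - B) * gcoef y B * gcoef z (S - A - B))" by simp
  qed
  finally show "gcoef (x * y * z) S = gcoef (x * (y * z)) S" .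
qed

instance
proof
  fix x y z :: "'a grassmann" and r s :: real
  show "x + y + z = x + (y + z)" "x + y = y + x" "0 + x = x" "- x + x = 0" "x - y = x + - y"
    "r *\<^sub>R (x + y) = r *\<^sub>R x + r *\<^sub>R y" "(r + s) *\<^sub>R x = r *\<^sub>R x + s *\<^sub>R x"
    "r *\<^sub>R s *\<^sub>R x = (r * s) *\<^sub>R x" "1 *\<^sub>R x = x" "(0::'a grassmann) \<noteq> 1"
    by (simp_all add: grassmann_eq_iff gcoef_simps scaleR_add_right scaleR_add_left)
  show "x * y * z = x * (y * z)" by (rule grassmann_mult_assoc)
  show "1 * x = x"
    by (rule grassmann_eqI) (simp add: gcoef_mult gcoef_simps if_distrib if_distribR sum.delta cong: if_cong)
  show "x * 1 = x"
  proof (rule grassmann_eqI)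
    fix S
    have "gcoef (x * 1) S = (\<Sum>A\<in>Pow S. if A = S then gcoef x S else 0)"
      unfolding gcoef_mult by (intro sum.cong) (auto simp: gcoef_simps)
    then show "gcoef (x * 1) S = gcoef x S" by simp
  qed
  show "(x + y) * z = x * z + y * z" "x * (y + z) = x * y + x * z"
    by (simp_all add: grassmann_eq_iff gcoef_mult gcoef_simps algebra_simps flip: sum.distrib)
  show "r *\<^sub>R x * y = r *\<^sub>R (x * y)" "x * r *\<^sub>R y = r *\<^sub>R (x * y)"
    by (simp_all add: grassmann_eq_iff gcoef_mult gcoef_simps scaleR_sum_right)
qed

end

instantiation grassmann :: (finite) real_normed_algebra_1
begin

text \<open>The l1 norm of the coefficients is submultiplicative. It makes the algebra a Banach
  algebra, for which \<open>exp\<close> and Frechet derivatives are available.\<close>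

definition "norm x = (\<Sum>S\<in>UNIV. cmod (gcoef x S))" for x :: "'a grassmann"
definition "sgn x = x /\<^sub>R norm x" for x :: "'a grassmann"
definition "dist x y = norm (x - y)" for x y :: "'a grassmann"
definition "uniformity = (INF e\<in>{0 <..}. principal {(x::'a grassmann, y). dist x y < e})"
definition "open U \<longleftrightarrow> (\<forall>x\<in>U. eventually (\<lambda>(x', y). x' = x \<longrightarrow> y \<in> U) uniformity)"
  for U :: "'a grassmann set"

text \<open>A product collects pairs of coefficients with disjoint supports, and these are among all
  pairs counted by \<open>norm x * norm y\<close>.\<close>

lemma grassmann_norm_mult: "norm (x * y) \<le> norm x * norm y" for x y :: "'a grassmann"
proof -
  have "norm (x * y) \<le> (\<Sum>S\<in>UNIV. \<Sum>A\<in>Pow S. cmod (gcoef x A) * cmod (gcoef y (S - A)))"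
    unfolding norm_grassmann_def gcoef_mult
    by (intro sum_mono order.trans[OF norm_sum]) (simp add: norm_mult)
  also have "\<dots> = (\<Sum>(S, A)\<in>Sigma UNIV Pow. cmod (gcoef x A) * cmod (gcoef y (S - A)))"
    by (simp add: sum.Sigma)
  also have "\<dots> = (\<Sum>(A, B)\<in>{(A, B). A \<inter> B = {}}. cmod (gcoef x A) * cmod (gcoef y B))"
    by (rule sum.reindex_bij_witness[of _ "\<lambda>(A, B). (A \<union> B, A)" "\<lambda>(S, A). (A, S - A)"])
      (auto intro!: arg_cong[where f="\<lambda>S. cmod (gcoef y S)"])
  also have "\<dots> \<le> (\<Sum>(A, B)\<in>UNIV. cmod (gcoef x A) * cmod (gcoef y B))"
    by (intro sum_mono2) auto
  also have "\<dots> = norm x * norm y"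
    by (simp add: norm_grassmann_def sum_product sum.cartesian_product)
  finally show ?thesis .
qed

instance
proof
  fix x y z :: "'a grassmann" and r s :: real
  show "norm x = 0 \<longleftrightarrow> x = 0"
    by (simp add: norm_grassmann_def sum_nonneg_eq_0_iff grassmann_eq_iff gcoef_simps)
  show "norm (x + y) \<le> norm x + norm y"
    by (simp add: norm_grassmann_def gcoef_simps norm_triangle_ineq sum_mono flip: sum.distrib)
  show "norm (r *\<^sub>R x) = \<bar>r\<bar> * norm x"
    by (simp add: norm_grassmann_def gcoef_simps sum_distrib_left)
  show "norm (x * y) \<le> norm x * norm y" by (rule grassmann_norm_mult)
  show "norm (1 :: 'a grassmann) = 1"
    by (simp add: norm_grassmann_def gcoef_simps if_distrib cong: if_cong)
qed (simp_all add: sgn_grassmann_def dist_grassmann_def uniformity_grassmann_def open_grassmann_def)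

end

declare gcoef_simps [simp]

lemma gcoef_sum [simp]: "gcoef (sum f I) S = (\<Sum>i\<in>I. gcoef (f i) S)"
  by (induction I rule: infinite_finite_induct) auto

lemma norm_gcoef_le: "cmod (gcoef x S) \<le> norm x"
  unfolding norm_grassmann_def by (rule member_le_sum) auto

lemma bounded_linear_gcoef: "bounded_linear (\<lambda>x. gcoef x S)"
  by (rule bounded_linear_intro[where K=1]) (simp_all add: norm_gcoef_le)

instance grassmann :: (finite) banach
proof
  fix X :: "nat \<Rightarrow> 'a grassmann"
  assume "Cauchy X"
  then have "Cauchy (\<lambda>n. gcoef (X n) S)" for S
    by (rule bounded_linear.Cauchy[OF bounded_linear_gcoef])
  then obtain l where l: "(\<lambda>n. gcoef (X n) S) \<longlonglongrightarrow> l S" for S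
    unfolding Cauchy_convergent_iff convergent_def by metis
  have "(\<lambda>n. \<Sum>S\<in>UNIV. cmod (gcoef (X n) S - l S)) \<longlonglongrightarrow> (\<Sum>S\<in>(UNIV::'a set set). 0)"
    by (intro tendsto_sum tendsto_norm_zero LIM_zero l)
  then have "(\<lambda>n. norm (X n - Grassmann l)) \<longlonglongrightarrow> 0"
    by (simp add: norm_grassmann_def)
  then show "convergent X"
    unfolding convergent_def using LIM_zero_cancel tendsto_norm_zero_iff by blast
qed

section \<open>Scalars, parity and contractions\<close>

definition cs :: "complex \<Rightarrow> 'i::finite grassmann" where
  "cs c = Grassmann (\<lambda>S. if S = {} then c else 0)"

definition gen :: "'i::finite \<Rightarrow> 'i grassmann" where
  "gen i = Grassmann (\<lambda>S. if S = {i} then 1 else 0)"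

definition geven :: "'i::finite grassmann \<Rightarrow> bool" where
  "geven x \<longleftrightarrow> (\<forall>S. odd (card S) \<longrightarrow> gcoef x S = 0)"

definition godd :: "'i::finite grassmann \<Rightarrow> bool" where
  "godd x \<longleftrightarrow> (\<forall>S. even (card S) \<longrightarrow> gcoef x S = 0)"

lemma gcoef_cs [simp]: "gcoef (cs c) S = (if S = {} then c else 0)"
  by (simp add: cs_def)

lemma gcoef_cs_mult [simp]: "gcoef (cs c * x) S = c * gcoef x S"
  by (simp add: gcoef_mult if_distrib if_distribR cong: if_cong)

lemma cs_simps:
  "cs 0 = 0" "cs 1 = 1" "cs (c + d) = cs c + cs d" "cs (c - d) = cs c - cs d" "cs (- c) = - cs c"
  "cs (c * d) = cs c * cs d" "cs (of_real r) = of_real r"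
  by (simp_all add: grassmann_eq_iff of_real_def)

lemma cs_sum: "cs (sum f I) = (\<Sum>i\<in>I. cs (f i))"
  by (induction I rule: infinite_finite_induct) (auto simp: cs_simps)

lemma cs_scaleR: "cs (r *\<^sub>R c) = r *\<^sub>R cs c"
  by (simp add: grassmann_eq_iff)

lemma bounded_linear_cs: "bounded_linear cs"
proof (rule bounded_linear_intro[where K=1])
  show "norm (cs c) \<le> norm c * 1" for c
    by (simp add: norm_grassmann_def if_distrib cong: if_cong)
qed (simp_all add: cs_simps cs_scaleR)

lemma gcoef_mult_compl:
  "gcoef (y * x) S = (\<Sum>A\<in>Pow S. gsign (S - A) A * gcoef x A * gcoef y (S - A))"
  unfolding gcoef_mult
  by (rule sum.reindex_bij_witness[of _ "\<lambda>A. S - A" "\<lambda>A. S - A"])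
    (auto simp: double_diff)

lemma geven_commute: assumes "geven x" shows "x * y = y * x"
proof (rule grassmann_eqI)
  fix S
  show "gcoef (x * y) S = gcoef (y * x) S"
    unfolding gcoef_mult_compl[of y] gcoef_mult[of x y]
  proof (intro sum.cong refl)
    fix A assume "A \<in> Pow S"
    show "gsign A (S - A) * gcoef x A * gcoef y (S - A) = gsign (S - A) A * gcoef x A * gcoef y (S - A)"
    proof (cases "even (card A)")
      case True
      then have "gsign A (S - A) = gsign (S - A) A" by (subst gsign_swap) auto
      then show ?thesis by simp
    qed (use assms in \<open>simp add: geven_def\<close>)
  qed
qed

lemma godd_anticommute: assumes "godd x" "godd y" shows "x * y = - (y * x)"
proof (rule grassmann_eqI)
  fix S
  show "gcoef (x * y) S = gcoef (- (y * x)) S"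
    unfolding gcoef_mult_compl[of y] gcoef_mult[of x y] gcoef_simps sum_negf[symmetric]
  proof (intro sum.cong refl)
    fix A assume "A \<in> Pow S"
    show "gsign A (S - A) * gcoef x A * gcoef y (S - A) = - (gsign (S - A) A * gcoef x A * gcoef y (S - A))"
    proof (cases "odd (card A) \<and> odd (card (S - A))")
      case True
      then have "gsign A (S - A) = - gsign (S - A) A" by (subst gsign_swap) auto
      then show ?thesis by simp
    qed (use assms in \<open>auto simp: godd_def\<close>)
  qed
qed

lemma godd_square [simp]: assumes "godd x" shows "x * x = 0"
proof -
  have "x * x + x * x = 0" using godd_anticommute[OF assms assms] by (metis add.right_inverse)
  then show ?thesis by (simp flip: scaleR_2)
qed

lemma card_Pow_split: "A \<in> Pow S \<Longrightarrow> card (S::'i::finite set) = card A + card (S - A)"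
  using card_Un_disjoint[of A "S - A"] by (auto simp: Un_absorb1)

lemma geven_simps [simp]:
  "geven 0" "geven 1" "geven (cs c)"
  "geven x \<Longrightarrow> geven y \<Longrightarrow> geven (x + y)"
  "geven x \<Longrightarrow> geven y \<Longrightarrow> geven (x - y)"
  "geven x \<Longrightarrow> geven (- x)" "geven x \<Longrightarrow> geven (r *\<^sub>R x)"
  by (auto simp: geven_def)

lemma godd_simps [simp]:
  "godd 0" "godd (gen i)"
  "godd x \<Longrightarrow> godd y \<Longrightarrow> godd (x + y)"
  "godd x \<Longrightarrow> godd y \<Longrightarrow> godd (x - y)"
  "godd x \<Longrightarrow> godd (- x)" "godd x \<Longrightarrow> godd (r *\<^sub>R x)"
  by (auto simp: godd_def gen_def)

lemma parity_mult [simp]: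
  "geven x \<Longrightarrow> geven y \<Longrightarrow> geven (x * y)"
  "godd x \<Longrightarrow> godd y \<Longrightarrow> geven (x * y)"
  "geven x \<Longrightarrow> godd y \<Longrightarrow> godd (x * y)"
  "godd x \<Longrightarrow> geven y \<Longrightarrow> godd (x * y)"
  unfolding geven_def godd_def gcoef_mult
  by (intro allI impI sum.neutral ballI; drule card_Pow_split; metis add.commute even_add mult_zero_right mult_zero_left)+

lemma geven_sum [simp]: "(\<And>i. i \<in> I \<Longrightarrow> geven (f i)) \<Longrightarrow> geven (sum f I)"
  by (induction I rule: infinite_finite_induct) auto

lemma godd_sum [simp]: "(\<And>i. i \<in> I \<Longrightarrow> godd (f i)) \<Longrightarrow> godd (sum f I)"
  by (induction I rule: infinite_finite_induct) auto

lemma geven_power [simp]: "geven x \<Longrightarrow> geven (x ^ n)"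
  by (induction n) auto

lemma geven_prod_list [simp]: "(\<And>x. x \<in> set xs \<Longrightarrow> geven x) \<Longrightarrow> geven (prod_list xs)"
  by (induction xs) auto

lemma cs_commute: "x * cs c = cs c * x"
  by (simp add: geven_commute)

text \<open>The left derivative by the generator \<open>i\<close>: the sign moves
  \<open>gen i\<close> to the front of the ordered monomial, where it is struck out.\<close>

definition con :: "'i::finite \<Rightarrow> 'i grassmann \<Rightarrow> 'i grassmann" where
  "con i x = Grassmann (\<lambda>S. if i \<in> S then 0 else gsign {i} S * gcoef x (insert i S))"

lemma gcoef_con: "gcoef (con i x) S = (if i \<in> S then 0 else gsign {i} S * gcoef x (insert i S))"
  by (simp add: con_def)

lemma con_simps [simp]:
  "con i 0 = 0" "con i 1 = 0" "con i (cs c) = 0" "con i (x + y) = con i x + con i y"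
  "con i (x - y) = con i x - con i y" "con i (- x) = - con i x" "con i (r *\<^sub>R x) = r *\<^sub>R con i x"
  "con i (sum f I) = (\<Sum>j\<in>I. con i (f j))"
  by (auto simp: grassmann_eq_iff gcoef_con algebra_simps sum_distrib_left)

lemma con_gen: "con i (gen j) = (if i = j then 1 else 0)"
proof (rule grassmann_eqI)
  show "gcoef (con i (gen j)) S = gcoef (if i = j then 1 else 0) S" for S
    by (cases "S = {}") (auto simp: gcoef_con gen_def)
qed

lemma bounded_linear_con: "bounded_linear (con i)"
proof (rule bounded_linear_intro[where K=1])
  fix x :: "'a grassmann"
  have "norm (con i x) = (\<Sum>S\<in>{S. i \<notin> S}. cmod (gcoef x (insert i S)))"
    unfolding norm_grassmann_def
    by (rule sum.mono_neutral_cong_right) (auto simp: gcoef_con norm_mult)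
  also have "\<dots> = (\<Sum>S\<in>{S. i \<in> S}. cmod (gcoef x S))"
    by (rule sum.reindex_bij_witness[of _ "\<lambda>S. S - {i}" "insert i"]) (auto simp: insert_absorb)
  also have "\<dots> \<le> norm x"
    unfolding norm_grassmann_def by (rule sum_mono2) auto
  finally show "norm (con i x) \<le> norm x * 1" by simp
qed simp_all

text \<open>Encoding the parity of \<open>x\<close> by a sign \<open>e\<close> yields the even and
  the odd Leibniz rule at once. For \<open>i\<close> outside \<open>S\<close>, the subsets of
  \<open>insert i S\<close> with and without \<open>i\<close> give the two summands.\<close>

lemma con_mult_sign:
  assumes p: "\<And>S. gcoef x S \<noteq> 0 \<Longrightarrow> (-1) ^ card S = (e::complex)"
  shows "con i (x * y) = con i x * y + cs e * x * con i y"
proof (rule grassmann_eqI)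
  fix S
  have e: "(-1) ^ card A * gcoef x A = e * gcoef x A" for A using p[of A] by (cases "gcoef x A = 0") auto
  have split: "(\<Sum>A\<in>Pow (insert i B). f A) = (\<Sum>A\<in>Pow B. f A) + (\<Sum>A\<in>Pow B. f (insert i A))"
    if "i \<notin> B" for f :: "'a set \<Rightarrow> complex" and B
  proof -
    have "Pow B \<inter> insert i ` Pow B = {}" "inj_on (insert i) (Pow B)"
      using that by (auto intro!: inj_onI)
    then show ?thesis by (simp add: Pow_insert sum.union_disjoint sum.reindex)
  qed
  show "gcoef (con i (x * y)) S = gcoef (con i x * y + cs e * x * con i y) S"
  proof (cases "i \<in> S")
    case False
    have "gcoef (con i (x * y)) S = gsign {i} S * ((\<Sum>A\<in>Pow S. gsign A (insert i S - A) * gcoef x A * gcoef y (insert i S - A)) +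
       (\<Sum>A\<in>Pow S. gsign (insert i A) (S - A) * gcoef x (insert i A) * gcoef y (S - A)))"
      using False by (simp add: gcoef_con gcoef_mult split)
    also have "\<dots> = (\<Sum>A\<in>Pow S. gsign A (S - A) * gcoef (con i x) A * gcoef y (S - A))
        + (\<Sum>A\<in>Pow S. gsign A (S - A) * (e * gcoef x A) * gcoef (con i y) (S - A))"
      unfolding distrib_left sum_distrib_left add.commute[of "\<Sum>A\<in>Pow S. gsign A (S - A) * gcoef (con i x) A * gcoef y (S - A)"]
    proof (intro arg_cong2[where f="(+)"] sum.cong refl)
      fix A assume A: "A \<in> Pow S"
      have S: "gsign {i} S = gsign {i} A * gsign {i} (S - A)"
        using gsign_Un_right[of A "S - A" "{i}"] A by (auto simp: Un_absorb1)
      have B: "gsign A (insert i (S - A)) = gsign A {i} * gsign A (S - A)"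
        using gsign_Un_right[of "{i}" "S - A" A] False by simp
      have D: "gsign A {i} = (-1) ^ card A * gsign {i} A"
        using False A by (subst gsign_swap) auto
      have "gsign {i} S * gsign A (insert i S - A) = (-1) ^ card A * gsign {i} (S - A) * gsign A (S - A)"
        using False A by (auto simp: insert_Diff_if S B D mult_ac)
      then have "gsign {i} S * (gsign A (insert i S - A) * gcoef x A * gcoef y (insert i S - A)) =
        ((-1) ^ card A * gcoef x A) * gsign {i} (S - A) * gsign A (S - A) * gcoef y (insert i S - A)"
        by (simp add: mult_ac) 
      also have "\<dots> = gsign A (S - A) * (e * gcoef x A) * gcoef (con i y) (S - A)"
        using False A e[of A] by (auto simp: gcoef_con insert_Diff_if mult_ac)
      finally show "gsign {i} S * (gsign A (insert i S - A) * gcoef x A * gcoef y (insert i S - A)) =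
        gsign A (S - A) * (e * gcoef x A) * gcoef (con i y) (S - A)" .
      have E: "gsign (insert i A) (S - A) = gsign {i} (S - A) * gsign A (S - A)"
        using gsign_Un_left[of "{i}" A "S - A"] False A by auto
      show "gsign {i} S * (gsign (insert i A) (S - A) * gcoef x (insert i A) * gcoef y (S - A)) =
        gsign A (S - A) * gcoef (con i x) A * gcoef y (S - A)"
        using False A by (auto simp: gcoef_con S E mult_ac)
    qed
    also have "\<dots> = gcoef (con i x * y + cs e * x * con i y) S"
      by (simp only: gcoef_simps gcoef_mult[of "con i x"] gcoef_mult[of "cs e * x"] gcoef_cs_mult)
    finally show ?thesis .
  next
    case True
    \<comment> \<open>Now the left side vanishes. On the right, both products consist of the
      coefficients of \<open>x\<close> at \<open>insert i A\<close> and of \<open>y\<close> at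
      \<open>insert i (B - A)\<close>, with opposite signs.\<close>
    define B where "B = S - {i}"
    have B: "S = insert i B" "i \<notin> B" using True by (auto simp: B_def)
    have "gcoef (con i x * y) S = (\<Sum>A\<in>Pow B. gsign A (S - A) * gcoef (con i x) A * gcoef y (S - A))"
      unfolding gcoef_mult B(1) by (subst split[OF B(2)]) (simp add: gcoef_con)
    moreover have "gcoef (cs e * x * con i y) S =
        (\<Sum>A\<in>Pow B. gsign (insert i A) (B - A) * (e * gcoef x (insert i A)) * gcoef (con i y) (B - A))"
      unfolding gcoef_mult[of "cs e * x"] gcoef_cs_mult B(1)
      by (subst split[OF B(2)], subst sum.neutral) (use B in \<open>auto simp: gcoef_con\<close>)
    moreover have "gsign A (S - A) * gcoef (con i x) A * gcoef y (S - A) +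
        gsign (insert i A) (B - A) * (e * gcoef x (insert i A)) * gcoef (con i y) (B - A) = 0"
      if A: "A \<in> Pow B" for A
    proof -
      have SA: "S - A = insert i (B - A)" using A B by auto
      have i: "i \<notin> A" "i \<notin> B - A" using A B by auto
      have 1: "gsign A (insert i (B - A)) = gsign A {i} * gsign A (B - A)"
        using gsign_Un_right[of "{i}" "B - A" A] i by simp
      have 2: "gsign (insert i A) (B - A) = gsign {i} (B - A) * gsign A (B - A)"
        using gsign_Un_left[of "{i}" A "B - A"] i by simp
      have 3: "gsign A {i} = (-1) ^ card A * gsign {i} A"
        using i by (subst gsign_swap) auto
      have 4: "e * gcoef x (insert i A) = - ((-1) ^ card A * gcoef x (insert i A))"
        using e[of "insert i A"] i by simp
      show ?thesis
        unfolding SA 4 using B(2) by (simp add: gcoef_con i 1 2 3 mult_ac)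
    qed
    ultimately show ?thesis
      using True by (simp add: gcoef_con flip: sum.distrib)
  qed
qed

lemma con_mult_even: assumes "geven x" shows "con i (x * y) = con i x * y + x * con i y"
proof -
  have "(-1) ^ card S = (1::complex)" if "gcoef x S \<noteq> 0" for S
    using assms that by (metis geven_def neg_one_even_power)
  from con_mult_sign[OF this] show ?thesis by (simp add: cs_simps)
qed

lemma con_mult_odd: assumes "godd x" shows "con i (x * y) = con i x * y - x * con i y"
proof -
  have "(-1) ^ card S = (-1::complex)" if "gcoef x S \<noteq> 0" for S
    using assms that by (metis godd_def neg_one_odd_power)
  from con_mult_sign[OF this] show ?thesis by (simp add: cs_simps)
qed

text \<open>The Berezin integral over all generators, those of the tangent vectors included. Its
  sign depends on the arbitrary enumeration of the generators; the normalization \<open>c0\<close>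
  absorbs this later.\<close>

definition top_coef :: "'i::finite grassmann \<Rightarrow> complex" where
  "top_coef x = gcoef x UNIV"

lemma top_coef_con [simp]: "top_coef (con i x) = 0"
  by (simp add: top_coef_def gcoef_con)

lemma top_coef_eq_0: assumes "con i x = 0" shows "top_coef x = 0"
proof -
  have "gcoef (con i x) (UNIV - {i}) = 0" using assms by simp
  then show ?thesis by (simp add: gcoef_con top_coef_def)
qed

lemma top_coef_simps:
  "top_coef 0 = 0" "top_coef (x + y) = top_coef x + top_coef y" "top_coef (x - y) = top_coef x - top_coef y"
  "top_coef (- x) = - top_coef x" "top_coef (r *\<^sub>R x) = r *\<^sub>R top_coef x" "top_coef (cs c * x) = c * top_coef x"
  "top_coef (sum f I) = (\<Sum>i\<in>I. top_coef (f i))"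
  by (simp_all add: top_coef_def)

lemma bounded_linear_top_coef: "bounded_linear top_coef"
  unfolding top_coef_def by (rule bounded_linear_gcoef)

lemma gcoef_gen_mult: "i \<notin> S \<Longrightarrow> gcoef (gen i * x) (insert i S) = gsign {i} S * gcoef x S"
proof -
  assume i: "i \<notin> S"
  have "gcoef (gen i * x) (insert i S) = (\<Sum>A\<in>Pow (insert i S). if A = {i} then gsign {i} S * gcoef x S else 0)"
    unfolding gcoef_mult using i by (intro sum.cong) (auto simp: gen_def)
  then show ?thesis by simp
qed

lemma gcoef_prod_gen: "distinct is \<Longrightarrow> gcoef (prod_list (map gen is)) (set is) \<noteq> 0"
  by (induction "is") (auto simp: gcoef_gen_mult)

section \<open>The exponential series on even elements and its derivatives\<close>

lemma cs_power: "cs (c ^ n) = cs c ^ n"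
  by (induction n) (auto simp: cs_simps)

lemma cs_exp: "cs (exp c) = exp (cs c)"
proof -
  have "(\<lambda>n. cs (c ^ n /\<^sub>R fact n)) sums cs (exp c)"
    by (intro bounded_linear.sums[OF bounded_linear_cs] exp_converges)
  then have "(\<lambda>n. cs c ^ n /\<^sub>R fact n) sums cs (exp c)"
    by (simp add: cs_scaleR cs_power)
  then show ?thesis using exp_converges sums_unique2 by blast
qed

lemma geven_exp [simp]: assumes "geven x" shows "geven (exp x)"
  unfolding geven_def
proof (intro allI impI)
  fix S :: "'a set" assume "odd (card S)"
  then have "gcoef (x ^ n /\<^sub>R fact n) S = 0" for n
    using geven_power[OF assms, of n] by (simp add: geven_def)
  then have "(\<lambda>n. 0) sums gcoef (exp x) S"
    using bounded_linear.sums[OF bounded_linear_gcoef exp_converges[of x], of S] by simp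
  then show "gcoef (exp x) S = 0" using sums_0 sums_unique2 by blast
qed

lemma con_power:
  assumes "geven x" shows "con i (x ^ Suc n) = (1 + real n) *\<^sub>R (con i x * x ^ n)"
proof (induction n)
  case (Suc n)
  have "con i (x ^ Suc (Suc n)) = con i x * x ^ Suc n + x * con i (x ^ Suc n)"
    using con_mult_even[OF assms, of i "x ^ Suc n"] by simp
  also have "x * con i (x ^ Suc n) = (1 + real n) *\<^sub>R (x * con i x * x ^ n)"
    unfolding Suc by (simp add: mult.assoc)
  also have "x * con i x * x ^ n = con i x * x ^ Suc n"
    using geven_commute[OF assms, of "con i x"] by (simp add: mult.assoc)
  finally show ?case by (simp add: scaleR_left_distrib scaleR_2)
qed simp

text \<open>An even \<open>x\<close> commutes with \<open>con i x\<close>, so the series is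
  differentiated term by term as in a commutative algebra.\<close>

lemma con_exp: assumes "geven x" shows "con i (exp x) = con i x * exp x"
proof -
  have "con i (x ^ Suc n /\<^sub>R fact (Suc n)) = con i x * (x ^ n /\<^sub>R fact n)" for n
    by (simp add: con_power[OF assms] del: power_Suc)
  then have "(\<lambda>n. con i (x ^ Suc n /\<^sub>R fact (Suc n))) sums (con i x * exp x)"
    using sums_mult[OF exp_converges[of x], of "con i x"] by simp
  then have "(\<lambda>n. con i (x ^ n /\<^sub>R fact n)) sums (con i x * exp x)"
    by (rule sums_Suc_imp[rotated]) simp
  moreover have "(\<lambda>n. con i (x ^ n /\<^sub>R fact n)) sums con i (exp x)"
    by (intro bounded_linear.sums[OF bounded_linear_con] exp_converges)
  ultimately show ?thesis using sums_unique2 by blast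
qed

lemma exp_square_zero:
  fixes x :: "'a::{real_normed_algebra_1, banach}"
  assumes "x * x = 0" shows "exp x = 1 + x"
proof -
  have "x ^ n /\<^sub>R fact n = 0" if "n \<notin> {..<2}" for n
  proof -
    from that obtain k where "n = Suc (Suc k)" by (metis lessThan_iff less_2_cases_iff not0_implies_Suc One_nat_def)
    then show ?thesis using assms by (simp flip: mult.assoc)
  qed
  then have "(\<lambda>n. x ^ n /\<^sub>R fact n) sums (\<Sum>n<2. x ^ n /\<^sub>R fact n)"
    by (intro sums_finite) auto
  then have "(\<lambda>n. x ^ n /\<^sub>R fact n) sums (1 + x)"
    by (simp add: numeral_2_eq_2)
  then show ?thesis using exp_converges sums_unique2 by blast
qed

lemma norm_exp_remainder:
  fixes x :: "'a::{real_normed_algebra_1, banach}"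
  shows "norm (exp x - 1 - x) \<le> exp (norm x) - 1 - norm x"
proof -
  have *: "(\<lambda>n. y ^ (n + 2) /\<^sub>R fact (n + 2)) sums (exp y - 1 - y)"
    for y :: "'b::{real_normed_algebra_1, banach}"
    using sums_split_initial_segment[OF exp_converges[of y], of 2]
    by (simp add: numeral_2_eq_2 algebra_simps)
  have **: "norm (x ^ (n + 2) /\<^sub>R fact (n + 2)) \<le> norm x ^ (n + 2) /\<^sub>R fact (n + 2)" for n
    using norm_power_ineq[of x "n + 2"] by (simp add: mult_left_mono del: fact_Suc power_Suc)
  have "norm (exp x - 1 - x) = norm (\<Sum>n. x ^ (n + 2) /\<^sub>R fact (n + 2))"
    by (rule arg_cong[OF sums_unique[OF *]])
  also have "\<dots> \<le> (\<Sum>n. norm x ^ (n + 2) /\<^sub>R fact (n + 2))"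
    using *[of "norm x"] ** by (intro norm_suminf_le) (auto simp: sums_iff)
  also have "\<dots> = exp (norm x) - 1 - norm x"
    by (rule sym[OF sums_unique[OF *]])
  finally show ?thesis .
qed

text \<open>The remainder after the linear term is dominated by that of the real exponential at
  \<open>norm h\<close>, which reduces the claim to the real derivative at 0.\<close>

lemma has_derivative_exp_0: "(exp has_derivative (\<lambda>h. h)) (at (0::'a::{real_normed_algebra_1, banach}))"
  unfolding has_derivative_at
proof (intro conjI)
  have "((\<lambda>r. (exp r - exp 0 - r) / norm r) \<longlongrightarrow> 0) (at (0::real))"
  proof -
    have "(exp has_derivative (\<lambda>h. h)) (at (0::real))"
      using DERIV_exp[of "0::real"] unfolding has_field_derivative_def by (rule has_derivative_eq_rhs) auto
    then show ?thesis by (simp add: has_derivative_at tendsto_norm_zero_iff divide_inverse)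
         (subst (asm) tendsto_norm_zero_iff[symmetric], subst tendsto_norm_zero_iff[symmetric], simp add: abs_mult)
  qed
  then have "((\<lambda>r. (exp r - 1 - r) / r) \<longlongrightarrow> 0) (at (0::real))"
    by (subst tendsto_norm_zero_iff[symmetric], subst (asm) tendsto_norm_zero_iff[symmetric]) (simp add: abs_mult)
  moreover have "filterlim norm (at 0) (at (0::'a))"
    by (rule filterlim_atI) (auto simp: tendsto_norm_zero eventually_at_filter)
  ultimately have "((\<lambda>h::'a. (exp (norm h) - 1 - norm h) / norm h) \<longlongrightarrow> 0) (at 0)"
    by (rule filterlim_compose)
  then show "((\<lambda>h::'a. norm (exp (0 + h) - exp 0 - h) / norm h) \<longlongrightarrow> 0) (at 0)"
    by (rule tendsto_0_le[where K=1])
      (use norm_exp_remainder in \<open>auto intro!: always_eventually divide_right_mono order.trans[OF _ abs_ge_self]\<close>)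
qed simp

text \<open>An even value \<open>f z\<close> is central, hence
  \<open>exp (f y) = exp (f z) * exp (f y - f z)\<close> for every \<open>y\<close>, and only the
  derivative of \<open>exp\<close> at 0 is needed.\<close>

lemma has_derivative_exp_even:
  fixes f :: "'a::real_normed_vector \<Rightarrow> 'i::finite grassmann"
  assumes f: "(f has_derivative f') (at z)" and "geven (f z)"
  shows "((\<lambda>y. exp (f y)) has_derivative (\<lambda>h. exp (f z) * f' h)) (at z)"
proof -
  have "((\<lambda>y. f y - f z) has_derivative f') (at z)"
    using has_derivative_diff[OF f has_derivative_const[of "f z"]] by simp
  then have "((\<lambda>y. exp (f y - f z)) has_derivative f') (at z)"
    by (rule has_derivative_compose) (simp add: has_derivative_exp_0)
  then have "((\<lambda>y. exp (f z) * exp (f y - f z)) has_derivative (\<lambda>h. exp (f z) * f' h)) (at z)"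
    by (rule has_derivative_mult_right)
  moreover have "exp (f z) * exp (f y - f z) = exp (f y)" for y
    using exp_add_commuting[OF geven_commute[OF assms(2)], of "f y - f z"] by simp
  ultimately show ?thesis by simp
qed

text \<open>The derivation with \<open>gen i \<mapsto> c i\<close>; it is odd when all \<open>c i\<close> are even.\<close>

definition gder :: "('i::finite \<Rightarrow> 'i grassmann) \<Rightarrow> 'i grassmann \<Rightarrow> 'i grassmann" where
  "gder c x = (\<Sum>i\<in>UNIV. c i * con i x)"

lemma gder_simps [simp]:
  "gder c 0 = 0" "gder c (cs a) = 0" "gder c (x + y) = gder c x + gder c y"
  "gder c (x - y) = gder c x - gder c y" "gder c (- x) = - gder c x" "gder c (r *\<^sub>R x) = r *\<^sub>R gder c x"
  "gder c (sum f I) = (\<Sum>j\<in>I. gder c (f j))"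
  by (auto simp: gder_def algebra_simps sum.distrib sum_subtractf sum_negf scaleR_sum_right sum_distrib_left
      intro: sum.swap)

lemma gder_gen [simp]: "gder c (gen i) = c i"
  by (simp add: gder_def con_gen if_distrib cong: if_cong)

lemma gder_mult_even:
  assumes "geven x" shows "gder c (x * y) = gder c x * y + x * gder c y"
proof -
  have "c i * (x * con i y) = x * (c i * con i y)" for i
    using geven_commute[OF assms, of "c i"] by (simp flip: mult.assoc)
  then show ?thesis
    unfolding gder_def
    by (simp add: con_mult_even assms sum_distrib_left sum_distrib_right algebra_simps sum.distrib)
qed

lemma gder_mult_odd:
  assumes "godd x" "\<And>i. geven (c i)" shows "gder c (x * y) = gder c x * y - x * gder c y"
proof -
  have "c i * (x * con i y) = x * (c i * con i y)" for i
    using geven_commute[OF assms(2), of i x] by (simp flip: mult.assoc)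
  then show ?thesis
    unfolding gder_def
    by (simp add: con_mult_odd assms sum_distrib_left sum_distrib_right algebra_simps sum_subtractf)
qed

lemma gder_exp: "geven x \<Longrightarrow> gder c (exp x) = gder c x * exp x"
  by (simp add: gder_def con_exp sum_distrib_right mult.assoc)

text \<open>For even coefficients the derivation is a sum of contractions
  \<open>con i (c i * x)\<close> minus its divergence times \<open>x\<close>, and a contraction has
  no top coefficient. This is Stokes' theorem for a divergence-free odd vector field.\<close>

lemma top_coef_gder:
  assumes "\<And>i. geven (c i)" "(\<Sum>i\<in>UNIV. con i (c i)) = 0"
  shows "top_coef (gder c x) = 0"
proof -
  have "gder c x = (\<Sum>i\<in>UNIV. con i (c i * x)) - (\<Sum>i\<in>UNIV. con i (c i)) * x"
    by (simp add: gder_def con_mult_even assms(1) sum.distrib sum_distrib_right)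
  then show ?thesis by (simp add: assms(2) top_coef_simps)
qed

section \<open>Products of odd elements\<close>

lemma sum_lists_Suc:
  fixes F :: "'a list \<Rightarrow> 'b::comm_monoid_add"
  assumes "finite J"
  shows "(\<Sum>js | set js \<subseteq> J \<and> length js = Suc n. F js) =
    (\<Sum>j\<in>J. \<Sum>js | set js \<subseteq> J \<and> length js = n. F (j # js))"
proof -
  have "(\<Sum>js | set js \<subseteq> J \<and> length js = Suc n. F js) =
      (\<Sum>(j, js)\<in>J \<times> {js. set js \<subseteq> J \<and> length js = n}. F (j # js))"
    by (rule sum.reindex_bij_witness[of _ "\<lambda>(j, js). j # js" "\<lambda>js. (hd js, tl js)"])
      (auto simp: length_Suc_conv)
  then show ?thesis by (simp add: sum.cartesian_product)
qed

lemma prod_list_sum: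
  fixes g :: "nat \<Rightarrow> 'a \<Rightarrow> 'b::semiring_1"
  assumes "finite J"
  shows "prod_list (map (\<lambda>i. \<Sum>j\<in>J. g i j) [0..<n]) =
    (\<Sum>js | set js \<subseteq> J \<and> length js = n. prod_list (map (\<lambda>i. g i (js ! i)) [0..<n]))"
proof (induction n arbitrary: g)
  case 0
  then show ?case by (simp add: conj_commute cong: conj_cong)
next
  case (Suc n)
  have upt: "[0..<Suc n] = 0 # map Suc [0..<n]" by (simp add: upt_conv_Cons map_Suc_upt del: upt_Suc)
  have "prod_list (map (\<lambda>i. \<Sum>j\<in>J. g i j) [0..<Suc n]) =
      (\<Sum>j\<in>J. g 0 j) * prod_list (map (\<lambda>i. \<Sum>j\<in>J. g (Suc i) j) [0..<n])"
    unfolding upt by (simp add: comp_def)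
  also have "\<dots> = (\<Sum>js | set js \<subseteq> J \<and> length js = Suc n. prod_list (map (\<lambda>i. g i (js ! i)) [0..<Suc n]))"
    unfolding sum_lists_Suc[OF assms] upt Suc[of "\<lambda>i. g (Suc i)"]
    by (simp add: comp_def sum_distrib_left sum_distrib_right)
       (rule sum.swap)
  finally show ?case .
qed

lemma prod_list_cs:
  "prod_list (map (\<lambda>i. cs (a i) * e i) xs) = cs (prod_list (map a xs)) * prod_list (map e xs)"
proof (induction xs)
  case (Cons i xs)
  have "cs (a i) * e i * (cs (prod_list (map a xs)) * prod_list (map e xs)) =
    cs (a i) * (e i * cs (prod_list (map a xs))) * prod_list (map e xs)" by (simp add: mult.assoc)
  also have "e i * cs (prod_list (map a xs)) = cs (prod_list (map a xs)) * e i" by (rule cs_commute)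
  finally show ?case using Cons by (simp add: cs_simps mult.assoc)
qed (simp add: cs_simps)

lemma prod_list_odd_parity:
  "(\<And>x. x \<in> set xs \<Longrightarrow> godd x) \<Longrightarrow> geven (prod_list xs) \<or> godd (prod_list xs)"
  by (induction xs) auto

text \<open>In the exchange, \<open>x\<close> and \<open>y\<close> both pass the middle factor and
  the two signs cancel; the sign left over comes from \<open>x\<close> passing
  \<open>y\<close>.\<close>

lemma odd_swap:
  assumes "godd x" "godd y" "geven b \<or> godd b" shows "x * b * y = - (y * b * x)"
proof (cases "geven b")
  case True
  then have "x * b * y = b * (x * y)" "y * b * x = b * (y * x)"
    by (metis True geven_commute mult.assoc)+
  then show ?thesis using godd_anticommute[OF assms(1,2)] by simp
next
  case False
  then have b: "godd b" using assms by simp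
  have "x * b * y = - (b * x * y)" using godd_anticommute[OF assms(1) b] by simp
  moreover have "y * b * x = - (b * y * x)" using godd_anticommute[OF assms(2) b] by simp
  moreover have "b * x * y = - (b * y * x)" using godd_anticommute[OF assms(1,2)] by (simp add: mult.assoc)
  ultimately show ?thesis by simp
qed

lemma prod_list_not_distinct:
  assumes "\<not> distinct js" "\<And>j. godd (\<eta> j)" shows "prod_list (map \<eta> js) = 0"
proof -
  obtain xs ys zs y where js: "js = xs @ [y] @ ys @ [y] @ zs"
    using not_distinct_decomp[OF assms(1)] by blast
  have "geven (prod_list (map \<eta> ys)) \<or> godd (prod_list (map \<eta> ys))"
    by (rule prod_list_odd_parity) (auto simp: assms(2))
  from odd_swap[OF assms(2) assms(2) this, of y y]
  have "\<eta> y * prod_list (map \<eta> ys) * \<eta> y + \<eta> y * prod_list (map \<eta> ys) * \<eta> y = 0"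
    by (simp only: eq_neg_iff_add_eq_0)
  then have "\<eta> y * prod_list (map \<eta> ys) * \<eta> y = 0" by (simp flip: scaleR_2)
  then show ?thesis unfolding js by (simp flip: mult.assoc)
qed

lemma prod_list_transpose:
  assumes odd: "\<And>j. godd (\<eta> j)" and ab: "a < b" "b < n"
  shows "prod_list (map (\<lambda>i. \<eta> (Transposition.transpose a b i)) [0..<n]) = - prod_list (map \<eta> [0..<n])"
proof -
  have upt: "[0..<n] = [0..<a] @ [a] @ [Suc a..<b] @ [b] @ [Suc b..<n]"
  proof -
    have "[0..<n] = [0..<a] @ [a..<n]" using ab upt_add_eq_append[of 0 a "n - a"] by simp
    also have "[a..<n] = a # [Suc a..<n]" using ab by (simp add: upt_conv_Cons)
    also have "[Suc a..<n] = [Suc a..<b] @ [b..<n]" using ab upt_add_eq_append[of "Suc a" b "n - b"] by simp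
    also have "[b..<n] = b # [Suc b..<n]" using ab by (simp add: upt_conv_Cons)
    finally show ?thesis by simp
  qed
  have cong: "map (\<lambda>i. \<eta> (Transposition.transpose a b i)) xs = map \<eta> xs"
    if "a \<notin> set xs" "b \<notin> set xs" for xs
    using that by (intro map_cong) (auto simp: Transposition.transpose_def)
  let ?b = "prod_list (map \<eta> [Suc a..<b])"
  have "geven ?b \<or> godd ?b" by (rule prod_list_odd_parity) (auto simp: odd)
  note swap = odd_swap[OF odd odd this, of b a]
  have *: "\<eta> b * (?b * (\<eta> a * r)) = - (\<eta> a * (?b * (\<eta> b * r)))" for r
    using arg_cong[OF swap, of "\<lambda>x. x * r"] by (simp add: mult.assoc)
  show ?thesis unfolding upt using ab by (simp add: cong * del: upt_Suc)
qed

lemma prod_list_permutes: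
  assumes "\<pi> permutes {..<n}" and odd: "\<And>j. godd (\<eta> j)"
  shows "prod_list (map (\<lambda>i. \<eta> (\<pi> i)) [0..<n]) = cs (of_int (sign \<pi>)) * prod_list (map \<eta> [0..<n])"
  using assms(1) finite_lessThan odd
proof (induction \<pi> arbitrary: \<eta> rule: permutes_induct)
  case id
  then show ?case by (simp add: cs_simps)
next
  case (swap a b p)
  have perm: "permutation p" "permutation (Transposition.transpose a b)"
    using swap(4) permutation_permutes by (auto simp: permutation_swap_id)
  have "prod_list (map (\<lambda>i. \<eta> ((Transposition.transpose a b \<circ> p) i)) [0..<n]) =
      cs (of_int (sign p)) * prod_list (map (\<lambda>i. \<eta> (Transposition.transpose a b i)) [0..<n])"
    using swap(5)[of "\<lambda>i. \<eta> (Transposition.transpose a b i)"] swap(6) by simp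
  also have "prod_list (map (\<lambda>i. \<eta> (Transposition.transpose a b i)) [0..<n]) = - prod_list (map \<eta> [0..<n])"
    using prod_list_transpose[of \<eta> a b n] prod_list_transpose[of \<eta> b a n] swap(1-3,6)
    by (metis lessThan_iff linorder_neqE_nat transpose_commute)
  finally show ?case
    unfolding sign_compose[OF perm(2,1)] by (simp add: sign_swap_id swap(3) cs_simps)
qed

definition gdet :: "nat \<Rightarrow> (nat \<Rightarrow> nat \<Rightarrow> complex) \<Rightarrow> complex" where
  "gdet n c = (\<Sum>\<pi> | \<pi> permutes {..<n}. of_int (sign \<pi>) * (\<Prod>i<n. c i (\<pi> i)))"

text \<open>Expansion gives a sum over index lists. A repeated index kills a product of odd
  elements, and a list without repetition is a permutation whose sign is that of the
  reordering.\<close>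

lemma prod_list_linear_combinations:
  assumes odd: "\<And>j. godd (\<eta> j)"
  shows "prod_list (map (\<lambda>i. \<Sum>j<n. cs (c i j) * \<eta> j) [0..<n]) = cs (gdet n c) * prod_list (map \<eta> [0..<n])"
proof -
  let ?P = "\<lambda>f. prod_list (map f [0..<n])"
  have "?P (\<lambda>i. \<Sum>j<n. cs (c i j) * \<eta> j) =
      (\<Sum>js | set js \<subseteq> {..<n} \<and> length js = n. cs (\<Prod>i<n. c i (js ! i)) * prod_list (map \<eta> js))"
    unfolding prod_list_sum[OF finite_lessThan]
    by (intro sum.cong refl)
      (auto simp: prod_list_cs atLeast0LessThan prod.list_conv_set_nth
        intro!: arg_cong2[where f="(*)"] arg_cong[where f=cs] arg_cong[where f=prod_list] nth_equalityI)
  also have "\<dots> = (\<Sum>js | set js \<subseteq> {..<n} \<and> length js = n \<and> distinct js. cs (\<Prod>i<n. c i (js ! i)) * prod_list (map \<eta> js))"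
    by (rule sum.mono_neutral_right)
      (auto simp: finite_lists_length_eq prod_list_not_distinct odd)
  also have "\<dots> = (\<Sum>\<pi> | \<pi> permutes {..<n}. cs (\<Prod>i<n. c i (\<pi> i)) * ?P (\<lambda>i. \<eta> (\<pi> i)))"
  proof (rule sum.reindex_bij_witness[of _ "\<lambda>\<pi>. map \<pi> [0..<n]" "\<lambda>js i. if i < n then js ! i else i"])
    fix js assume js: "js \<in> {js. set js \<subseteq> {..<n} \<and> length js = n \<and> distinct js}"
    show "map (\<lambda>i. if i < n then js ! i else i) [0..<n] = js"
      using js by (intro nth_equalityI) auto
    have "bij_betw (\<lambda>i. if i < n then js ! i else i) {..<n} {..<n}"
    proof (rule bij_betwI')
      show "\<exists>i\<in>{..<n}. k = (if i < n then js ! i else i)" if k: "k \<in> {..<n}" for k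
      proof -
        have "card (set js) = card {..<n}" using js by (simp add: distinct_card)
        then have "set js = {..<n}" using js card_subset_eq by blast
        then obtain i where "i < length js" "js ! i = k" using k in_set_conv_nth[of k js] by auto
        then show ?thesis using js by (intro bexI[of _ i]) auto
      qed
    qed (use js in \<open>auto simp: nth_eq_iff_index_eq dest: nth_mem\<close>)
    then show "(\<lambda>i. if i < n then js ! i else i) \<in> {\<pi>. \<pi> permutes {..<n}}"
      unfolding mem_Collect_eq by (rule bij_imp_permutes) auto
    show "cs (\<Prod>i<n. c i (if i < n then js ! i else i)) * ?P (\<lambda>i. \<eta> (if i < n then js ! i else i)) =
        cs (\<Prod>i<n. c i (js ! i)) * prod_list (map \<eta> js)"
    proof -
      have "map (\<lambda>i. \<eta> (if i < n then js ! i else i)) [0..<n] = map \<eta> js"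
        using js by (intro nth_equalityI) auto
      then show ?thesis by simp
    qed
  next
    fix \<pi> assume "\<pi> \<in> {\<pi>. \<pi> permutes {..<n}}"
    then have p: "\<pi> permutes {..<n}" by simp
    show "(\<lambda>i. if i < n then map \<pi> [0..<n] ! i else i) = \<pi>"
      using permutes_not_in[OF p] by auto
    show "map \<pi> [0..<n] \<in> {js. set js \<subseteq> {..<n} \<and> length js = n \<and> distinct js}"
      using permutes_in_image[OF p] permutes_inj[OF p]
      by (auto simp: distinct_map inj_on_def dest: injD)
  qed
  also have "\<dots> = cs (gdet n c) * ?P \<eta>"
    unfolding gdet_def cs_sum sum_distrib_right
  proof (intro sum.cong refl)
    fix \<pi> assume "\<pi> \<in> {\<pi>. \<pi> permutes {..<n}}"
    then have "cs (\<Prod>i<n. c i (\<pi> i)) * ?P (\<lambda>i. \<eta> (\<pi> i)) =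
        cs (\<Prod>i<n. c i (\<pi> i)) * cs (of_int (sign \<pi>)) * ?P \<eta>"
      by (simp add: prod_list_permutes[of \<pi> n \<eta>, OF _ odd] mult.assoc)
    then show "cs (\<Prod>i<n. c i (\<pi> i)) * ?P (\<lambda>i. \<eta> (\<pi> i)) =
        cs (of_int (sign \<pi>) * (\<Prod>i<n. c i (\<pi> i))) * ?P \<eta>"
      unfolding cs_simps(6)[symmetric] by (simp only: mult.commute)
  qed
  finally show ?thesis .
qed

text \<open>This brings \<open>wedge\<close> into the algebra: each one-form is evaluated on the odd
  tangent vector, and the determinant of the resulting linear combinations is the alternating sum
  that defines \<open>wedge\<close>.\<close>

lemma prod_list_one_forms:
  assumes len: "length es = length \<xi>s" "length w = length \<xi>s" and odd: "\<And>x. x \<in> set es \<Longrightarrow> godd x"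
  shows "prod_list (map (\<lambda>\<xi>. \<Sum>j<length \<xi>s. es ! j * cs (\<xi> (w ! j))) \<xi>s) = cs (wedge \<xi>s w) * prod_list es"
proof -
  let ?n = "length \<xi>s" and ?\<eta> = "\<lambda>j. if j < length \<xi>s then es ! j else 0"
  have "map (\<lambda>\<xi>. \<Sum>j<?n. es ! j * cs (\<xi> (w ! j))) \<xi>s =
      map (\<lambda>i. \<Sum>j<?n. cs ((\<xi>s ! i) (w ! j)) * ?\<eta> j) [0..<?n]"
    by (rule nth_equalityI) (auto simp: cs_commute intro!: sum.cong)
  moreover have "map ?\<eta> [0..<?n] = es" using len by (intro nth_equalityI) auto
  moreover have "godd (?\<eta> j)" for j using odd len by auto
  ultimately show ?thesis
    using prod_list_linear_combinations[of ?\<eta> "\<lambda>i j. (\<xi>s ! i) (w ! j)" ?n] len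
    by (simp add: gdet_def wedge_def)
qed

lemma gdet_transpose: "gdet n (\<lambda>i j. c j i) = gdet n c"
proof -
  have "gdet n (\<lambda>i j. c j i) = (\<Sum>\<pi> | \<pi> permutes {..<n}. of_int (sign (inv \<pi>)) * (\<Prod>i<n. c (inv \<pi> i) i))"
    unfolding gdet_def
    by (rule sum.reindex_bij_witness[of _ inv inv]) (auto simp: permutes_inv permutes_inv_inv)
  also have "\<dots> = gdet n c"
    unfolding gdet_def
  proof (intro sum.cong refl arg_cong2[where f="(*)"])
    fix \<pi> assume "\<pi> \<in> {\<pi>. \<pi> permutes {..<n}}"
    then have p: "\<pi> permutes {..<n}" by simp
    show "of_int (sign (inv \<pi>)) = (of_int (sign \<pi>) :: complex)"
      using p sign_inverse permutation_permutes by (metis finite_lessThan)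
    show "(\<Prod>i<n. c (inv \<pi> i) i) = (\<Prod>i<n. c i (\<pi> i))"
      by (rule prod.reindex_bij_witness[of _ \<pi> "inv \<pi>"])
        (use p permutes_in_image[OF permutes_inv[OF p]] permutes_in_image[OF p] in
          \<open>auto simp: permutes_inverses\<close>)
  qed
  finally show ?thesis .
qed

text \<open>Inserting the combinations \<open>b\<close> into the combinations \<open>a\<close> gives
  back \<open>n\<close> distinct generators, and the coefficient of their product is nonzero. The
  injection \<open>f\<close> only supplies these generators.\<close>

lemma gdet_inverse:
  fixes f :: "nat \<Rightarrow> 'i::finite"
  assumes inj: "inj_on f {..<n}" and ab: "\<And>i k. i < n \<Longrightarrow> k < n \<Longrightarrow> (\<Sum>j<n. a i j * b j k) = (if i = k then 1 else 0)"
  shows "gdet n a * gdet n b = 1"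
proof -
  define \<eta> where "\<eta> = (\<lambda>j. \<Sum>k<n. cs (b j k) * gen (f k))"
  have odd: "godd (\<eta> j)" for j by (simp add: \<eta>_def)
  have "(\<Sum>j<n. cs (a i j) * \<eta> j) = gen (f i)" if i: "i < n" for i
  proof -
    have "(\<Sum>j<n. cs (a i j) * \<eta> j) = (\<Sum>k<n. cs (\<Sum>j<n. a i j * b j k) * gen (f k))"
      by (simp add: \<eta>_def sum_distrib_left sum_distrib_right cs_sum cs_simps mult.assoc) (rule sum.swap)
    also have "\<dots> = (\<Sum>k<n. if i = k then gen (f k) else 0)"
      using ab i by (intro sum.cong) (auto simp: cs_simps)
    finally show ?thesis using i by simp
  qed
  then have "prod_list (map (\<lambda>i. gen (f i)) [0..<n]) = prod_list (map (\<lambda>i. \<Sum>j<n. cs (a i j) * \<eta> j) [0..<n])"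
    by (intro arg_cong[where f=prod_list] map_cong) auto
  also have "\<dots> = cs (gdet n a * gdet n b) * prod_list (map (\<lambda>i. gen (f i)) [0..<n])"
    unfolding prod_list_linear_combinations[of \<eta>, OF odd]
    unfolding \<eta>_def prod_list_linear_combinations[of "\<lambda>k. gen (f k)" b n, OF godd_simps(2)]
    by (simp add: cs_simps mult.assoc)
  finally have "gcoef (prod_list (map gen (map f [0..<n]))) (set (map f [0..<n])) =
      gdet n a * gdet n b * gcoef (prod_list (map gen (map f [0..<n]))) (set (map f [0..<n]))"
    by (metis (no_types, lifting) gcoef_cs_mult map_map comp_apply map_cong)
  moreover have "distinct (map f [0..<n])" using inj by (simp add: distinct_map atLeast0LessThan)
  ultimately show ?thesis using gcoef_prod_gen by fastforce
qed

section \<open>Matrices with Grassmann entries\<close>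

lemma matrix_minus_left: "(- A) ** B = - (A ** (B :: 'a::ring_1 ^ 'c ^ 'b))"
  by (simp add: matrix_matrix_mult_def vec_eq_iff sum_negf)

lemma matrix_minus_right: "A ** (- B) = - (A ** (B :: 'a::ring_1 ^ 'c ^ 'b))"
  by (simp add: matrix_matrix_mult_def vec_eq_iff sum_negf)

lemma matrix_add_left: "(A + A') ** B = A ** B + A' ** (B :: 'a::ring_1 ^ 'c ^ 'b)"
  by (simp add: matrix_matrix_mult_def vec_eq_iff sum.distrib algebra_simps)

lemma matrix_diff_left: "(A - A') ** B = A ** B - A' ** (B :: 'a::ring_1 ^ 'c ^ 'b)"
  by (simp add: matrix_matrix_mult_def vec_eq_iff sum_subtractf algebra_simps)

lemma matrix_diff_right: "A ** (B - B') = A ** B - A ** (B' :: 'a::ring_1 ^ 'c ^ 'b)"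
  by (simp add: matrix_matrix_mult_def vec_eq_iff sum_subtractf algebra_simps)

lemma matrix_zero_left: "0 ** (B :: 'a::ring_1 ^ 'c ^ 'b) = 0"
  by (simp add: matrix_matrix_mult_def vec_eq_iff)

lemma matrix_zero_right: "(A :: 'a::ring_1 ^ 'b ^ 'd) ** 0 = 0"
  by (simp add: matrix_matrix_mult_def vec_eq_iff)

lemma matrix_scaleR_left: "(r *\<^sub>R A) ** B = r *\<^sub>R (A ** (B :: 'a::real_algebra_1 ^ 'c ^ 'b))"
  by (simp add: matrix_matrix_mult_def vec_eq_iff scaleR_sum_right)

lemma matrix_scaleR_right: "A ** (r *\<^sub>R B) = r *\<^sub>R (A ** (B :: 'a::real_algebra_1 ^ 'c ^ 'b))"
  by (simp add: matrix_matrix_mult_def vec_eq_iff scaleR_sum_right)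

lemmas matrix_ring_simps = matrix_add_ldistrib matrix_add_left matrix_diff_left matrix_diff_right
  matrix_minus_left matrix_minus_right matrix_zero_left matrix_zero_right
  matrix_scaleR_left matrix_scaleR_right matrix_mul_assoc[symmetric]

definition cm :: "complex ^ 'b ^ 'a \<Rightarrow> 'i::finite grassmann ^ 'b ^ 'a" where
  "cm A = (\<chi> i j. cs (A $ i $ j))"

definition ct :: "complex ^ 'b ^ 'a \<Rightarrow> complex ^ 'a ^ 'b" where
  "ct A = (\<chi> i j. cnj (A $ j $ i))"

definition meven :: "'i::finite grassmann ^ 'b ^ 'a \<Rightarrow> bool" where
  "meven A \<longleftrightarrow> (\<forall>i j. geven (A $ i $ j))"

definition modd :: "'i::finite grassmann ^ 'b ^ 'a \<Rightarrow> bool" where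
  "modd A \<longleftrightarrow> (\<forall>i j. godd (A $ i $ j))"

definition mder :: "('i::finite \<Rightarrow> 'i grassmann) \<Rightarrow> 'i grassmann ^ 'b ^ 'a \<Rightarrow> 'i grassmann ^ 'b ^ 'a" where
  "mder c A = (\<chi> i j. gder c (A $ i $ j))"

lemma cm_simps:
  "cm (A ** B) = cm A ** cm B" "cm (A + A') = cm A + cm A'" "cm (A - A') = cm A - cm A'"
  "cm (- A) = - cm A" "cm (mat 1) = mat 1" "cm 0 = 0" "cm (r *\<^sub>R A) = r *\<^sub>R cm A"
  by (auto simp: cm_def vec_eq_iff matrix_matrix_mult_def cs_sum cs_simps mat_def cs_scaleR)

lemma cm_nth: "cm A $ i $ j = cs (A $ i $ j)"
  by (simp add: cm_def)

lemma ct_simps: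
  "ct (A ** B) = ct B ** ct A" "ct (A + A') = ct A + ct A'" "ct (A - A') = ct A - ct A'"
  "ct (- A) = - ct A" "ct (mat 1) = mat 1" "ct 0 = 0" "ct (r *\<^sub>R A) = r *\<^sub>R ct A" "ct (ct A) = A"
  by (auto simp: ct_def vec_eq_iff matrix_matrix_mult_def mat_def mult.commute)

lemma meven_simps [simp]:
  "meven (cm X)" "meven 0" "meven A \<Longrightarrow> meven A' \<Longrightarrow> meven (A + A')" "meven A \<Longrightarrow> meven A' \<Longrightarrow> meven (A - A')"
  "meven A \<Longrightarrow> meven (- A)" "meven A \<Longrightarrow> meven (r *\<^sub>R A)" "meven (mat 1)"
  by (auto simp: meven_def cm_nth mat_def)

lemma modd_simps [simp]:
  "modd 0" "modd A \<Longrightarrow> modd A' \<Longrightarrow> modd (A + A')" "modd A \<Longrightarrow> modd A' \<Longrightarrow> modd (A - A')"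
  "modd A \<Longrightarrow> modd (- A)" "modd A \<Longrightarrow> modd (r *\<^sub>R A)"
  by (auto simp: modd_def)

lemma mparity_mult [simp]:
  "meven A \<Longrightarrow> meven B \<Longrightarrow> meven (A ** B)" "modd A \<Longrightarrow> modd B \<Longrightarrow> meven (A ** B)"
  "meven A \<Longrightarrow> modd B \<Longrightarrow> modd (A ** B)" "modd A \<Longrightarrow> meven B \<Longrightarrow> modd (A ** B)"
  by (auto simp: meven_def modd_def matrix_matrix_mult_def)

lemma mder_simps:
  "mder c (cm X) = 0" "mder c 0 = 0" "mder c (A + A') = mder c A + mder c A'" "mder c (A - A') = mder c A - mder c A'"
  "mder c (- A) = - mder c A" "mder c (r *\<^sub>R A) = r *\<^sub>R mder c A"
  by (auto simp: mder_def vec_eq_iff cm_nth)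

lemma mder_mult_even: "meven A \<Longrightarrow> mder c (A ** B) = mder c A ** B + A ** mder c B"
  by (auto simp: mder_def vec_eq_iff matrix_matrix_mult_def meven_def gder_mult_even sum.distrib)

lemma mder_mult_odd:
  "modd A \<Longrightarrow> (\<And>i. geven (c i)) \<Longrightarrow> mder c (A ** B) = mder c A ** B - A ** mder c B"
  by (auto simp: mder_def vec_eq_iff matrix_matrix_mult_def modd_def gder_mult_odd sum_subtractf)

text \<open>The inverse as an explicit rational function of the entries, whose differentiability is evident.\<close>

definition cramer_inv :: "complex ^ 'n ^ 'n \<Rightarrow> complex ^ 'n ^ 'n" where
  "cramer_inv A = (\<chi> k l. det (\<chi> i j. if j = k then (if i = l then 1 else 0) else A $ i $ j) / det A)"

lemma cramer_inv:
  assumes "det A \<noteq> 0" shows "A ** cramer_inv A = mat 1" "cramer_inv A ** A = mat 1"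
proof -
  have "A *v (\<chi> k. cramer_inv A $ k $ l) = axis l 1" for l
    using cramer[OF assms, of "\<chi> k. cramer_inv A $ k $ l" "axis l 1"]
    by (simp add: cramer_inv_def axis_def cong: if_cong)
  then have "(A ** cramer_inv A) $ k $ l = mat 1 $ k $ l" for k l
    by (simp add: vec_eq_iff matrix_vector_mult_def matrix_matrix_mult_def axis_def mat_def)
  then show *: "A ** cramer_inv A = mat 1" by (simp add: vec_eq_iff)
  then show "cramer_inv A ** A = mat 1" using matrix_left_right_inverse by blast
qed

lemma differentiable_prod:
  fixes f :: "'a \<Rightarrow> 'b::real_normed_vector \<Rightarrow> complex"
  assumes "\<And>i. i \<in> I \<Longrightarrow> f i differentiable (at x)"
  shows "(\<lambda>y. \<Prod>i\<in>I. f i y) differentiable (at x)"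
  using assms by (induction I rule: infinite_finite_induct) auto

lemma differentiable_det:
  fixes A :: "'b::real_normed_vector \<Rightarrow> complex ^ 'n ^ 'n"
  assumes "\<And>i j. (\<lambda>y. A y $ i $ j) differentiable (at x)"
  shows "(\<lambda>y. det (A y)) differentiable (at x)"
proof -
  have "(\<lambda>y. \<Prod>i\<in>UNIV. A y $ i $ p i) differentiable (at x)" for p
    by (rule differentiable_prod[of UNIV "\<lambda>i y. A y $ i $ p i"]) (rule assms)
  then show ?thesis unfolding det_def
    by (intro differentiable_sum differentiable_mult differentiable_const) auto
qed

lemma differentiable_cramer_inv:
  fixes A :: "'b::real_normed_vector \<Rightarrow> complex ^ 'n ^ 'n"
  assumes "\<And>i j. (\<lambda>y. A y $ i $ j) differentiable (at x)" "det (A x) \<noteq> 0"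
  shows "(\<lambda>y. cramer_inv (A y) $ k $ l) differentiable (at x)"
proof -
  have "(\<lambda>y. (\<chi> i j. if j = k then (if i = l then 1 else 0) else A y $ i $ j) $ i $ j) differentiable (at x)" for i j
    using assms(1)[of i j] by (cases "j = k") simp_all
  then have d: "(\<lambda>y. det (\<chi> i j. if j = k then (if i = l then 1 else 0) else A y $ i $ j)) differentiable (at x)"
    by (rule differentiable_det)
  show ?thesis
    unfolding cramer_inv_def vec_lambda_beta
    by (intro differentiable_divide d differentiable_det[OF assms(1)] assms(2))
qed

section \<open>Wirtinger calculus with odd tangent vectors\<close>

locale odd_tangent =
  fixes es :: "'i::finite grassmann list" and w :: "(complex ^ 'q::finite ^ 'p::finite) list"
  assumes len: "length es = length w" and odd: "\<And>x. x \<in> set es \<Longrightarrow> godd x"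
begin

lemma odd_nth: "j < length w \<Longrightarrow> godd (es ! j)"
  using odd len by simp

text \<open>
  For the derivative \<open>D\<close> of a function of \<open>Z\<close>, the values \<open>s = -\<i>\<close> and \<open>s = \<i>\<close> give \<open>\<partial>\<close> and
  \<open>\<partial>bar\<close> along \<open>\<Sum>\<^sub>j es\<^sub>j w\<^sub>j\<close>.
\<close>

definition dpm :: "complex \<Rightarrow> (complex ^ 'q ^ 'p \<Rightarrow> 'i grassmann) \<Rightarrow> 'i grassmann" where
  "dpm s D = (\<Sum>j<length w. es ! j * (cs (1/2) * (D (w ! j) + cs s * D (mult_i (w ! j)))))"

lemma dpm_add: "dpm s (\<lambda>h. D h + D' h) = dpm s D + dpm s D'"
  by (simp add: dpm_def algebra_simps sum.distrib)

lemma dpm_zero: "dpm s (\<lambda>h. 0) = 0"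
  by (simp add: dpm_def)

lemma dpm_mult_right: "dpm s (\<lambda>h. D h * c) = dpm s D * c"
  by (simp add: dpm_def sum_distrib_right algebra_simps)

lemma dpm_mult_even: assumes "geven c" shows "dpm s (\<lambda>h. c * D h) = c * dpm s D"
proof -
  have "es ! j * (cs (1/2) * (c * x + cs s * (c * y))) = c * (es ! j * (cs (1/2) * (x + cs s * y)))" for j x y
    using geven_commute[OF assms] by (simp add: algebra_simps)
  then show ?thesis by (simp add: dpm_def sum_distrib_left)
qed

lemma dpm_mult_odd: assumes "godd c" shows "dpm s (\<lambda>h. c * D h) = - (c * dpm s D)"
proof -
  have c: "cs a * (c * z) = c * (cs a * z)" for a z by (metis cs_commute mult.assoc)
  have "es ! j * (cs (1/2) * (c * x + cs s * (c * y))) = - (c * (es ! j * (cs (1/2) * (x + cs s * y))))"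
    if j: "j < length w" for j x y
  proof -
    have "es ! j * (cs (1/2) * (c * x + cs s * (c * y))) = es ! j * (c * (cs (1/2) * (x + cs s * y)))"
      by (simp add: distrib_left c)
    also have "\<dots> = - (c * es ! j) * (cs (1/2) * (x + cs s * y))"
      using godd_anticommute[OF odd_nth[OF j] assms] by (simp flip: mult.assoc)
    finally show ?thesis by (simp add: mult.assoc)
  qed
  then show ?thesis by (simp add: dpm_def sum_distrib_left flip: sum_negf)
qed

text \<open>A relation rather than two functions, so that differentiability travels together with
  the values: \<open>u\<close> is the \<partial>-derivative and \<open>v\<close> the
  \<partial>bar-derivative along the odd tangent vector.\<close>

definition dW :: "(complex ^ 'q ^ 'p \<Rightarrow> 'i grassmann) \<Rightarrow> complex ^ 'q ^ 'p \<Rightarrow> 'i grassmann \<Rightarrow> 'i grassmann \<Rightarrow> bool" where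
  "dW f Z u v \<longleftrightarrow> (\<exists>D. (f has_derivative D) (at Z) \<and> dpm (-\<i>) D = u \<and> dpm \<i> D = v)"

lemma dW_unique: assumes "dW f Z u v" "dW f Z u' v'" shows "u' = u \<and> v' = v"
  using assms has_derivative_unique unfolding dW_def by metis

lemma dW_transform:
  assumes "dW f Z u v" "open S" "Z \<in> S" "\<And>y. y \<in> S \<Longrightarrow> f y = g y" shows "dW g Z u v"
  using assms has_derivative_transform_within_open unfolding dW_def by blast

lemma dW_const: "dW (\<lambda>Z. c) Z 0 0"
  unfolding dW_def by (intro exI[of _ "\<lambda>h. 0"]) (simp add: dpm_zero)

lemma dW_add: "dW f Z u v \<Longrightarrow> dW g Z u' v' \<Longrightarrow> dW (\<lambda>Z. f Z + g Z) Z (u + u') (v + v')"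
  unfolding dW_def by (elim exE conjE, intro exI conjI, rule has_derivative_add) (auto simp: dpm_add)
    
lemma dW_mult_even:
  assumes "dW f Z u v" "dW g Z u' v'" "geven (f Z)"
  shows "dW (\<lambda>Z. f Z * g Z) Z (u * g Z + f Z * u') (v * g Z + f Z * v')"
proof -
  from assms obtain D D' where D: "(f has_derivative D) (at Z)" "dpm (-\<i>) D = u" "dpm \<i> D = v"
    "(g has_derivative D') (at Z)" "dpm (-\<i>) D' = u'" "dpm \<i> D' = v'" unfolding dW_def by auto
  show ?thesis unfolding dW_def
    by (rule exI[of _ "\<lambda>h. f Z * D' h + D h * g Z"])
      (use D assms(3) in \<open>auto intro!: has_derivative_mult simp: dpm_add dpm_mult_right dpm_mult_even\<close>)
qed

text \<open>The tangent variables stand on the left in \<open>dpm\<close>; passing the odd factor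
  \<open>f Z\<close> costs the minus sign.\<close>

lemma dW_mult_odd:
  assumes "dW f Z u v" "dW g Z u' v'" "godd (f Z)"
  shows "dW (\<lambda>Z. f Z * g Z) Z (u * g Z - f Z * u') (v * g Z - f Z * v')"
proof -
  from assms obtain D D' where D: "(f has_derivative D) (at Z)" "dpm (-\<i>) D = u" "dpm \<i> D = v"
    "(g has_derivative D') (at Z)" "dpm (-\<i>) D' = u'" "dpm \<i> D' = v'" unfolding dW_def by auto
  show ?thesis unfolding dW_def
    by (rule exI[of _ "\<lambda>h. f Z * D' h + D h * g Z"])
      (use D assms(3) in \<open>auto intro!: has_derivative_mult simp: dpm_add dpm_mult_right dpm_mult_odd\<close>)
qed

lemma dW_minus: "dW f Z u v \<Longrightarrow> dW (\<lambda>Z. - f Z) Z (- u) (- v)"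
  using dW_mult_even[OF dW_const[of "-1"], of f Z u v] by simp

lemma dW_diff: "dW f Z u v \<Longrightarrow> dW g Z u' v' \<Longrightarrow> dW (\<lambda>Z. f Z - g Z) Z (u - u') (v - v')"
  using dW_add[OF _ dW_minus] by fastforce

lemma dW_scaleR: "dW f Z u v \<Longrightarrow> dW (\<lambda>Z. r *\<^sub>R f Z) Z (r *\<^sub>R u) (r *\<^sub>R v)"
  using dW_mult_even[OF dW_const[of "r *\<^sub>R 1"], of f Z u v] by simp

lemma dW_sum: "(\<And>i. i \<in> I \<Longrightarrow> dW (f i) Z (u i) (v i)) \<Longrightarrow> dW (\<lambda>Z. \<Sum>i\<in>I. f i Z) Z (sum u I) (sum v I)"
  by (induction I rule: infinite_finite_induct) (auto simp: dW_const intro: dW_add)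

lemma dW_exp: assumes "dW f Z u v" "geven (f Z)" shows "dW (\<lambda>Z. exp (f Z)) Z (exp (f Z) * u) (exp (f Z) * v)"
proof -
  from assms obtain D where D: "(f has_derivative D) (at Z)" "dpm (-\<i>) D = u" "dpm \<i> D = v"
    unfolding dW_def by auto
  show ?thesis unfolding dW_def
    by (rule exI[of _ "\<lambda>h. exp (f Z) * D h"])
      (use D assms(2) in \<open>auto intro!: has_derivative_exp_even simp: dpm_mult_even\<close>)
qed

definition dWm :: "(complex ^ 'q ^ 'p \<Rightarrow> 'i grassmann ^ 'b ^ 'a) \<Rightarrow> complex ^ 'q ^ 'p \<Rightarrow>
    'i grassmann ^ 'b ^ 'a \<Rightarrow> 'i grassmann ^ 'b ^ 'a \<Rightarrow> bool" where
  "dWm F Z U V \<longleftrightarrow> (\<forall>i j. dW (\<lambda>Z. F Z $ i $ j) Z (U $ i $ j) (V $ i $ j))"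

lemma dWm_const: "dWm (\<lambda>Z. A) Z 0 0"
  by (simp add: dWm_def dW_const)

lemma dWm_add: "dWm F Z U V \<Longrightarrow> dWm G Z U' V' \<Longrightarrow> dWm (\<lambda>Z. F Z + G Z) Z (U + U') (V + V')"
  by (simp add: dWm_def dW_add)

lemma dWm_diff: "dWm F Z U V \<Longrightarrow> dWm G Z U' V' \<Longrightarrow> dWm (\<lambda>Z. F Z - G Z) Z (U - U') (V - V')"
  by (simp add: dWm_def dW_diff)

lemma dWm_scaleR: "dWm F Z U V \<Longrightarrow> dWm (\<lambda>Z. r *\<^sub>R F Z) Z (r *\<^sub>R U) (r *\<^sub>R V)"
  by (simp add: dWm_def dW_scaleR)

lemma dWm_mult_even:
  "dWm F Z U V \<Longrightarrow> dWm G Z U' V' \<Longrightarrow> meven (F Z) \<Longrightarrow>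
    dWm (\<lambda>Z. F Z ** G Z) Z (U ** G Z + F Z ** U') (V ** G Z + F Z ** V')"
  unfolding dWm_def matrix_matrix_mult_def meven_def
  by (simp flip: sum.distrib) (intro allI dW_sum dW_mult_even; simp)

lemma dWm_mult_odd:
  "dWm F Z U V \<Longrightarrow> dWm G Z U' V' \<Longrightarrow> modd (F Z) \<Longrightarrow>
    dWm (\<lambda>Z. F Z ** G Z) Z (U ** G Z - F Z ** U') (V ** G Z - F Z ** V')"
  unfolding dWm_def matrix_matrix_mult_def modd_def
  by (simp flip: sum_subtractf) (intro allI dW_sum dW_mult_odd; simp)

lemma dWm_eq: "dWm F Z U V \<Longrightarrow> U = U' \<Longrightarrow> V = V' \<Longrightarrow> dWm F Z U' V'"
  by simp

definition W :: "'i grassmann ^ 'q ^ 'p" where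
  "W = (\<chi> \<alpha> k. \<Sum>j<length w. es ! j * cs (w ! j $ \<alpha> $ k))"

definition Ws :: "'i grassmann ^ 'p ^ 'q" where
  "Ws = (\<chi> k \<alpha>. \<Sum>j<length w. es ! j * cs (cnj (w ! j $ \<alpha> $ k)))"

lemma modd_W [simp]: "modd W" "modd Ws"
  by (auto simp: modd_def W_def Ws_def intro!: godd_sum parity_mult odd_nth)

lemma dWm_Z: "dWm cm Z W 0"
  unfolding dWm_def dW_def
proof (intro allI exI conjI)
  fix \<alpha> k
  show "((\<lambda>Z. cm Z $ \<alpha> $ k) has_derivative (\<lambda>h. cs (h $ \<alpha> $ k))) (at Z)"
    unfolding cm_nth
    by (intro bounded_linear.has_derivative[OF bounded_linear_cs] has_derivative_bounded_linear
        bounded_linear.has_derivative[OF bounded_linear_vec_nth] has_derivative_ident)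
  have "cs (1/2) * (cs c + cs (-\<i>) * cs (\<i> * c)) = (cs c :: 'i grassmann)"
    "cs (1/2) * (cs c + cs \<i> * cs (\<i> * c)) = (0 :: 'i grassmann)" for c
    by (simp_all flip: cs_simps)
  then show "dpm (-\<i>) (\<lambda>h. cs (h $ \<alpha> $ k)) = W $ \<alpha> $ k" "dpm \<i> (\<lambda>h. cs (h $ \<alpha> $ k)) = 0 $ \<alpha> $ k"
    by (simp_all add: dpm_def W_def mult_i_def)
qed

lemma dWm_Zs: "dWm (\<lambda>Z. cm (ct Z)) Z 0 Ws"
  unfolding dWm_def dW_def
proof (intro allI exI conjI)
  fix \<alpha> k
  show "((\<lambda>Z. cm (ct Z) $ k $ \<alpha>) has_derivative (\<lambda>h. cs (cnj (h $ \<alpha> $ k)))) (at Z)"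
    unfolding cm_nth ct_def vec_lambda_beta
    by (intro bounded_linear.has_derivative[OF bounded_linear_cs] bounded_linear.has_derivative[OF bounded_linear_cnj]
        bounded_linear.has_derivative[OF bounded_linear_vec_nth] has_derivative_ident)
  have "cs (1/2) * (cs c + cs \<i> * cs (cnj \<i> * c)) = (cs c :: 'i grassmann)"
    "cs (1/2) * (cs c + cs (-\<i>) * cs (cnj \<i> * c)) = (0 :: 'i grassmann)" for c
    by (simp_all flip: cs_simps)
  then show "dpm (-\<i>) (\<lambda>h. cs (cnj (h $ \<alpha> $ k))) = 0 $ k $ \<alpha>" "dpm \<i> (\<lambda>h. cs (cnj (h $ \<alpha> $ k))) = Ws $ k $ \<alpha>"
    by (simp_all add: dpm_def Ws_def mult_i_def)
qed

end

section \<open>The superconnection identities\<close>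

text \<open>The Gram matrix of the negated Hermitian form in the frame v \<mapsto> (Z v, v) of
  \<open>graph Z\<close>; see \<open>herm_graph\<close>.\<close>

definition Kmat :: "complex ^ 'q ^ 'p \<Rightarrow> complex ^ 'q ^ 'q" where
  "Kmat Z = mat 1 - ct Z ** Z"

definition Hmat :: "complex ^ 'q ^ 'p \<Rightarrow> complex ^ 'q ^ 'q" where
  "Hmat Z = cramer_inv (Kmat Z)"

text \<open>The inverse of \<open>mat 1 - Z ** ct Z\<close>, expressed through \<open>Hmat\<close>
  so that no second matrix inversion has to be differentiated; see \<open>G_inverse\<close>.\<close>

definition Gmat :: "complex ^ 'q ^ 'p \<Rightarrow> complex ^ 'p ^ 'p" where
  "Gmat Z = mat 1 + Z ** Hmat Z ** ct Z"

definition pos_part :: "complex ^ ('p::finite + 'q::finite) \<Rightarrow> complex ^ 1 ^ 'p" where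
  "pos_part x = (\<chi> \<alpha> _. x $ Inl \<alpha>)"

definition neg_part :: "complex ^ ('p::finite + 'q::finite) \<Rightarrow> complex ^ 1 ^ 'q" where
  "neg_part x = (\<chi> \<mu> _. x $ Inr \<mu>)"

text \<open>In the notation of the introduction \<open>sst\<close>, \<open>tv\<close>, \<open>nst\<close>, \<open>mv\<close> are \<open>s\<^sup>*\<close>, \<open>t\<close>, \<open>n\<^sup>*\<close>, \<open>m\<close>.\<close>

definition sst :: "complex ^ ('p::finite + 'q::finite) \<Rightarrow> complex ^ 'q ^ 'p \<Rightarrow> complex ^ 'q ^ 1" where
  "sst x Z = ct (neg_part x) - ct (pos_part x) ** Z"

text \<open>Where \<open>Kmat Z\<close> is invertible these are the frame coordinates of the
  orthogonal projection x_z of \<open>x\<close> to \<open>graph Z\<close>, and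
  \<open>sst x Z ** tv x Z\<close> is -(x_z, x_z).\<close>

definition tv :: "complex ^ ('p::finite + 'q::finite) \<Rightarrow> complex ^ 'q ^ 'p \<Rightarrow> complex ^ 1 ^ 'q" where
  "tv x Z = Hmat Z ** (neg_part x - ct Z ** pos_part x)"

definition nst :: "complex ^ ('p::finite + 'q::finite) \<Rightarrow> complex ^ 'q ^ 'p \<Rightarrow> complex ^ 'p ^ 1" where
  "nst x Z = ct (pos_part x) - sst x Z ** Hmat Z ** ct Z"

definition mv :: "complex ^ ('p::finite + 'q::finite) \<Rightarrow> complex ^ 'q ^ 'p \<Rightarrow> complex ^ 1 ^ 'p" where
  "mv x Z = pos_part x - Z ** neg_part x"

lemma HK:
  assumes "det (Kmat Z) \<noteq> 0"
  shows "Kmat Z ** Hmat Z = mat 1" "Hmat Z ** Kmat Z = mat 1"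
  using cramer_inv[OF assms] by (simp_all add: Hmat_def)

lemma HZZ:
  assumes "det (Kmat Z) \<noteq> 0"
  shows "ct Z ** (Z ** Hmat Z) = Hmat Z - mat 1" "Hmat Z ** (ct Z ** Z) = Hmat Z - mat 1"
  using HK[OF assms] by (simp_all add: Kmat_def matrix_ring_simps algebra_simps)

lemma HZZ_left:
  assumes "det (Kmat Z) \<noteq> 0"
  shows "ct Z ** (Z ** (Hmat Z ** X)) = Hmat Z ** X - X" "Hmat Z ** (ct Z ** (Z ** X)) = Hmat Z ** X - X"
  using arg_cong[OF HZZ(1)[OF assms], of "\<lambda>A. A ** X"] arg_cong[OF HZZ(2)[OF assms], of "\<lambda>A. A ** X"]
  by (simp_all add: matrix_ring_simps)

lemma differentiable_Kmat: "(\<lambda>Z. Kmat Z $ i $ j) differentiable (at (Z :: complex ^ 'q::finite ^ 'p::finite))"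
proof -
  have 1: "bounded_linear (\<lambda>Z :: complex ^ 'q ^ 'p. Z $ a $ b)" for a b
    by (rule bounded_linear_compose[OF bounded_linear_vec_nth bounded_linear_vec_nth])
  then have 2: "bounded_linear (\<lambda>Z :: complex ^ 'q ^ 'p. cnj (Z $ a $ b))" for a b
    by (rule bounded_linear_compose[OF bounded_linear_cnj])
  have "(\<lambda>Z. cnj (Z $ k $ i) * Z $ k $ j) differentiable (at Z)" for k
    by (intro differentiable_mult bounded_linear_imp_differentiable[OF 1] bounded_linear_imp_differentiable[OF 2])
  then show ?thesis
    unfolding Kmat_def ct_def matrix_matrix_mult_def vector_minus_component vec_lambda_beta
    by (intro differentiable_diff differentiable_const differentiable_sum) auto
qed

lemma continuous_on_det_Kmat: "continuous_on S (\<lambda>Z :: complex ^ 'q::finite ^ 'p::finite. det (Kmat Z))"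
  by (intro continuous_at_imp_continuous_on ballI differentiable_imp_continuous_within
      differentiable_det differentiable_Kmat)

lemma open_det_Kmat: "open {Z :: complex ^ 'q::finite ^ 'p::finite. det (Kmat Z) \<noteq> 0}"
  by (intro open_Collect_neq continuous_on_det_Kmat continuous_on_const)

text \<open>Both sides are the positive component of x - x_z, with x_z the projection of
  \<open>x\<close> to \<open>graph Z\<close>. Through this identity the derivative of
  \<open>tv\<close> is expressed by \<open>bv\<close>.\<close>

lemma Gm_eq:
  assumes Z: "det (Kmat Z) \<noteq> 0"
  shows "Gmat Z ** mv x Z = pos_part x - Z ** tv x Z"
  by (simp add: Gmat_def mv_def tv_def matrix_ring_simps HZZ_left[OF Z] algebra_simps)

context odd_tangent
begin

lemma dWm_K: "dWm (\<lambda>Z. cm (Kmat Z)) Z (- (cm (ct Z) ** W)) (- (Ws ** cm Z))"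
  unfolding Kmat_def cm_simps
  by (rule dWm_eq[OF dWm_diff[OF dWm_const dWm_mult_even[OF dWm_Zs dWm_Z]]]) (simp_all add: matrix_ring_simps)

text \<open>Cramer's rule is used for differentiability only. The values follow by differentiating
  \<open>Kmat Z ** Hmat Z = mat 1\<close>, which holds on an open set.\<close>

lemma dWm_H:
  assumes Z: "det (Kmat Z) \<noteq> 0"
  shows "dWm (\<lambda>Z. cm (Hmat Z)) Z (cm (Hmat Z) ** cm (ct Z) ** W ** cm (Hmat Z))
    (cm (Hmat Z) ** Ws ** cm Z ** cm (Hmat Z))"
proof -
  have "\<exists>u v. dW (\<lambda>Z. cm (Hmat Z) $ k $ l) Z u v" for k l
  proof -
    obtain D where "((\<lambda>Z. Hmat Z $ k $ l) has_derivative D) (at Z)"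
      using differentiable_cramer_inv[OF differentiable_Kmat Z] unfolding Hmat_def differentiable_def by blast
    from bounded_linear.has_derivative[OF bounded_linear_cs this]
    show ?thesis unfolding cm_nth dW_def by blast
  qed
  then obtain u v where uv: "\<And>k l. dW (\<lambda>Z. cm (Hmat Z) $ k $ l) Z (u k l) (v k l)" by metis
  define U V :: "'i grassmann ^ 'q ^ 'q" where "U = (\<chi> k l. u k l)" and "V = (\<chi> k l. v k l)"
  have UV: "dWm (\<lambda>Z. cm (Hmat Z)) Z U V" by (simp add: dWm_def uv U_def V_def)
  have "dWm (\<lambda>Z. cm (Kmat Z) ** cm (Hmat Z)) Z (- (cm (ct Z) ** W) ** cm (Hmat Z) + cm (Kmat Z) ** U)
      (- (Ws ** cm Z) ** cm (Hmat Z) + cm (Kmat Z) ** V)"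
    by (rule dWm_mult_even[OF dWm_K UV]) simp
  moreover have "dWm (\<lambda>Z. cm (Kmat Z) ** cm (Hmat Z)) Z 0 0"
    unfolding dWm_def
  proof (intro allI)
    fix i j
    show "dW (\<lambda>Z. (cm (Kmat Z) ** cm (Hmat Z)) $ i $ j) Z (0 $ i $ j) (0 $ i $ j)"
      by (rule dW_transform[OF _ open_det_Kmat, of "\<lambda>Z. mat 1 $ i $ j"])
        (use Z in \<open>auto simp: dW_const HK cm_simps(1)[symmetric] cm_simps(5)\<close>)
  qed
  ultimately have "- (cm (ct Z) ** W) ** cm (Hmat Z) + cm (Kmat Z) ** U = 0"
    "- (Ws ** cm Z) ** cm (Hmat Z) + cm (Kmat Z) ** V = 0"
    unfolding dWm_def vec_eq_iff using dW_unique by blast+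
  then have KU: "cm (Kmat Z) ** U = cm (ct Z) ** W ** cm (Hmat Z)" "cm (Kmat Z) ** V = Ws ** cm Z ** cm (Hmat Z)"
    by (simp_all add: matrix_minus_left)
  have "cm (Hmat Z) ** cm (Kmat Z) = (mat 1 :: 'i grassmann ^ 'q ^ 'q)"
    using HK(2)[OF Z] by (metis cm_simps(1,5))
  then have "U = cm (Hmat Z) ** (cm (Kmat Z) ** U)" "V = cm (Hmat Z) ** (cm (Kmat Z) ** V)"
    by (simp_all add: matrix_mul_assoc)
  then show ?thesis using UV by (simp add: KU matrix_mul_assoc)
qed

text \<open>By \<open>dWm_K\<close> this is -H times the \<partial>-derivative of
  \<open>Kmat\<close>: minus the Chern connection form of the metric \<open>Kmat\<close> on the
  tautological bundle.\<close>

definition om :: "complex ^ 'q ^ 'p \<Rightarrow> 'i grassmann ^ 'q ^ 'q" where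
  "om Z = cm (Hmat Z) ** cm (ct Z) ** W"

definition Bm :: "complex ^ 'q ^ 'p \<Rightarrow> 'i grassmann ^ 'p ^ 'q" where
  "Bm Z = cm (Hmat Z) ** Ws ** cm (Gmat Z)"

text \<open>The \<partial>bar-derivative of \<open>om\<close>, hence the curvature up to
  sign.\<close>

definition Cm :: "complex ^ 'q ^ 'p \<Rightarrow> 'i grassmann ^ 'q ^ 'q" where
  "Cm Z = Bm Z ** W"

definition av :: "complex ^ ('p + 'q) \<Rightarrow> complex ^ 'q ^ 'p \<Rightarrow> 'i grassmann ^ 'q ^ 1" where
  "av x Z = cm (nst x Z) ** W"

definition bv :: "complex ^ ('p + 'q) \<Rightarrow> complex ^ 'q ^ 'p \<Rightarrow> 'i grassmann ^ 1 ^ 'q" where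
  "bv x Z = Bm Z ** cm (mv x Z)"

lemma parity_vm [simp]: "modd (om Z)" "modd (Bm Z)" "meven (Cm Z)" "modd (av x Z)" "modd (bv x Z)"
  by (simp_all add: om_def Bm_def Cm_def av_def bv_def)

lemma dWm_sst: "dWm (\<lambda>Z. cm (sst x Z)) Z (- (cm (ct (pos_part x)) ** W)) 0"
  unfolding sst_def cm_simps
  by (rule dWm_eq[OF dWm_diff[OF dWm_const dWm_mult_even[OF dWm_const dWm_Z]]]) (simp_all add: matrix_ring_simps)

lemma dWm_mv: "dWm (\<lambda>Z. cm (mv x Z)) Z (- (W ** cm (neg_part x))) 0"
  unfolding mv_def cm_simps
  by (rule dWm_eq[OF dWm_diff[OF dWm_const dWm_mult_even[OF dWm_Z dWm_const]]]) (simp_all add: matrix_ring_simps)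

text \<open>Splits the derivative of \<open>sst\<close> into a tensorial part \<open>av\<close> and
  a connection part, so that all later derivatives have covariant form.\<close>

lemma sst_om:
  "- (cm (ct (pos_part x)) ** W) = - av x Z - cm (sst x Z) ** om Z"
  by (simp add: av_def om_def nst_def cm_simps matrix_ring_simps)

lemma dWm_sst': "dWm (\<lambda>Z. cm (sst x Z)) Z (- av x Z - cm (sst x Z) ** om Z) 0"
  using dWm_sst[of x Z] unfolding sst_om[of x Z] by simp

text \<open>In the \<partial>bar-direction the product rule produces H Ws (Z t - x_+), and the
  bracket is -G m by \<open>Gm_eq\<close>.\<close>

lemma dWm_tv:
  assumes Z: "det (Kmat Z) \<noteq> 0"
  shows "dWm (\<lambda>Z. cm (tv x Z)) Z (om Z ** cm (tv x Z)) (- bv x Z)"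
proof -
  have "dWm (\<lambda>Z. cm (neg_part x) - cm (ct Z) ** cm (pos_part x)) Z 0 (- (Ws ** cm (pos_part x)))"
    by (rule dWm_eq[OF dWm_diff[OF dWm_const dWm_mult_even[OF dWm_Zs dWm_const]]]) (simp_all add: matrix_ring_simps)
  note d = dWm_mult_even[OF dWm_H[OF Z] this meven_simps(1)]
  have "bv x Z = cm (Hmat Z) ** Ws ** cm (pos_part x - Z ** tv x Z)"
    unfolding Gm_eq[OF Z, symmetric] by (simp add: bv_def Bm_def cm_simps matrix_mul_assoc)
  then show ?thesis
    unfolding tv_def cm_simps
    by (intro dWm_eq[OF d]) (simp_all add: om_def tv_def cm_simps matrix_ring_simps)
qed

lemma dWm_G:
  assumes Z: "det (Kmat Z) \<noteq> 0"
  shows "dWm (\<lambda>Z. cm (Gmat Z)) Z (cm (Gmat Z) ** W ** cm (Hmat Z) ** cm (ct Z))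
    (cm Z ** cm (Hmat Z) ** Ws ** cm (Gmat Z))"
  unfolding Gmat_def cm_simps
  by (rule dWm_eq[OF dWm_add[OF dWm_const dWm_mult_even[OF dWm_mult_even[OF dWm_Z dWm_H[OF Z]] dWm_Zs]]])
    (simp_all add: matrix_ring_simps)

lemma dWm_B:
  assumes Z: "det (Kmat Z) \<noteq> 0"
  shows "dWm Bm Z (om Z ** Bm Z - Bm Z ** W ** cm (Hmat Z) ** cm (ct Z)) 0"
  unfolding Bm_def
  by (rule dWm_eq[OF dWm_mult_odd[OF dWm_mult_even[OF dWm_H[OF Z] dWm_const] dWm_G[OF Z]]])
    (simp_all add: om_def matrix_ring_simps)

text \<open>The Bianchi identity for the curvature \<open>Cm\<close>.\<close>

lemma dWm_C:
  assumes Z: "det (Kmat Z) \<noteq> 0"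
  shows "dWm Cm Z (om Z ** Cm Z - Cm Z ** om Z) 0"
  unfolding Cm_def
  by (rule dWm_eq[OF dWm_mult_odd[OF dWm_B[OF Z] dWm_const]]) (simp_all add: om_def matrix_ring_simps)

lemma dWm_bv:
  assumes Z: "det (Kmat Z) \<noteq> 0"
  shows "dWm (bv x) Z (om Z ** bv x Z + Cm Z ** cm (tv x Z)) 0"
proof -
  \<comment> \<open>The derivative of \<open>mv\<close> contains x_-; this identity trades it for
    \<open>tv\<close> plus a connection term, which cancels the corresponding term in the derivative
    of \<open>Bm\<close>.\<close>
  have "tv x Z = neg_part x - Hmat Z ** ct Z ** mv x Z"
    by (simp add: tv_def mv_def matrix_ring_simps HZZ_left[OF Z] algebra_simps)
  then have t: "cm (tv x Z) = cm (neg_part x) - cm (Hmat Z) ** cm (ct Z) ** cm (mv x Z)"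
    by (simp add: cm_simps)
  show ?thesis
    unfolding bv_def t
    by (rule dWm_eq[OF dWm_mult_odd[OF dWm_B[OF Z] dWm_mv]]) (simp_all add: Cm_def matrix_ring_simps)
qed

lemma dWm_nst:
  assumes Z: "det (Kmat Z) \<noteq> 0"
  shows "dWm (\<lambda>Z. cm (nst x Z)) Z (cm (nst x Z) ** W ** cm (Hmat Z) ** cm (ct Z)) (- (cm (sst x Z) ** Bm Z))"
  unfolding nst_def cm_simps
  by (rule dWm_eq[OF dWm_diff[OF dWm_const dWm_mult_even[OF dWm_mult_even[OF dWm_sst dWm_H[OF Z]] dWm_Zs]]])
    (simp_all add: Bm_def Gmat_def cm_simps matrix_ring_simps)

lemma dWm_av:
  assumes Z: "det (Kmat Z) \<noteq> 0"
  shows "dWm (av x) Z (av x Z ** om Z) (- (cm (sst x Z) ** Cm Z))"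
  unfolding av_def
  by (rule dWm_eq[OF dWm_mult_even[OF dWm_nst[OF Z] dWm_const]]) (simp_all add: om_def Cm_def matrix_ring_simps)

definition Em :: "'i grassmann ^ 1 ^ 'q \<Rightarrow> 'i grassmann ^ 'q ^ 1 \<Rightarrow> complex ^ ('p + 'q) \<Rightarrow> complex ^ 'q ^ 'p \<Rightarrow>
    'i grassmann ^ 1 ^ 1" where
  "Em th ch x Z = - (2 * pi) *\<^sub>R (cm (sst x Z) ** cm (tv x Z)) - 2 *\<^sub>R (av x Z ** th + ch ** bv x Z)
     - (2 / pi) *\<^sub>R (ch ** Cm Z ** th)"

lemma meven_Em [simp]: "modd th \<Longrightarrow> modd ch \<Longrightarrow> meven (Em th ch x Z)"
  unfolding Em_def by (intro meven_simps mparity_mult) auto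

text \<open>The connection terms of the two factors of \<open>sst ** tv\<close> cancel, since their
  product is a scalar. In the other summands the connection terms remain, because \<theta> and
  \<chi> are still constant here; \<delta>' will remove them.\<close>

lemma dWm_Em:
  assumes Z: "det (Kmat Z) \<noteq> 0" and odd: "modd th" "modd ch"
  shows "dWm (Em th ch x) Z
    ((2 * pi) *\<^sub>R (av x Z ** cm (tv x Z)) - 2 *\<^sub>R (av x Z ** om Z ** th - ch ** (om Z ** bv x Z + Cm Z ** cm (tv x Z)))
      + (2 / pi) *\<^sub>R (ch ** (om Z ** Cm Z - Cm Z ** om Z) ** th))
    ((2 * pi) *\<^sub>R (cm (sst x Z) ** bv x Z) + 2 *\<^sub>R (cm (sst x Z) ** Cm Z ** th))"
proof -
  note d = dWm_diff[OF dWm_diff[OF dWm_scaleR[OF dWm_mult_even[OF dWm_sst' dWm_tv[OF Z]]]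
      dWm_scaleR[OF dWm_add[OF dWm_mult_odd[OF dWm_av[OF Z] dWm_const] dWm_mult_odd[OF dWm_const dWm_bv[OF Z]]]]]
      dWm_scaleR[OF dWm_mult_odd[OF dWm_mult_odd[OF dWm_const dWm_C[OF Z]] dWm_const]]]
  show ?thesis
    unfolding Em_def
    by (rule dWm_eq[OF d]) (use odd in \<open>simp_all add: matrix_ring_simps algebra_simps\<close>)
qed

text \<open>A derivation that kills \<open>W\<close> and \<open>Ws\<close> also kills
  \<open>av\<close>, \<open>bv\<close> and \<open>Cm\<close>, so only the explicit \<theta> and
  \<chi> are differentiated.\<close>

lemma mder_Em:
  assumes c: "\<And>i. geven (c i)" and w0: "mder c W = 0" "mder c Ws = 0" and odd: "modd th" "modd ch"
  shows "mder c (Em th ch x Z) = - 2 *\<^sub>R (mder c ch ** bv x Z - av x Z ** mder c th)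
    - (2 / pi) *\<^sub>R (mder c ch ** Cm Z ** th - ch ** Cm Z ** mder c th)"
proof -
  have B: "mder c (Bm Z) = 0"
    by (simp add: Bm_def mder_mult_even mder_mult_odd c w0 mder_simps matrix_ring_simps)
  have "mder c (av x Z) = 0" "mder c (bv x Z) = 0" "mder c (Cm Z) = 0"
    by (simp_all add: av_def bv_def Cm_def mder_mult_even mder_mult_odd c w0 B mder_simps matrix_ring_simps)
  then show ?thesis
    unfolding Em_def using odd
    by (simp add: mder_simps mder_mult_even mder_mult_odd c matrix_ring_simps algebra_simps)
qed

end

section \<open>Integration by parts in the odd variables\<close>

lemma top_coef_total_derivative:
  assumes c: "\<And>i. geven (c i)" "(\<Sum>i\<in>UNIV. con i (c i)) = 0" and \<eta>: "gder c \<eta> = 0" "geven \<eta> \<or> godd \<eta>"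
  shows "top_coef (\<eta> * gder c x) = 0"
proof -
  have "gder c (\<eta> * x) = \<eta> * gder c x \<or> gder c (\<eta> * x) = - (\<eta> * gder c x)"
    using \<eta> by (auto simp: gder_mult_even gder_mult_odd c)
  then show ?thesis
    using top_coef_gder[OF c, of "\<eta> * x"] by (auto simp: top_coef_simps)
qed

text \<open>With \<open>u\<close> the derivative of the exponent, \<open>u + gder c e = 0\<close>
  replaces differentiation of \<open>exp e\<close> by the derivation, and the total derivative
  \<open>gder c (Y * exp e)\<close> integrates to zero. The factor \<open>\<eta>\<close> will hold
  the variable of a removed tangent vector.\<close>

lemma integration_by_parts_even:
  assumes c: "\<And>i. geven (c i)" "(\<Sum>i\<in>UNIV. con i (c i)) = 0" and \<eta>: "gder c \<eta> = 0" "geven \<eta> \<or> godd \<eta>"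
    and e: "geven e" "u + gder c e = 0" and Y: "geven Y"
  shows "top_coef (\<eta> * (y * exp e + Y * (exp e * u))) = top_coef (\<eta> * ((y + gder c Y) * exp e))"
proof -
  have u: "exp e * u = - (gder c e * exp e)"
    using e(2) geven_commute[OF geven_exp[OF e(1)], of u] by (simp add: eq_neg_iff_add_eq_0[symmetric])
  have "\<eta> * (y * exp e + Y * (exp e * u)) = \<eta> * ((y + gder c Y) * exp e) - \<eta> * gder c (Y * exp e)"
    unfolding u by (simp add: gder_mult_even Y gder_exp e algebra_simps)
  then show ?thesis
    using top_coef_total_derivative[OF c \<eta>] by (simp add: top_coef_simps)
qed

lemma integration_by_parts_odd:
  assumes c: "\<And>i. geven (c i)" "(\<Sum>i\<in>UNIV. con i (c i)) = 0" and \<eta>: "gder c \<eta> = 0" "geven \<eta> \<or> godd \<eta>"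
    and e: "geven e" "u + gder c e = 0" and Y: "godd Y"
  shows "top_coef (\<eta> * (y * exp e - Y * (exp e * u))) = top_coef (\<eta> * ((y + gder c Y) * exp e))"
proof -
  have u: "exp e * u = - (gder c e * exp e)"
    using e(2) geven_commute[OF geven_exp[OF e(1)], of u] by (simp add: eq_neg_iff_add_eq_0[symmetric])
  have "\<eta> * (y * exp e - Y * (exp e * u)) = \<eta> * ((y + gder c Y) * exp e) - \<eta> * gder c (Y * exp e)"
    unfolding u by (simp add: gder_mult_odd c Y gder_exp e algebra_simps)
  then show ?thesis
    using top_coef_total_derivative[OF c \<eta>] by (simp add: top_coef_simps)
qed

text \<open>
  The \<open>2q\<close> indices \<open>Inl _\<close> belong to the tangent vectors, \<open>Inr (Inl k)\<close> to \<open>\<theta>\<^sub>k\<close> and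
  \<open>Inr (Inr k)\<close> to \<open>\<chi>\<^sub>k\<close>.
\<close>

type_synonym 'q gens = "('q + 'q) + ('q + 'q)"

definition th :: "'q::finite gens grassmann ^ 1 ^ 'q" where
  "th = (\<chi> k _. gen (Inr (Inl k)))"

definition ch :: "'q::finite gens grassmann ^ 'q ^ 1" where
  "ch = (\<chi> _ k. gen (Inr (Inr k)))"

lemma modd_th_ch [simp]: "modd th" "modd ch"
  by (auto simp: modd_def th_def ch_def)

definition cof :: "'q::finite gens grassmann ^ 1 ^ 'q \<Rightarrow> 'q gens grassmann ^ 'q ^ 1 \<Rightarrow>
    'q gens \<Rightarrow> 'q gens grassmann" where
  "cof A B i = (case i of Inl _ \<Rightarrow> 0 | Inr (Inl k) \<Rightarrow> A $ k $ 1 | Inr (Inr k) \<Rightarrow> B $ 1 $ k)"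

lemma geven_cof: "meven A \<Longrightarrow> meven B \<Longrightarrow> geven (cof A B i)"
  by (auto simp: cof_def meven_def split: sum.split)

lemma mder_cof [simp]: "mder (cof A B) th = A" "mder (cof A B) ch = B"
  by (simp_all add: mder_def th_def ch_def vec_eq_iff cof_def)

definition eps_only :: "'q::finite gens grassmann \<Rightarrow> bool" where
  "eps_only x \<longleftrightarrow> (\<forall>i. con (Inr i) x = 0)"

lemma eps_only_simps [simp]:
  "eps_only (cs c)" "eps_only 0" "eps_only 1" "eps_only (gen (Inl j))"
  "eps_only x \<Longrightarrow> eps_only y \<Longrightarrow> eps_only (x + y)"
  by (auto simp: eps_only_def con_gen)

lemma eps_only_mult:
  "eps_only x \<Longrightarrow> eps_only y \<Longrightarrow> geven x \<or> godd x \<Longrightarrow> eps_only (x * y)"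
  by (auto simp: eps_only_def con_mult_even con_mult_odd)

lemma eps_only_sum: "(\<And>i. i \<in> I \<Longrightarrow> eps_only (f i)) \<Longrightarrow> eps_only (sum f I)"
  by (simp add: eps_only_def)

lemma gder_cof_eps_only: "eps_only x \<Longrightarrow> gder (cof A B) x = 0"
  unfolding gder_def eps_only_def
  by (intro sum.neutral ballI) (auto simp: cof_def split: sum.split)

lemma sum_gens:
  "(\<Sum>i\<in>UNIV. f i) = (\<Sum>j\<in>UNIV. f (Inl j)) + ((\<Sum>k\<in>UNIV. f (Inr (Inl k))) + (\<Sum>k\<in>UNIV. f (Inr (Inr k))))"
  for f :: "'q::finite gens \<Rightarrow> 'a::comm_monoid_add"
  by (simp add: UNIV_Plus_UNIV[symmetric] sum.Plus del: UNIV_Plus_UNIV)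

lemma scaleR_complex: "r *\<^sub>R (c::complex) = of_real r * c"
  by (simp add: scaleR_conv_of_real)

locale eps_tangent = odd_tangent es w
  for es :: "'q::finite gens grassmann list" and w :: "(complex ^ 'q ^ 'p::finite) list" +
  assumes es_gen: "x \<in> set es \<Longrightarrow> \<exists>j. x = gen (Inl j)"
begin

lemma eps_only_es: "x \<in> set es \<Longrightarrow> eps_only x"
  using es_gen by fastforce

lemma eps_only_W [simp]: "eps_only (W $ \<alpha> $ k)" "eps_only (Ws $ k $ \<alpha>)"
  by (auto simp: W_def Ws_def len[symmetric] odd eps_only_es intro!: eps_only_sum eps_only_mult)

lemma mder_W: "mder (cof A B) W = 0" "mder (cof A B) Ws = 0"
  by (simp_all add: mder_def vec_eq_iff gder_cof_eps_only)

lemma eps_only_om: "eps_only (om Z $ k $ l)"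
  by (simp add: om_def cm_simps(1)[symmetric] matrix_matrix_mult_def cm_nth eps_only_sum eps_only_mult)

definition Eexp :: "complex ^ ('p + 'q) \<Rightarrow> complex ^ 'q ^ 'p \<Rightarrow> 'q gens grassmann" where
  "Eexp x Z = Em th ch x Z $ 1 $ 1"

lemma geven_Eexp [simp]: "geven (Eexp x Z)"
  using meven_Em[of th ch x Z] by (simp add: Eexp_def meven_def)

text \<open>The coefficients of the derivations \<open>\<delta>'\<close> and \<open>\<delta>''\<close>.\<close>

definition c1 :: "complex ^ ('p + 'q) \<Rightarrow> complex ^ 'q ^ 'p \<Rightarrow> 'q gens \<Rightarrow> 'q gens grassmann" where
  "c1 x Z = cof (om Z ** th - pi *\<^sub>R cm (tv x Z)) (ch ** om Z)"

definition c2 :: "complex ^ ('p + 'q) \<Rightarrow> complex ^ 'q ^ 'p \<Rightarrow> 'q gens \<Rightarrow> 'q gens grassmann" where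
  "c2 x Z = cof 0 (pi *\<^sub>R cm (sst x Z))"

lemma geven_c: "geven (c1 x Z i)" "geven (c2 x Z i)"
  unfolding c1_def c2_def by (intro geven_cof; simp)+

text \<open>The trace of \<open>om\<close> appears twice: with a minus sign from \<theta>, where the
  contraction passes the odd \<open>om\<close>, and with a plus sign from \<chi>, which stands on
  the left.\<close>

lemma div_c1: "(\<Sum>i\<in>UNIV. con i (c1 x Z i)) = 0"
proof -
  have *: "con (Inr i) (om Z $ k $ l) = 0" "godd (om Z $ k $ l)" for i k l
    using eps_only_om[of Z k l] parity_vm(1)[of Z] by (auto simp: eps_only_def modd_def)
  have "con (Inr (Inl k)) (c1 x Z (Inr (Inl k))) = - om Z $ k $ k" for k
    by (simp add: c1_def cof_def matrix_matrix_mult_def th_def cm_nth con_mult_odd * con_gen if_distrib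
        sum_negf cong: if_cong)
  moreover have "con (Inr (Inr k)) (c1 x Z (Inr (Inr k))) = om Z $ k $ k" for k
    by (simp add: c1_def cof_def matrix_matrix_mult_def ch_def con_mult_odd * con_gen if_distrib if_distribR cong: if_cong)
  moreover have "con (Inl j) (c1 x Z (Inl j)) = 0" for j
    by (simp add: c1_def cof_def)
  ultimately show ?thesis by (simp add: sum_gens sum_negf)
qed

lemma div_c2: "(\<Sum>i\<in>UNIV. con i (c2 x Z i)) = 0"
  by (rule sum.neutral) (auto simp: c2_def cof_def cm_nth split: sum.split)

definition E1 :: "complex ^ ('p + 'q) \<Rightarrow> complex ^ 'q ^ 'p \<Rightarrow> 'q gens grassmann" where
  "E1 x Z = ((2 * pi) *\<^sub>R (av x Z ** cm (tv x Z)) - 2 *\<^sub>R (av x Z ** om Z ** th - ch ** (om Z ** bv x Z + Cm Z ** cm (tv x Z)))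
      + (2 / pi) *\<^sub>R (ch ** (om Z ** Cm Z - Cm Z ** om Z) ** th)) $ 1 $ 1"

definition E2 :: "complex ^ ('p + 'q) \<Rightarrow> complex ^ 'q ^ 'p \<Rightarrow> 'q gens grassmann" where
  "E2 x Z = ((2 * pi) *\<^sub>R (cm (sst x Z) ** bv x Z) + 2 *\<^sub>R (cm (sst x Z) ** Cm Z ** th)) $ 1 $ 1"

lemma dW_Eexp: "det (Kmat Z) \<noteq> 0 \<Longrightarrow> dW (Eexp x) Z (E1 x Z) (E2 x Z)"
  using dWm_Em[of Z th ch x] unfolding dWm_def Eexp_def E1_def E2_def by auto

lemma gder_Eexp: "gder c (Eexp x Z) = mder c (Em th ch x Z) $ 1 $ 1"
  by (simp add: Eexp_def mder_def)

text \<open>The rotation of \<theta> and \<chi> by \<open>om\<close> removes the connection terms.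
  The shift of \<theta> by -\<pi> t serves two terms at once: inserted in -2 a\<theta> it cancels
  2\<pi> at, and inserted in -(2/\<pi>) \<chi>C\<theta> it cancels 2 \<chi>Ct.\<close>

lemma E1_cancel: "E1 x Z + gder (c1 x Z) (Eexp x Z) = 0"
proof -
  have "mder (c1 x Z) (Em th ch x Z) =
    - ((2 * pi) *\<^sub>R (av x Z ** cm (tv x Z)) - 2 *\<^sub>R (av x Z ** om Z ** th - ch ** (om Z ** bv x Z + Cm Z ** cm (tv x Z)))
      + (2 / pi) *\<^sub>R (ch ** (om Z ** Cm Z - Cm Z ** om Z) ** th))"
    by (subst mder_Em[OF geven_c(1)])
      (simp_all add: c1_def mder_W matrix_ring_simps algebra_simps)
  then show ?thesis unfolding gder_Eexp E1_def by simp
qed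

text \<open>Replacing \<chi> by \<pi> ct(s) in -2 \<chi>b and in -(2/\<pi>) \<chi>C\<theta> produces
  the two terms to be cancelled.\<close>

lemma E2_cancel: "E2 x Z + gder (c2 x Z) (Eexp x Z) = 0"
proof -
  have "mder (c2 x Z) (Em th ch x Z) =
    - ((2 * pi) *\<^sub>R (cm (sst x Z) ** bv x Z) + 2 *\<^sub>R (cm (sst x Z) ** Cm Z ** th))"
    by (subst mder_Em[OF geven_c(2)])
      (simp_all add: c2_def mder_W matrix_ring_simps algebra_simps)
  then show ?thesis unfolding gder_Eexp E2_def by simp
qed

definition Nel :: "'q gens grassmann" where
  "Nel = - ((ch ** th) $ 1 $ 1)"

lemma geven_Nel [simp]: "geven Nel"
  using mparity_mult(2)[OF modd_th_ch(2,1)] unfolding Nel_def meven_def by (intro geven_simps(6)) blast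

definition Y1 :: "complex ^ ('p + 'q) \<Rightarrow> complex ^ 'q ^ 'p \<Rightarrow> 'q gens grassmann" where
  "Y1 x Z = (ch ** cm (tv x Z)) $ 1 $ 1"

definition Y2 :: "complex ^ ('p + 'q) \<Rightarrow> complex ^ 'q ^ 'p \<Rightarrow> 'q gens grassmann" where
  "Y2 x Z = (cm (sst x Z) ** th) $ 1 $ 1"

lemma godd_Y [simp]: "godd (Y1 x Z)" "godd (Y2 x Z)"
proof -
  have "modd (ch ** cm (tv x Z))" "modd (cm (sst x Z) ** th)" by simp_all
  then show "godd (Y1 x Z)" "godd (Y2 x Z)" by (simp_all add: Y1_def Y2_def modd_def)
qed

text \<open>\<open>Nel\<close> is constant in \<open>Z\<close>, so only the exponent contributes;
  after integration by parts this becomes \<delta>' and \<delta>'' of \<open>Nel\<close>, which are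
  -\<pi> times \<open>Y1\<close> and \<open>Y2\<close>.\<close>

lemma dW_level1:
  assumes Z: "det (Kmat Z) \<noteq> 0" and \<eta>: "eps_only \<eta>" "geven \<eta> \<or> godd \<eta>"
  shows "\<exists>u v. dW (\<lambda>Z. Nel * exp (Eexp x Z)) Z u v \<and>
    top_coef (\<eta> * u) = - pi * top_coef (\<eta> * (Y1 x Z * exp (Eexp x Z))) \<and>
    top_coef (\<eta> * v) = - pi * top_coef (\<eta> * (Y2 x Z * exp (Eexp x Z)))"
proof (intro exI conjI)
  note d = dW_mult_even[OF dW_const[of Nel] dW_exp[OF dW_Eexp[OF Z] geven_Eexp] geven_Nel]
  show "dW (\<lambda>Z. Nel * exp (Eexp x Z)) Z (0 * exp (Eexp x Z) + Nel * (exp (Eexp x Z) * E1 x Z))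
      (0 * exp (Eexp x Z) + Nel * (exp (Eexp x Z) * E2 x Z))"
    by (rule d)
  have g: "gder c Nel = - (mder c ch ** th - ch ** mder c th) $ 1 $ 1" if "\<And>i. geven (c i)" for c
  proof -
    have "gder c Nel = - mder c (ch ** th) $ 1 $ 1" by (simp add: Nel_def mder_def)
    then show ?thesis using that by (simp add: mder_mult_odd)
  qed
  have "gder (c1 x Z) Nel = - pi *\<^sub>R Y1 x Z"
    unfolding g[OF geven_c(1)] by (simp add: c1_def Y1_def matrix_ring_simps)
  then show "top_coef (\<eta> * (0 * exp (Eexp x Z) + Nel * (exp (Eexp x Z) * E1 x Z))) =
      - pi * top_coef (\<eta> * (Y1 x Z * exp (Eexp x Z)))"
    by (subst integration_by_parts_even[OF geven_c(1) div_c1 _ \<eta>(2) geven_Eexp E1_cancel geven_Nel])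
      (use \<eta>(1) in \<open>simp_all add: c1_def gder_cof_eps_only top_coef_simps scaleR_complex\<close>)
  have "gder (c2 x Z) Nel = - pi *\<^sub>R Y2 x Z"
    unfolding g[OF geven_c(2)] by (simp add: c2_def Y2_def matrix_ring_simps)
  then show "top_coef (\<eta> * (0 * exp (Eexp x Z) + Nel * (exp (Eexp x Z) * E2 x Z))) =
      - pi * top_coef (\<eta> * (Y2 x Z * exp (Eexp x Z)))"
    by (subst integration_by_parts_even[OF geven_c(2) div_c2 _ \<eta>(2) geven_Eexp E2_cancel geven_Nel])
      (use \<eta>(1) in \<open>simp_all add: c2_def gder_cof_eps_only top_coef_simps scaleR_complex\<close>)
qed

lemma dW_Y:
  assumes Z: "det (Kmat Z) \<noteq> 0"
  shows "dW (Y1 x) Z (- (ch ** om Z ** cm (tv x Z)) $ 1 $ 1) ((ch ** bv x Z) $ 1 $ 1)"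
    "dW (Y2 x) Z (((- av x Z - cm (sst x Z) ** om Z) ** th) $ 1 $ 1) 0"
proof -
  have "dWm (\<lambda>Z. ch ** cm (tv x Z)) Z (- (ch ** om Z ** cm (tv x Z))) (ch ** bv x Z)"
    by (rule dWm_eq[OF dWm_mult_odd[OF dWm_const dWm_tv[OF Z]]]) (simp_all add: matrix_ring_simps)
  then show "dW (Y1 x) Z (- (ch ** om Z ** cm (tv x Z)) $ 1 $ 1) ((ch ** bv x Z) $ 1 $ 1)"
    unfolding Y1_def dWm_def by auto
  have "dWm (\<lambda>Z. cm (sst x Z) ** th) Z ((- av x Z - cm (sst x Z) ** om Z) ** th) 0"
    by (rule dWm_eq[OF dWm_mult_even[OF dWm_sst' dWm_const]]) (simp_all add: matrix_ring_simps)
  then show "dW (Y2 x) Z (((- av x Z - cm (sst x Z) ** om Z) ** th) $ 1 $ 1) 0"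
    unfolding Y2_def dWm_def by auto
qed

text \<open>The homogeneity of \<open>Eexp\<close> in \<open>x\<close> makes \<open>- Rel\<close> its derivative \<open>v \<partial>/\<partial>v\<close> under \<open>x \<mapsto> \<surd>v x\<close>.\<close>

definition Rel :: "complex ^ ('p + 'q) \<Rightarrow> complex ^ 'q ^ 'p \<Rightarrow> 'q gens grassmann" where
  "Rel x Z = ((2 * pi) *\<^sub>R (cm (sst x Z) ** cm (tv x Z)) + (av x Z ** th + ch ** bv x Z)) $ 1 $ 1"

text \<open>The difference \<open>Y1 - Y2\<close> is what \<open>ext_dc\<close> leaves after
  \<open>dW_level1\<close>. The outer derivative is \<partial> + \<partial>bar on the full list of
  tangent vectors, so no prefactor is carried.\<close>

lemma dW_level2:
  assumes Z: "det (Kmat Z) \<noteq> 0"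
  shows "\<exists>u v. dW (\<lambda>Z. (Y1 x Z - Y2 x Z) * exp (Eexp x Z)) Z u v \<and>
    top_coef (u + v) = top_coef (Rel x Z * exp (Eexp x Z))"
proof -
  let ?e = "exp (Eexp x Z)"
  let ?y1 = "- (ch ** om Z ** cm (tv x Z)) $ 1 $ 1 - ((- av x Z - cm (sst x Z) ** om Z) ** th) $ 1 $ 1"
  let ?y2 = "(ch ** bv x Z) $ 1 $ 1 - 0"
  have odd: "godd (Y1 x Z - Y2 x Z)" by simp
  note d = dW_mult_odd[OF dW_diff[OF dW_Y[OF Z, of x]] dW_exp[OF dW_Eexp[OF Z] geven_Eexp] odd]
  have g: "gder c (Y1 x Z - Y2 x Z) = (mder c ch ** cm (tv x Z) - cm (sst x Z) ** mder c th) $ 1 $ 1"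
    if "\<And>i. geven (c i)" for c
  proof -
    have "gder c (Y1 x Z - Y2 x Z) = (mder c (ch ** cm (tv x Z)) - mder c (cm (sst x Z) ** th)) $ 1 $ 1"
      by (simp add: Y1_def Y2_def mder_def)
    then show ?thesis
      using that by (simp add: mder_mult_odd mder_mult_even mder_simps matrix_ring_simps)
  qed
  have "top_coef (1 * (?y1 * ?e - (Y1 x Z - Y2 x Z) * (?e * E1 x Z))) =
      top_coef (1 * ((?y1 + gder (c1 x Z) (Y1 x Z - Y2 x Z)) * ?e))"
    by (rule integration_by_parts_odd[OF geven_c(1) div_c1 _ _ geven_Eexp E1_cancel odd])
      (simp_all add: c1_def gder_cof_eps_only)
  \<comment> \<open>The terms \<open>ch ** om ** tv\<close> and \<open>sst ** om ** th\<close>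
    cancel, and the shift of \<theta> inside -\<open>Y2\<close> contributes one half of the 2\<pi>
    ct(s) t in \<open>Rel\<close>; the other half comes from \<delta>''.\<close>
  also have "?y1 + gder (c1 x Z) (Y1 x Z - Y2 x Z) = (pi *\<^sub>R (cm (sst x Z) ** cm (tv x Z)) + av x Z ** th) $ 1 $ 1"
    unfolding g[OF geven_c(1)] by (simp add: c1_def matrix_ring_simps)
  finally have 1: "top_coef (?y1 * ?e - (Y1 x Z - Y2 x Z) * (?e * E1 x Z)) =
      top_coef ((pi *\<^sub>R (cm (sst x Z) ** cm (tv x Z)) + av x Z ** th) $ 1 $ 1 * ?e)" by simp
  have "top_coef (1 * (?y2 * ?e - (Y1 x Z - Y2 x Z) * (?e * E2 x Z))) =
      top_coef (1 * ((?y2 + gder (c2 x Z) (Y1 x Z - Y2 x Z)) * ?e))"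
    by (rule integration_by_parts_odd[OF geven_c(2) div_c2 _ _ geven_Eexp E2_cancel odd])
      (simp_all add: c2_def gder_cof_eps_only)
  also have "?y2 + gder (c2 x Z) (Y1 x Z - Y2 x Z) = (pi *\<^sub>R (cm (sst x Z) ** cm (tv x Z)) + ch ** bv x Z) $ 1 $ 1"
    unfolding g[OF geven_c(2)] by (simp add: c2_def matrix_ring_simps)
  finally have 2: "top_coef (?y2 * ?e - (Y1 x Z - Y2 x Z) * (?e * E2 x Z)) =
      top_coef ((pi *\<^sub>R (cm (sst x Z) ** cm (tv x Z)) + ch ** bv x Z) $ 1 $ 1 * ?e)" by simp
  have R: "Rel x Z = (pi *\<^sub>R (cm (sst x Z) ** cm (tv x Z)) + av x Z ** th) $ 1 $ 1
      + (pi *\<^sub>R (cm (sst x Z) ** cm (tv x Z)) + ch ** bv x Z) $ 1 $ 1"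
    by (simp add: Rel_def scaleR_2[symmetric] algebra_simps)
  have "top_coef ((?y1 * ?e - (Y1 x Z - Y2 x Z) * (?e * E1 x Z)) + (?y2 * ?e - (Y1 x Z - Y2 x Z) * (?e * E2 x Z))) =
      top_coef (Rel x Z * ?e)"
    unfolding top_coef_simps(2) 1 2 R by (simp only: distrib_right top_coef_simps)
  then show ?thesis using d by blast
qed

end

section \<open>Exterior derivatives as odd directional derivatives\<close>

context odd_tangent
begin

text \<open>The sign in the hypothesis cancels the \<open>(-1) ^ i\<close> in \<open>del\<close> and
  \<open>delbar\<close>. The sum over \<open>i\<close> is then the complex linear functional
  \<open>L\<close> applied to \<open>dpm\<close>, taken along the full odd tangent vector.\<close>

lemma del_delbar_eq:
  assumes F: "dW F (coord z) u v" and S: "open S" "coord z \<in> S"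
    and L: "bounded_linear L" "\<And>c x. L (cs c * x) = c * L x"
    and \<omega>: "\<And>Z i. Z \<in> S \<Longrightarrow> i < length w \<Longrightarrow> \<omega> (graph Z) (take i w @ drop (Suc i) w) = (-1) ^ i * L (es ! i * F Z)"
  shows "del \<omega> z w = L u" "delbar \<omega> z w = L v"
proof -
  obtain D where D: "(F has_derivative D) (at (coord z))" "dpm (-\<i>) D = u" "dpm \<i> D = v"
    using F unfolding dW_def by blast
  interpret L: bounded_linear L by (rule L)
  have fd: "frechet_derivative (\<lambda>Z. \<omega> (graph Z) (take i w @ drop (Suc i) w)) (at (coord z)) =
      (\<lambda>h. (-1) ^ i * L (es ! i * D h))" if i: "i < length w" for i
  proof -
    have "((\<lambda>Z. (-1) ^ i * L (es ! i * F Z)) has_derivative (\<lambda>h. (-1) ^ i * L (es ! i * D h))) (at (coord z))"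
      by (intro has_derivative_mult_right L.has_derivative D)
    then have "((\<lambda>Z. \<omega> (graph Z) (take i w @ drop (Suc i) w)) has_derivative (\<lambda>h. (-1) ^ i * L (es ! i * D h))) (at (coord z))"
      by (rule has_derivative_transform_within_open[OF _ S]) (simp add: \<omega> i)
    then show ?thesis by (rule frechet_derivative_at[symmetric])
  qed
  have *: "L (es ! i * (cs (1/2) * (a + cs s * b))) = (L (es ! i * a) + s * L (es ! i * b)) / 2" for i a b s
  proof -
    have "es ! i * (cs r * y) = cs r * (es ! i * y)" for r y by (metis cs_commute mult.assoc)
    then have "es ! i * (cs (1/2) * (a + cs s * b)) = cs (1/2) * (es ! i * a) + cs (1/2) * (cs s * (es ! i * b))"
      by (simp add: distrib_left)
    then show ?thesis by (simp add: L.add L(2) add_divide_distrib)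
  qed
  have "L (dpm s D) = (\<Sum>i<length w. (L (es ! i * D (w ! i)) + s * L (es ! i * D (mult_i (w ! i)))) / 2)" for s
    by (simp only: dpm_def L.sum *)
  then show "del \<omega> z w = L u" "delbar \<omega> z w = L v"
    unfolding del_def delbar_def D(2,3)[symmetric] Let_def
    by (auto intro!: sum.cong simp: fd algebra_simps divide_simps power_mult_distrib[symmetric] simp flip: mult.assoc)
qed

text \<open>The removed summand contains the factor \<open>es ! i\<close>, and
  \<open>es ! i * es ! i = 0\<close>. Behind the factor \<open>es ! i\<close> the removed vector may
  therefore be put back.\<close>

lemma remove_sum:
  assumes i: "i < length w"
  shows "es ! i * (\<Sum>j<length (take i w @ drop (Suc i) w). (take i es @ drop (Suc i) es) ! j *
      f ((take i w @ drop (Suc i) w) ! j)) = es ! i * (\<Sum>j<length w. es ! j * f (w ! j))"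
proof -
  let ?f = "\<lambda>e v. e * f v"
  have L: "(\<Sum>j<length b. ?f (a ! j) (b ! j)) = sum_list (map2 ?f a b)" if "length a = length b" for a b
    using that by (simp add: sum_list_sum_nth atLeast0LessThan)
  have r: "length (take i es @ drop (Suc i) es) = length (take i w @ drop (Suc i) w)" using len by simp
  have "map2 ?f es w = map2 ?f (take i es @ es ! i # drop (Suc i) es) (take i w @ w ! i # drop (Suc i) w)"
    using i len by (simp flip: id_take_nth_drop)
  then have "sum_list (map2 ?f es w) =
      sum_list (map2 ?f (take i es @ drop (Suc i) es) (take i w @ drop (Suc i) w)) + ?f (es ! i) (w ! i)"
    using i len by simp
  moreover have "es ! i * ?f (es ! i) (w ! i) = 0"
    using odd_nth[OF i] by (simp flip: mult.assoc)
  ultimately have "es ! i * sum_list (map2 ?f es w) =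
      es ! i * sum_list (map2 ?f (take i es @ drop (Suc i) es) (take i w @ drop (Suc i) w))"
    by (simp only: distrib_left[of "es ! i" "sum_list _"] add_0_right)
  then show ?thesis
    unfolding L[OF r] L[OF len] by (rule sym)
qed

lemma odd_tangent_remove: "odd_tangent (take i es @ drop (Suc i) es) (take i w @ drop (Suc i) w)"
  using len odd by unfold_locales (auto dest: in_set_takeD in_set_dropD)

lemma remove_dpm:
  assumes i: "i < length w"
  shows "es ! i * odd_tangent.dpm (take i es @ drop (Suc i) es) (take i w @ drop (Suc i) w) s D = es ! i * dpm s D"
  unfolding odd_tangent.dpm_def[OF odd_tangent_remove] dpm_def by (rule remove_sum[OF i])

end

section \<open>Hermite functions through a Grassmann exponential\<close>

text \<open>\<open>J\<close> is -\<i> for the derivative by z and \<i> for that by its conjugate. It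
  is an element of the target algebra, so that complex and Grassmann valued functions share one
  calculus.\<close>

definition wirt :: "'a::real_normed_algebra_1 \<Rightarrow> 'p \<Rightarrow> (complex ^ ('p::finite + 'q::finite) \<Rightarrow> 'a) \<Rightarrow>
    complex ^ ('p + 'q) \<Rightarrow> 'a \<Rightarrow> bool" where
  "wirt J \<alpha> f y d \<longleftrightarrow> (\<exists>D. (f has_derivative D) (at y) \<and>
     (D (axis (Inl \<alpha>) 1) + J * D (axis (Inl \<alpha>) \<i>)) /\<^sub>R 2 = d)"

lemma wirt_const: "wirt J \<alpha> (\<lambda>y. c) y 0"
  unfolding wirt_def by (intro exI[of _ "\<lambda>h. 0"]) simp

lemma wirt_add: "wirt J \<alpha> f y d \<Longrightarrow> wirt J \<alpha> g y d' \<Longrightarrow> wirt J \<alpha> (\<lambda>y. f y + g y) y (d + d')"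
  unfolding wirt_def
  by (elim exE conjE, intro exI conjI, rule has_derivative_add) (auto simp: algebra_simps)

lemma wirt_diff: "wirt J \<alpha> f y d \<Longrightarrow> wirt J \<alpha> g y d' \<Longrightarrow> wirt J \<alpha> (\<lambda>y. f y - g y) y (d - d')"
  unfolding wirt_def
  by (elim exE conjE, intro exI conjI, rule has_derivative_diff) (auto simp: algebra_simps)

lemma wirt_mult:
  assumes "wirt J \<alpha> f y d" "wirt J \<alpha> g y d'" and J: "\<And>x. J * x = x * J"
  shows "wirt J \<alpha> (\<lambda>y. f y * g y) y (d * g y + f y * d')"
proof -
  from assms obtain D D' where D: "(f has_derivative D) (at y)" "(g has_derivative D') (at y)"
    "(D (axis (Inl \<alpha>) 1) + J * D (axis (Inl \<alpha>) \<i>)) /\<^sub>R 2 = d"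
    "(D' (axis (Inl \<alpha>) 1) + J * D' (axis (Inl \<alpha>) \<i>)) /\<^sub>R 2 = d'" unfolding wirt_def by auto
  have J': "J * (f y * x) = f y * (J * x)" for x by (metis J mult.assoc)
  show ?thesis unfolding wirt_def
  proof (intro exI conjI)
    show "((\<lambda>y. f y * g y) has_derivative (\<lambda>h. f y * D' h + D h * g y)) (at y)"
      by (rule has_derivative_mult[OF D(1,2)])
  qed (simp add: D(3,4)[symmetric] J' algebra_simps)
qed

lemmas wirt_mult_complex = wirt_mult[where J = "J :: complex" for J, OF _ _ mult.commute]

lemma wirt_bounded_linear:
  assumes "wirt J \<alpha> f y d" "bounded_linear L" "\<And>x. L (J * x) = J' * L x"
  shows "wirt J' \<alpha> (\<lambda>y. L (f y)) y (L d)"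
proof -
  interpret L: bounded_linear L by (rule assms)
  from assms(1) obtain D where D: "(f has_derivative D) (at y)"
    "(D (axis (Inl \<alpha>) 1) + J * D (axis (Inl \<alpha>) \<i>)) /\<^sub>R 2 = d" unfolding wirt_def by auto
  show ?thesis unfolding wirt_def
    by (rule exI[of _ "\<lambda>h. L (D h)"])
      (auto intro!: L.has_derivative D simp: D(2)[symmetric] L.add L.scaleR assms(3))
qed

lemma wirt_exp:
  fixes f :: "complex ^ ('p::finite + 'q::finite) \<Rightarrow> 'i::finite grassmann"
  assumes "wirt J \<alpha> f y d" "geven (f y)" shows "wirt J \<alpha> (\<lambda>y. exp (f y)) y (exp (f y) * d)"
proof -
  from assms obtain D where D: "(f has_derivative D) (at y)"
    "(D (axis (Inl \<alpha>) 1) + J * D (axis (Inl \<alpha>) \<i>)) /\<^sub>R 2 = d" unfolding wirt_def by auto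
  have J': "J * (exp (f y) * x) = exp (f y) * (J * x)" for x
    by (metis geven_commute[OF geven_exp[OF assms(2)]] mult.assoc)
  show ?thesis unfolding wirt_def
    by (rule exI[of _ "\<lambda>h. exp (f y) * D h"])
      (auto intro!: has_derivative_exp_even D assms(2) simp: D(2)[symmetric] J' algebra_simps)
qed

lemma wirt_coord:
  "wirt (-\<i>) \<alpha> (\<lambda>y. y $ r) y (if r = Inl \<alpha> then 1 else 0)"
  "wirt \<i> \<alpha> (\<lambda>y. y $ r) y 0"
  "wirt (-\<i>) \<alpha> (\<lambda>y. cnj (y $ r)) y 0"
  "wirt \<i> \<alpha> (\<lambda>y. cnj (y $ r)) y (if r = Inl \<alpha> then 1 else 0)"
proof -
  have 1: "((\<lambda>y. y $ r) has_derivative (\<lambda>h. h $ r)) (at y)"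
    by (intro bounded_linear.has_derivative[OF bounded_linear_vec_nth] has_derivative_ident)
  then have 2: "((\<lambda>y. cnj (y $ r)) has_derivative (\<lambda>h. cnj (h $ r))) (at y)"
    by (intro bounded_linear.has_derivative[OF bounded_linear_cnj])
  show "wirt (-\<i>) \<alpha> (\<lambda>y. y $ r) y (if r = Inl \<alpha> then 1 else 0)"
    unfolding wirt_def by (rule exI, rule conjI, rule 1) (auto simp: axis_def scaleR_conv_of_real)
  show "wirt \<i> \<alpha> (\<lambda>y. y $ r) y 0"
    unfolding wirt_def by (rule exI, rule conjI, rule 1) (auto simp: axis_def scaleR_conv_of_real)
  show "wirt (-\<i>) \<alpha> (\<lambda>y. cnj (y $ r)) y 0"
    unfolding wirt_def by (rule exI, rule conjI, rule 2) (auto simp: axis_def scaleR_conv_of_real)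
  show "wirt \<i> \<alpha> (\<lambda>y. cnj (y $ r)) y (if r = Inl \<alpha> then 1 else 0)"
    unfolding wirt_def by (rule exI, rule conjI, rule 2) (auto simp: axis_def scaleR_conv_of_real)
qed

lemma wirt_phi_zero:
  "wirt (-\<i>) \<alpha> phi_zero y (- of_real pi * cnj (y $ Inl \<alpha>) * phi_zero y)"
  "wirt \<i> \<alpha> phi_zero y (- of_real pi * y $ Inl \<alpha> * phi_zero y)"
proof -
  have phi: "phi_zero = (\<lambda>y. exp (- of_real (pi * (\<Sum>r\<in>UNIV. y $ r \<bullet> y $ r))))"
    by (auto simp: phi_zero_def fun_eq_iff power2_norm_eq_inner)
  have "((\<lambda>y. y $ r) has_derivative (\<lambda>h. h $ r)) (at y)" for r
    by (intro bounded_linear.has_derivative[OF bounded_linear_vec_nth] has_derivative_ident)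
  note this [derivative_intros]
  have "((\<lambda>y. - of_real (pi * (\<Sum>r\<in>UNIV. y $ r \<bullet> y $ r)) :: complex) has_derivative
      (\<lambda>h. - of_real (2 * pi * (\<Sum>r\<in>UNIV. y $ r \<bullet> h $ r)))) (at y)"
    by (auto intro!: derivative_eq_intros simp: inner_commute sum.distrib sum_distrib_left algebra_simps)
  from has_derivative_compose[OF this DERIV_exp[unfolded has_field_derivative_def]]
  have D: "(phi_zero has_derivative (\<lambda>h. phi_zero y * - of_real (2 * pi * (\<Sum>r\<in>UNIV. y $ r \<bullet> h $ r)))) (at y)"
    by (simp add: phi)
  have a: "(\<Sum>r\<in>UNIV. y $ r \<bullet> axis (Inl \<alpha>) c $ r) = y $ Inl \<alpha> \<bullet> c" for c
    by (simp add: axis_def if_distrib cong: if_cong)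
  show "wirt (-\<i>) \<alpha> phi_zero y (- of_real pi * cnj (y $ Inl \<alpha>) * phi_zero y)"
    unfolding wirt_def
    by (rule exI, rule conjI, rule D, unfold a) (simp add: inner_complex_def complex_eq_iff algebra_simps)
  show "wirt \<i> \<alpha> phi_zero y (- of_real pi * y $ Inl \<alpha> * phi_zero y)"
    unfolding wirt_def
    by (rule exI, rule conjI, rule D, unfold a) (simp add: inner_complex_def complex_eq_iff algebra_simps)
qed

lemma D_op_wirt:
  assumes "wirt (-\<i>) \<alpha> f y d" shows "D_op \<alpha> f y = cnj (y $ Inl \<alpha>) * f y - 1 / of_real pi * d"
proof -
  from assms obtain D where D: "(f has_derivative D) (at y)"
    "(D (axis (Inl \<alpha>) 1) + (-\<i>) * D (axis (Inl \<alpha>) \<i>)) /\<^sub>R 2 = d" unfolding wirt_def by auto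
  have "frechet_derivative f (at y) = D" using D(1) by (rule frechet_derivative_at[symmetric])
  then show ?thesis by (simp add: D_op_def D(2)[symmetric] scaleR_conv_of_real)
qed

lemma Dbar_op_wirt:
  assumes "wirt \<i> \<alpha> f y d" shows "Dbar_op \<alpha> f y = y $ Inl \<alpha> * f y - 1 / of_real pi * d"
proof -
  from assms obtain D where D: "(f has_derivative D) (at y)"
    "(D (axis (Inl \<alpha>) 1) + \<i> * D (axis (Inl \<alpha>) \<i>)) /\<^sub>R 2 = d" unfolding wirt_def by auto
  have "frechet_derivative f (at y) = D" using D(1) by (rule frechet_derivative_at[symmetric])
  then show ?thesis by (simp add: Dbar_op_def D(2)[symmetric] scaleR_conv_of_real)
qed

text \<open>The polynomial factor is holomorphic, so the derivative by the conjugate variable hits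
  the Gaussian alone; each operator multiplies by z + z.\<close>

lemma foldr_Dbar_op:
  "foldr Dbar_op \<beta>s phi_zero = (\<lambda>y :: complex ^ ('p::finite + 'q::finite). phi_zero y * prod_list (map (\<lambda>\<beta>. 2 * y $ Inl \<beta>) \<beta>s))"
proof (induction \<beta>s)
  case (Cons \<beta> \<beta>s)
  show ?case
  proof
    fix y :: "complex ^ ('p + 'q)"
    have "wirt \<i> \<beta> (\<lambda>y. prod_list (map (\<lambda>\<beta>. 2 * y $ Inl \<beta>) bs)) y 0" for bs
    proof (induction bs)
      case (Cons b bs)
      show ?case
        using wirt_mult_complex[OF wirt_mult_complex[OF wirt_const[of _ _ 2] wirt_coord(2)] Cons] by simp
    qed (simp add: wirt_const)
    from wirt_mult_complex[OF wirt_phi_zero(2) this]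
    have "wirt \<i> \<beta> (\<lambda>y. phi_zero y * prod_list (map (\<lambda>\<beta>. 2 * y $ Inl \<beta>) \<beta>s)) y
        (- of_real pi * y $ Inl \<beta> * phi_zero y * prod_list (map (\<lambda>\<beta>. 2 * y $ Inl \<beta>) \<beta>s))"
      by simp
    from Dbar_op_wirt[OF this]
    show "foldr Dbar_op (\<beta> # \<beta>s) phi_zero y = phi_zero y * prod_list (map (\<lambda>\<beta>. 2 * y $ Inl \<beta>) (\<beta> # \<beta>s))"
      unfolding foldr.simps comp_def Cons by (simp add: algebra_simps)
  qed
qed simp

text \<open>A class of differentiable functions that is closed, after multiplication by the
  Gaussian, under \<open>D_op\<close>; it justifies the linearity of iterated \<open>D_op\<close>,
  whose definition uses \<open>frechet_derivative\<close>.\<close>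

inductive polyfun :: "(complex ^ ('p::finite + 'q::finite) \<Rightarrow> complex) \<Rightarrow> bool" where
  const: "polyfun (\<lambda>y. c)"
| coord: "polyfun (\<lambda>y. y $ r)"
| cnj_coord: "polyfun (\<lambda>y. cnj (y $ r))"
| add: "polyfun f \<Longrightarrow> polyfun g \<Longrightarrow> polyfun (\<lambda>y. f y + g y)"
| mult: "polyfun f \<Longrightarrow> polyfun g \<Longrightarrow> polyfun (\<lambda>y. f y * g y)"

lemma polyfun_wirt: "polyfun f \<Longrightarrow> \<exists>g. polyfun g \<and> (\<forall>y. wirt (-\<i>) \<alpha> f y (g y))"
proof (induction rule: polyfun.induct)
  case (const c)
  show ?case using polyfun.const wirt_const by blast
next
  case (coord r)
  show ?case using polyfun.const[of "if r = Inl \<alpha> then 1 else 0"] wirt_coord(1) by blast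
next
  case (cnj_coord r)
  show ?case using polyfun.const[of 0] wirt_coord(3) by blast
next
  case (add f g)
  then obtain f' g' where *: "polyfun f'" "\<And>y. wirt (-\<i>) \<alpha> f y (f' y)" "polyfun g'" "\<And>y. wirt (-\<i>) \<alpha> g y (g' y)"
    by blast
  then show ?case
    by (intro exI[of _ "\<lambda>y. f' y + g' y"] conjI allI polyfun.add wirt_add)
next
  case (mult f g)
  then obtain f' g' where *: "polyfun f'" "\<And>y. wirt (-\<i>) \<alpha> f y (f' y)" "polyfun g'" "\<And>y. wirt (-\<i>) \<alpha> g y (g' y)"
    by blast
  have "wirt (-\<i>) \<alpha> (\<lambda>y. f y * g y) y (f' y * g y + f y * g' y)" for y
    by (rule wirt_mult) (auto simp: *)
  then show ?case
    by (intro exI[of _ "\<lambda>y. f' y * g y + f y * g' y"] conjI allI polyfun.add polyfun.mult mult.hyps *(1,3))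
qed

lemma D_op_polyfun:
  assumes "polyfun f" shows "\<exists>g. polyfun g \<and> D_op \<alpha> (\<lambda>y. phi_zero y * f y) = (\<lambda>y. phi_zero y * g y)"
proof -
  obtain f' where f': "polyfun f'" "\<And>y. wirt (-\<i>) \<alpha> f y (f' y)" using polyfun_wirt[OF assms] by blast
  have "D_op \<alpha> (\<lambda>y. phi_zero y * f y) y = phi_zero y * (2 * cnj (y $ Inl \<alpha>) * f y + (- 1 / of_real pi) * f' y)" for y
    using D_op_wirt[OF wirt_mult_complex[OF wirt_phi_zero(1) f'(2)]] by (simp add: field_simps)
  moreover have "polyfun (\<lambda>y. 2 * cnj (y $ Inl \<alpha>) * f y + (- 1 / of_real pi) * f' y)"
    by (intro polyfun.intros assms f')
  ultimately show ?thesis by blast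
qed

lemma polyfun_prod_list: "polyfun (\<lambda>y. prod_list (map (\<lambda>\<beta>. 2 * y $ Inl \<beta>) \<beta>s))"
proof (induction \<beta>s)
  case (Cons \<beta> \<beta>s)
  then show ?case unfolding list.map prod_list.Cons by (intro polyfun.intros)
qed (simp add: polyfun.const)

text \<open>The second conjunct keeps each intermediate function of the form Gaussian times
  polynomial, hence differentiable, so that the next \<open>D_op\<close> is again additive.\<close>

lemma foldr_D_op_linear:
  assumes "\<And>b. b \<in> I \<Longrightarrow> polyfun (f b)" "finite I"
  shows "foldr D_op \<alpha>s (\<lambda>y. \<Sum>b\<in>I. c b * (phi_zero y * f b y)) =
      (\<lambda>y. \<Sum>b\<in>I. c b * foldr D_op \<alpha>s (\<lambda>y. phi_zero y * f b y) y) \<and>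
    (\<forall>b\<in>I. \<exists>g. polyfun g \<and> foldr D_op \<alpha>s (\<lambda>y. phi_zero y * f b y) = (\<lambda>y. phi_zero y * g y))"
proof (induction \<alpha>s)
  case Nil
  then show ?case using assms by auto
next
  case (Cons \<alpha> \<alpha>s)
  let ?F = "\<lambda>b. foldr D_op \<alpha>s (\<lambda>y. phi_zero y * f b y)"
  from Cons obtain g where g: "\<And>b. b \<in> I \<Longrightarrow> polyfun (g b)" "\<And>b. b \<in> I \<Longrightarrow> ?F b = (\<lambda>y. phi_zero y * g b y)"
    by metis
  have "\<exists>h. polyfun h \<and> foldr D_op (\<alpha> # \<alpha>s) (\<lambda>y. phi_zero y * f b y) = (\<lambda>y. phi_zero y * h y)" if "b \<in> I" for b
    using D_op_polyfun[OF g(1)[OF that]] g(2)[OF that] by simp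
  moreover have "D_op \<alpha> (\<lambda>y. \<Sum>b\<in>I. c b * ?F b y) y = (\<Sum>b\<in>I. c b * D_op \<alpha> (?F b) y)" for y
  proof -
    have "\<exists>d. wirt (-\<i>) \<alpha> (?F b) y d" if b: "b \<in> I" for b
    proof -
      obtain g' where "wirt (-\<i>) \<alpha> (g b) y (g' y)" using polyfun_wirt[OF g(1)[OF b]] by blast
      from wirt_mult_complex[OF wirt_phi_zero(1) this] show ?thesis unfolding g(2)[OF b] by auto
    qed
    then obtain d where d: "\<And>b. b \<in> I \<Longrightarrow> wirt (-\<i>) \<alpha> (?F b) y (d b)" by metis
    have "wirt (-\<i>) \<alpha> (\<lambda>y. c b * ?F b y) y (c b * d b)" if "b \<in> I" for b
      using wirt_mult_complex[OF wirt_const[of _ _ "c b"] d[OF that]] by simp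
    with assms(2) have "wirt (-\<i>) \<alpha> (\<lambda>y. \<Sum>b\<in>I. c b * ?F b y) y (\<Sum>b\<in>I. c b * d b)"
      by (induction I rule: finite_induct) (auto intro: wirt_const wirt_add)
    from D_op_wirt[OF this] show ?thesis
      by (simp add: D_op_wirt[OF d] sum_subtractf sum_distrib_left algebra_simps)
  qed
  ultimately show ?case using Cons by auto
qed

text \<open>On \<open>phi_zero y * exp (B y)\<close> the operator \<open>D_op \<alpha>\<close>
  multiplies by 2 cnj z - V/\<pi>: the Gaussian doubles the conjugate coordinate, and the
  exponential brings down \<open>V \<alpha>\<close>.\<close>

lemma foldr_D_op_exp:
  fixes V :: "'p::finite \<Rightarrow> 'i::finite grassmann" and \<kappa> :: "'i grassmann"
  assumes V: "\<And>\<alpha>. geven (V \<alpha>)"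
  defines "B \<equiv> \<lambda>y :: complex ^ ('p + 'q::finite). \<Sum>\<beta>\<in>UNIV. cs (y $ Inl \<beta>) * V \<beta>"
  defines "Q \<equiv> \<lambda>\<alpha>s y. prod_list (map (\<lambda>\<alpha>. cs (2 * cnj (y $ Inl \<alpha>)) - (1 / pi) *\<^sub>R V \<alpha>) \<alpha>s)"
  shows "foldr D_op \<alpha>s (\<lambda>y. phi_zero y * top_coef (\<kappa> * exp (B y))) =
    (\<lambda>y. phi_zero y * top_coef (\<kappa> * (Q \<alpha>s y * exp (B y))))"
proof (induction \<alpha>s)
  case Nil
  then show ?case by (simp add: Q_def)
next
  case (Cons \<alpha> \<alpha>s)
  have J: "cs (-\<i>) * x = x * cs (-\<i>)" for x :: "'i grassmann" by (simp add: cs_commute)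
  have cs: "wirt (cs (-\<i>)) a (\<lambda>y. cs (f y) :: 'i grassmann) y (cs d)" if "wirt (-\<i>) a f y d" for a f y d
    by (rule wirt_bounded_linear[OF that bounded_linear_cs]) (simp add: cs_simps)
  have evB: "geven (B y)" for y by (simp add: B_def V)
  show ?case
  proof
    fix y
    have "wirt (cs (-\<i>)) \<alpha> B y (\<Sum>\<beta>\<in>UNIV. cs (if Inl \<beta> = (Inl \<alpha> :: 'p + 'q) then 1 else 0) * V \<beta>)"
    proof -
      have "wirt (cs (-\<i>)) \<alpha> (\<lambda>y. \<Sum>\<beta>\<in>I. cs (y $ Inl \<beta>) * V \<beta>) y
        (\<Sum>\<beta>\<in>I. cs (if Inl \<beta> = (Inl \<alpha> :: 'p + 'q) then 1 else 0) * V \<beta>)" if "finite I" for I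
        using that
      proof (induction I)
        case (insert b I)
        have "wirt (cs (-\<i>)) \<alpha> (\<lambda>y. cs (y $ Inl b) * V b) y (cs (if Inl b = (Inl \<alpha> :: 'p + 'q) then 1 else 0) * V b)"
          using wirt_mult[OF cs[OF wirt_coord(1)[of \<alpha> "Inl b" y]] wirt_const[of _ _ "V b"] J]
          by (simp only: mult_zero_right add_0_right)
        with insert show ?case by (auto intro: wirt_add)
      qed (simp add: wirt_const)
      then show ?thesis by (simp add: B_def)
    qed
    also have "(\<Sum>\<beta>\<in>UNIV. cs (if Inl \<beta> = (Inl \<alpha> :: 'p + 'q) then 1 else 0) * V \<beta>) = V \<alpha>"
      by (simp add: if_distrib if_distribR cs_simps cong: if_cong)
    finally have e: "wirt (cs (-\<i>)) \<alpha> (\<lambda>y. exp (B y)) y (exp (B y) * V \<alpha>)"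
      by (rule wirt_exp[OF _ evB])
    \<comment> \<open>The factors produced so far involve conjugate coordinates only, so the next
      operator does not differentiate them.\<close>
    have q: "wirt (cs (-\<i>)) \<alpha> (\<lambda>y :: complex ^ ('p + 'q). Q as y) y 0" for as
    proof (induction as)
      case (Cons a as)
      have "wirt (-\<i>) \<alpha> (\<lambda>y :: complex ^ ('p + 'q). 2 * cnj (y $ Inl a)) y 0"
        using wirt_mult_complex[OF wirt_const[of _ _ 2] wirt_coord(3)] by simp
      from wirt_mult[OF wirt_diff[OF cs[OF this] wirt_const[of _ _ "(1 / pi) *\<^sub>R V a"]] Cons J]
      show ?case by (simp add: Q_def cs_simps)
    qed (simp add: Q_def wirt_const)
    let ?f = "cs (phi_zero y) :: 'i grassmann"
    have "wirt (cs (-\<i>)) \<alpha> (\<lambda>y. cs (phi_zero y) * (Q \<alpha>s y * exp (B y))) y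
        (cs (- of_real pi * cnj (y $ Inl \<alpha>) * phi_zero y) * (Q \<alpha>s y * exp (B y)) + ?f * (0 * exp (B y) + Q \<alpha>s y * (exp (B y) * V \<alpha>)))"
      by (intro wirt_mult cs wirt_phi_zero q e J)
    moreover have "top_coef (\<kappa> * (cs c * x)) = c * top_coef (\<kappa> * x)" for c x
      by (metis cs_commute mult.assoc top_coef_simps(6))
    ultimately have "wirt (-\<i>) \<alpha> (\<lambda>y. top_coef (\<kappa> * (cs (phi_zero y) * (Q \<alpha>s y * exp (B y))))) y
        (top_coef (\<kappa> * (cs (- of_real pi * cnj (y $ Inl \<alpha>) * phi_zero y) * (Q \<alpha>s y * exp (B y)) + ?f * (0 * exp (B y) + Q \<alpha>s y * (exp (B y) * V \<alpha>)))))"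
      by (intro wirt_bounded_linear[where L="\<lambda>x. top_coef (\<kappa> * x)" and J="cs (-\<i>)"]
          bounded_linear_compose[OF bounded_linear_top_coef] bounded_linear_mult_right)
    note D = D_op_wirt[OF this]
    have t: "top_coef (\<kappa> * (cs c * x)) = c * top_coef (\<kappa> * x)" for c x
      by (metis cs_commute mult.assoc top_coef_simps(6))
    have V': "Q \<alpha>s y * (exp (B y) * V \<alpha>) = V \<alpha> * (Q \<alpha>s y * exp (B y))"
      using geven_commute[OF V, of \<alpha> "Q \<alpha>s y * exp (B y)"] by (simp add: mult.assoc)
    have Qc: "Q (\<alpha> # \<alpha>s) y = (cs (2 * cnj (y $ Inl \<alpha>)) - (1 / pi) *\<^sub>R V \<alpha>) * Q \<alpha>s y"
      by (simp add: Q_def)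
    have "D_op \<alpha> (\<lambda>y. phi_zero y * top_coef (\<kappa> * (Q \<alpha>s y * exp (B y)))) y =
        phi_zero y * top_coef (\<kappa> * (Q (\<alpha> # \<alpha>s) y * exp (B y)))"
      using D by (simp add: t V' Qc distrib_left left_diff_distrib right_diff_distrib top_coef_simps scaleR_complex mult.assoc)
    then show "foldr D_op (\<alpha> # \<alpha>s) (\<lambda>y. phi_zero y * top_coef (\<kappa> * exp (B y))) y =
        phi_zero y * top_coef (\<kappa> * (Q (\<alpha> # \<alpha>s) y * exp (B y)))"
      by (simp add: Cons)
  qed
qed

section \<open>Berezin integration\<close>

lemma mult_cs_left: "x * (cs c * y) = cs c * (x * y)"
  by (metis cs_commute mult.assoc)

lemma mult_exp_absorb:
  fixes a z :: "'a::{real_normed_algebra_1, banach}"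
  assumes "a * z = 0" shows "a * exp z = a"
proof -
  have "a * (z ^ n /\<^sub>R fact n) = (if n = 0 then a else 0)" for n
  proof (cases n)
    case (Suc m)
    then show ?thesis using assms by (simp flip: mult.assoc)
  qed simp
  then have "(\<lambda>n. if n = 0 then a else 0) sums (a * exp z)"
    using sums_mult[OF exp_converges[of z], of a] by simp
  moreover have "(\<lambda>n. if n = 0 then a else 0) sums a"
    using sums_If_finite_set[of "{0::nat}" "\<lambda>_. a"] by simp
  ultimately show ?thesis using sums_unique2 by blast
qed

lemma con_mult_0: "con i x = 0 \<Longrightarrow> con i y = 0 \<Longrightarrow> geven x \<or> godd x \<Longrightarrow> con i (x * y) = 0"
  by (auto simp: con_mult_even con_mult_odd)

lemma con_prod_list_0: "(\<And>y. y \<in> set ys \<Longrightarrow> geven y \<and> con i y = 0) \<Longrightarrow> con i (prod_list ys) = 0"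
  by (induction ys) (auto simp: con_mult_0)

text \<open>Choosing the summand 1 in the factor of \<open>k\<close> leaves a product free of the
  generator \<open>g k\<close>, which has no top coefficient.\<close>

lemma keep_top:
  assumes "distinct ks" "\<And>k. geven (x k)"
    and "\<And>k l. k \<in> set ks \<Longrightarrow> l \<in> set ks \<Longrightarrow> k \<noteq> l \<Longrightarrow> con (g k) (x l) = 0"
    and "\<And>k. k \<in> set ks \<Longrightarrow> con (g k) \<kappa> = 0" "\<And>k. k \<in> set ks \<Longrightarrow> con (g k) R = 0"
    and "geven \<kappa> \<or> godd \<kappa>"
  shows "top_coef (\<kappa> * (prod_list (map (\<lambda>k. 1 + x k) ks) * R)) = top_coef (\<kappa> * (prod_list (map x ks) * R))"
  using assms
proof (induction ks arbitrary: \<kappa>)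
  case (Cons k ks)
  let ?P = "prod_list (map (\<lambda>k. 1 + x k) ks)"
  have x: "con (g k) (x l) = 0" "con (g l) (x k) = 0" if "l \<in> set ks" for l
    using Cons.prems(1) Cons.prems(3)[of k l] Cons.prems(3)[of l k] that by auto
  have P: "con (g k) ?P = 0" using Cons.prems(2) x by (intro con_prod_list_0) auto
  have ev: "geven ?P" using Cons.prems(2) by (intro geven_prod_list) auto
  have "con (g k) (\<kappa> * (?P * R)) = 0"
    using Cons.prems P ev by (intro con_mult_0) auto
  then have 0: "top_coef (\<kappa> * (?P * R)) = 0" by (rule top_coef_eq_0)
  have "top_coef ((\<kappa> * x k) * (?P * R)) = top_coef ((\<kappa> * x k) * (prod_list (map x ks) * R))"
    using Cons.prems x(2) by (intro Cons.IH) (auto intro!: con_mult_0)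
  moreover have "\<kappa> * ((1 + x k) * ?P * R) = \<kappa> * (?P * R) + (\<kappa> * x k) * (?P * R)"
    by (simp add: algebra_simps)
  ultimately show ?case using 0 by (simp add: top_coef_simps mult.assoc)
qed simp

text \<open>The sign of the reversal of \<open>n\<close> odd factors.\<close>

definition psign :: "nat \<Rightarrow> complex" where
  "psign n = (-1) ^ (n * (n - 1) div 2)"

lemma psign_square [simp]: "psign n * psign n = 1"
  by (simp add: psign_def flip: power_add mult_2)

lemma psign_Suc: "psign (Suc n) = (-1) ^ n * psign n"
proof -
  have "Suc n * n = n * (n - 1) + n * 2"
    by (cases n) (auto simp: algebra_simps)
  then have "Suc n * n div 2 = n * (n - 1) div 2 + n"
    by (metis div_mult_self1 zero_neq_numeral add.commute)
  then show ?thesis by (simp add: psign_def power_add mult.commute)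
qed

lemma odd_move:
  assumes "godd b" "\<And>x. x \<in> set xs \<Longrightarrow> godd x"
  shows "b * prod_list xs = cs ((-1) ^ length xs) * (prod_list xs * b)"
  using assms(2)
proof (induction xs)
  case (Cons x xs)
  have "b * (x * prod_list xs) = - (x * (b * prod_list xs))"
    using godd_anticommute[OF assms(1), of x] Cons.prems by (simp flip: mult.assoc)
  also have "b * prod_list xs = cs ((-1) ^ length xs) * (prod_list xs * b)" using Cons by simp
  also have "- (x * (cs ((-1) ^ length xs) * (prod_list xs * b))) = cs (- ((-1) ^ length xs)) * (x * prod_list xs * b)"
    by (simp add: cs_simps mult_cs_left[of x] mult.assoc)
  finally show ?case by (simp add: mult.assoc)
qed (simp add: cs_simps)

lemma prod_list_pairs:
  assumes "\<And>k. k \<in> set ks \<Longrightarrow> godd (a k)" "\<And>k. k \<in> set ks \<Longrightarrow> godd (b k)"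
  shows "prod_list (map (\<lambda>k. a k * b k) ks) = cs (psign (length ks)) * (prod_list (map a ks) * prod_list (map b ks))"
  using assms
proof (induction ks)
  case (Cons k ks)
  let ?A = "prod_list (map a ks)" and ?B = "prod_list (map b ks)" and ?n = "length ks"
  have "a k * b k * (cs (psign ?n) * (?A * ?B)) = cs (psign ?n) * (a k * (b k * ?A) * ?B)"
    by (simp only: mult_cs_left[of "a k"] mult_cs_left[of "b k"] mult.assoc)
  also have "b k * ?A = cs ((-1) ^ ?n) * (?A * b k)"
    using odd_move[of "b k" "map a ks"] Cons.prems by auto
  also have "cs (psign ?n) * (a k * (cs ((-1) ^ ?n) * (?A * b k)) * ?B) =
      cs (psign ?n) * cs ((-1) ^ ?n) * (a k * ?A * (b k * ?B))"
    by (simp only: mult_cs_left[of "a k"] mult.assoc)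
  also have "cs (psign ?n) * cs ((-1) ^ ?n) = cs (psign (Suc ?n))"
    by (simp add: psign_Suc mult.commute flip: cs_simps(6))
  finally show ?case using Cons by simp
qed (simp add: cs_simps psign_def)

lemma exp_sum_list:
  assumes "\<And>k. k \<in> set ks \<Longrightarrow> geven (x k)" "\<And>k. k \<in> set ks \<Longrightarrow> x k * x k = 0"
  shows "exp (sum_list (map x ks)) = prod_list (map (\<lambda>k. 1 + x k) ks)"
  using assms
proof (induction ks)
  case (Cons k ks)
  have "exp (x k + sum_list (map x ks)) = exp (x k) * exp (sum_list (map x ks))"
    using Cons.prems by (intro exp_add_commuting geven_commute) auto
  then show ?case using Cons by (simp add: exp_square_zero)
qed simp

lemma odd_pair_square: assumes "godd a" "godd b" shows "a * b * (a * b) = 0"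
proof -
  have "a * b * a + a * b * a = 0"
    using odd_swap[OF assms(1) assms(1) disjI2[OF assms(2)]] by (simp only: eq_neg_iff_add_eq_0)
  then have "a * b * a = 0" by (simp flip: scaleR_2)
  then show ?thesis by (simp flip: mult.assoc)
qed

definition qs :: "'q::{finite, linorder} list" where
  "qs = sorted_list_of_set UNIV"

lemma qs_simps [simp]: "set qs = UNIV" "distinct qs" "length (qs :: 'q::{finite, linorder} list) = CARD('q)"
  by (simp_all add: qs_def)

lemma neg_index_qs: "neg_index k = qs ! k"
  by (simp add: neg_index_def qs_def)

lemma sum_list_qs: "sum_list (map f qs) = (\<Sum>k\<in>UNIV. f k)"
  for f :: "'q::{finite, linorder} \<Rightarrow> 'a::comm_monoid_add"
  by (simp add: sum_list_distinct_conv_sum_set)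

lemma sum_qs_nth: "(\<Sum>k\<in>UNIV. f k) = (\<Sum>j<CARD('q). f (qs ! j))"
  for f :: "'q::{finite, linorder} \<Rightarrow> 'a::comm_monoid_add"
  unfolding sum_list_qs[symmetric] by (simp add: sum_list_sum_nth atLeast0LessThan)

lemma map_qs_nth: "map (\<lambda>i. f (qs ! i :: 'q::{finite, linorder})) [0..<CARD('q)] = map f qs"
  by (rule nth_equalityI) auto

text \<open>\<open>g k\<close> can occur only in the pair with index \<open>k\<close>, so reaching
  the top degree requires every pair exactly once; \<open>psign\<close> is the cost of sorting all
  \<open>a k\<close> before all \<open>b k\<close>.\<close>

lemma berezin:
  fixes a b :: "'q::{finite, linorder} \<Rightarrow> 'i::finite grassmann"
  assumes odd: "\<And>k. godd (a k)" "\<And>k. godd (b k)" and g: "\<And>k l. k \<noteq> l \<Longrightarrow> con (g k) (a l * b l) = 0"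
    and \<eta>: "\<And>k. con (g k) \<eta> = 0" "\<And>k. con (g k) R = 0" "geven \<eta> \<or> godd \<eta>"
  shows "top_coef (\<eta> * (exp (\<Sum>k\<in>UNIV. a k * b k) * R)) =
    psign CARD('q) * top_coef (\<eta> * (prod_list (map a qs) * prod_list (map b qs) * R))"
proof -
  have "exp (\<Sum>k\<in>UNIV. a k * b k) = prod_list (map (\<lambda>k. 1 + a k * b k) qs)"
    unfolding sum_list_qs[symmetric] by (rule exp_sum_list) (auto simp: odd odd_pair_square)
  then have "top_coef (\<eta> * (exp (\<Sum>k\<in>UNIV. a k * b k) * R)) =
      top_coef (\<eta> * (prod_list (map (\<lambda>k. a k * b k) qs) * R))"
    using keep_top[of qs "\<lambda>k. a k * b k" g \<eta> R] by (simp add: odd g \<eta>)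
  also have "\<eta> * (prod_list (map (\<lambda>k. a k * b k) qs) * R) =
      cs (psign CARD('q)) * (\<eta> * (prod_list (map a qs) * prod_list (map b qs) * R))"
    by (subst prod_list_pairs) (simp_all add: odd mult.assoc mult_cs_left[of \<eta>])
  finally show ?thesis by (simp add: top_coef_simps)
qed

definition pdet :: "complex ^ ('q::{finite, linorder}) ^ ('q::{finite, linorder}) \<Rightarrow> complex" where
  "pdet P = gdet CARD('q) (\<lambda>i j. P $ (qs ! i) $ (qs ! j))"

lemma prod_list_matrix:
  fixes Y :: "'q::{finite, linorder} \<Rightarrow> 'i::finite grassmann"
  assumes "\<And>k. godd (Y k)"
  shows "prod_list (map (\<lambda>k. \<Sum>m\<in>UNIV. cs (P $ k $ m) * Y m) qs) = cs (pdet P) * prod_list (map Y qs)"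
  using prod_list_linear_combinations[of "\<lambda>j. Y (qs ! j)" "\<lambda>i j. P $ (qs ! i) $ (qs ! j)" "CARD('q)"] assms
  unfolding sum_qs_nth map_qs_nth[symmetric] pdet_def by simp

lemma pdet_transpose: "pdet (transpose P) = pdet P"
  unfolding pdet_def transpose_def using gdet_transpose by fastforce

lemma pdet_inverse:
  fixes P :: "complex ^ ('q::{finite, linorder}) ^ ('q::{finite, linorder})"
  assumes "P ** P' = mat 1" shows "pdet P * pdet P' = 1"
  unfolding pdet_def
proof (rule gdet_inverse)
  show "inj_on (\<lambda>i. qs ! i :: 'q) {..<CARD('q)}" by (auto intro!: inj_onI simp: nth_eq_iff_index_eq)
  fix i k assume ik: "i < CARD('q)" "k < CARD('q)"
  have "(P ** P') $ (qs ! i) $ (qs ! k) = mat 1 $ (qs ! i :: 'q) $ (qs ! k)" using assms by simp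
  moreover have "(qs ! i :: 'q) = qs ! k \<longleftrightarrow> i = k" using nth_eq_iff_index_eq[of "qs :: 'q list" i k] ik by simp
  ultimately show "(\<Sum>j<CARD('q). P $ (qs ! i) $ (qs ! j) * P' $ (qs ! j) $ (qs ! k)) = (if i = k then 1 else 0)"
    by (simp add: matrix_matrix_mult_def mat_def sum_qs_nth)
qed

section \<open>Invariance of the Berezin integral under a change of frame\<close>

definition mfree :: "'i::finite \<Rightarrow> 'i grassmann ^ 'b ^ 'a \<Rightarrow> bool" where
  "mfree i A \<longleftrightarrow> (\<forall>r s. con i (A $ r $ s) = 0)"

lemma mfree_simps [simp]:
  "mfree i (cm X)" "mfree i A \<Longrightarrow> mfree i A' \<Longrightarrow> mfree i (A + A')"
  "mfree i A \<Longrightarrow> mfree i A' \<Longrightarrow> mfree i (A - A')" "mfree i A \<Longrightarrow> mfree i (r *\<^sub>R A)"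
  "mfree i (mat 1)"
  by (auto simp: mfree_def cm_nth mat_def)

lemma mfree_mult [simp]: "mfree i A \<Longrightarrow> mfree i B \<Longrightarrow> meven A \<or> modd A \<Longrightarrow> mfree i (A ** B)"
  by (auto simp: mfree_def meven_def modd_def matrix_matrix_mult_def con_mult_0)

lemma mfree_th_ch [simp]: "mfree (Inr (Inr k)) th" "mfree (Inr (Inl k)) ch"
  by (auto simp: mfree_def th_def ch_def con_gen)

text \<open>By \<open>berezin\<close> only the product of the entries multiplying the
  \<theta>-variables matters, and a linear change of these odd entries scales it by the determinant.
  \<open>R\<close> holds the part of the exponential without \<theta>.\<close>

lemma frame_change_theta:
  fixes X :: "'q::{finite, linorder} gens grassmann ^ ('q::{finite, linorder}) ^ 1"
  assumes X: "modd X" "\<And>k. mfree (Inr (Inl k)) X"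
    and \<eta>: "\<And>k. con (Inr (Inl k)) \<eta> = 0" "\<And>k. con (Inr (Inl k)) R = 0" "geven \<eta> \<or> godd \<eta>"
  shows "top_coef (\<eta> * (exp ((X ** cm P ** th) $ 1 $ 1) * R)) = pdet P * top_coef (\<eta> * (exp ((X ** th) $ 1 $ 1) * R))"
proof -
  have B: "top_coef (\<eta> * (exp ((A ** th) $ 1 $ 1) * R)) = psign CARD('q) *
      top_coef (\<eta> * (prod_list (map (\<lambda>k. A $ 1 $ k) qs) * prod_list (map (\<lambda>k. gen (Inr (Inl k))) qs) * R))"
    if "modd A" "\<And>k. mfree (Inr (Inl k)) A" for A :: "'q gens grassmann ^ ('q::{finite, linorder}) ^ 1"
  proof -
    have "(A ** th) $ 1 $ 1 = (\<Sum>k\<in>UNIV. A $ 1 $ k * gen (Inr (Inl k)))"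
      by (simp add: matrix_matrix_mult_def th_def)
    then show ?thesis
      using berezin[of "\<lambda>k. A $ 1 $ k" "\<lambda>k. gen (Inr (Inl k))" "\<lambda>k. Inr (Inl k)" \<eta> R] that \<eta>
      by (auto simp: modd_def mfree_def con_mult_0 con_gen)
  qed
  have "(X ** cm P) $ 1 $ k = (\<Sum>m\<in>UNIV. cs (transpose P $ k $ m) * X $ 1 $ m)" for k
    by (simp add: matrix_matrix_mult_def cm_nth transpose_def cs_commute)
  then have "prod_list (map (\<lambda>k. (X ** cm P) $ 1 $ k) qs) = cs (pdet P) * prod_list (map (\<lambda>k. X $ 1 $ k) qs)"
    using prod_list_matrix[of "\<lambda>m. X $ 1 $ m" "transpose P"] X(1) by (simp add: modd_def pdet_transpose)
  then have "top_coef (\<eta> * (prod_list (map (\<lambda>k. (X ** cm P) $ 1 $ k) qs) * prod_list (map (\<lambda>k. gen (Inr (Inl k))) qs) * R)) =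
    pdet P * top_coef (\<eta> * (prod_list (map (\<lambda>k. X $ 1 $ k) qs) * prod_list (map (\<lambda>k. gen (Inr (Inl k))) qs) * R))"
    unfolding top_coef_simps(6)[symmetric] by (simp only: mult.assoc mult_cs_left[of \<eta>])
  then show ?thesis using X by (simp add: B)
qed

lemma frame_change_chi:
  fixes Y :: "'q::{finite, linorder} gens grassmann ^ 1 ^ ('q::{finite, linorder})"
  assumes Y: "modd Y" "\<And>k. mfree (Inr (Inr k)) Y"
    and \<eta>: "\<And>k. con (Inr (Inr k)) \<eta> = 0" "\<And>k. con (Inr (Inr k)) R = 0" "geven \<eta> \<or> godd \<eta>"
  shows "top_coef (\<eta> * (exp ((ch ** (cm P ** Y)) $ 1 $ 1) * R)) = pdet P * top_coef (\<eta> * (exp ((ch ** Y) $ 1 $ 1) * R))"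
proof -
  have B: "top_coef (\<eta> * (exp ((ch ** A) $ 1 $ 1) * R)) = psign CARD('q) *
      top_coef (\<eta> * (prod_list (map (\<lambda>k. gen (Inr (Inr k))) qs) * prod_list (map (\<lambda>k. A $ k $ 1) qs) * R))"
    if "modd A" "\<And>k. mfree (Inr (Inr k)) A" for A :: "'q gens grassmann ^ 1 ^ ('q::{finite, linorder})"
  proof -
    have "(ch ** A) $ 1 $ 1 = (\<Sum>k\<in>UNIV. gen (Inr (Inr k)) * A $ k $ 1)"
      by (simp add: matrix_matrix_mult_def ch_def)
    then show ?thesis
      using berezin[of "\<lambda>k. gen (Inr (Inr k))" "\<lambda>k. A $ k $ 1" "\<lambda>k. Inr (Inr k)" \<eta> R] that \<eta>
      by (auto simp: modd_def mfree_def con_mult_0 con_gen)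
  qed
  have "(cm P ** Y) $ k $ 1 = (\<Sum>m\<in>UNIV. cs (P $ k $ m) * Y $ m $ 1)" for k
    by (simp add: matrix_matrix_mult_def cm_nth)
  then have "prod_list (map (\<lambda>k. (cm P ** Y) $ k $ 1) qs) = cs (pdet P) * prod_list (map (\<lambda>k. Y $ k $ 1) qs)"
    using prod_list_matrix[of "\<lambda>m. Y $ m $ 1" P] Y(1) by (simp add: modd_def)
  then have "top_coef (\<eta> * (prod_list (map (\<lambda>k. gen (Inr (Inr k))) qs) * prod_list (map (\<lambda>k. (cm P ** Y) $ k $ 1) qs) * R)) =
    pdet P * top_coef (\<eta> * (prod_list (map (\<lambda>k. gen (Inr (Inr k))) qs) * prod_list (map (\<lambda>k. Y $ k $ 1) qs) * R))"
    unfolding top_coef_simps(6)[symmetric]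
    by (simp only: mult.assoc mult_cs_left[of \<eta>] mult_cs_left[of "prod_list (map (\<lambda>k. gen (Inr (Inr k))) qs)"])
  then show ?thesis using Y by (simp add: B)
qed

definition Mexp :: "'q::{finite, linorder} gens grassmann ^ ('q::{finite, linorder}) ^ 1 \<Rightarrow> 'q gens grassmann ^ 1 ^ ('q::{finite, linorder}) \<Rightarrow>
    'q gens grassmann ^ ('q::{finite, linorder}) ^ ('q::{finite, linorder}) \<Rightarrow> 'q gens grassmann" where
  "Mexp a b C = (a ** th + ch ** b + ch ** C ** th) $ 1 $ 1"

lemma geven_Mexp [simp]: assumes "modd a" "modd b" "meven C" shows "geven (Mexp a b C)"
proof -
  have "meven (a ** th + ch ** b + ch ** C ** th)"
    by (intro meven_simps mparity_mult) (simp_all add: assms)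
  then show ?thesis by (simp add: Mexp_def meven_def)
qed

text \<open>The substitution \<theta> \<mapsto> P\<theta> costs \<open>pdet P\<close> and \<chi>
  \<mapsto> \<chi>P' costs \<open>pdet P'\<close>; these factors are inverse to each other.\<close>

lemma frame_change:
  fixes a :: "'q::{finite, linorder} gens grassmann ^ ('q::{finite, linorder}) ^ 1"
  assumes odd: "modd a" "modd b" "meven C" and free: "\<And>i. mfree (Inr i) a" "\<And>i. mfree (Inr i) b" "\<And>i. mfree (Inr i) C"
    and \<eta>: "eps_only \<eta>" "geven \<eta> \<or> godd \<eta>" and P: "P ** P' = mat 1"
  shows "top_coef (\<eta> * exp (Mexp (a ** cm P) (cm P' ** b) (cm P' ** C ** cm P))) = top_coef (\<eta> * exp (Mexp a b C))"
proof -
  have \<eta>': "con (Inr i) \<eta> = 0" for i using \<eta>(1) by (simp add: eps_only_def)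
  have even: "meven A \<Longrightarrow> geven (A $ r $ s)" for A :: "'q gens grassmann ^ 1 ^ 1" and r s
    unfolding meven_def by blast
  have con: "con i (exp (A $ r $ s)) = 0" if "meven A" "mfree i A" for i r s and A :: "'q gens grassmann ^ 1 ^ 1"
  proof -
    have "con i (A $ r $ s) = 0" using that(2) unfolding mfree_def by blast
    then show ?thesis using con_exp[OF even[OF that(1), of r s], of i] by simp
  qed
  \<comment> \<open>The exponent is linear in \<theta> with coefficient row \<open>?X\<close> (up to
    \<open>cm P\<close>) and linear in \<chi> with coefficient column \<open>?Y\<close>; grouping it
    in these two ways treats one variable at a time although the term with \<open>C\<close> contains
    both.\<close>
  let ?X = "a + ch ** cm P' ** C" and ?Y = "b + C ** th"
  let ?p = "(ch ** (cm P' ** b)) $ 1 $ 1"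
  have "Mexp (a ** cm P) (cm P' ** b) (cm P' ** C ** cm P) = (?X ** cm P ** th) $ 1 $ 1 + ?p"
    by (simp add: Mexp_def matrix_ring_simps algebra_simps)
  moreover have "exp ((?X ** cm P ** th) $ 1 $ 1 + ?p) = exp ((?X ** cm P ** th) $ 1 $ 1) * exp ?p"
    by (intro exp_add_commuting geven_commute even) (simp add: odd)
  ultimately have "top_coef (\<eta> * exp (Mexp (a ** cm P) (cm P' ** b) (cm P' ** C ** cm P))) =
      top_coef (\<eta> * (exp ((?X ** cm P ** th) $ 1 $ 1) * exp ?p))" by simp
  also have "\<dots> = pdet P * top_coef (\<eta> * (exp ((?X ** th) $ 1 $ 1) * exp ?p))"
    by (rule frame_change_theta) (simp_all add: odd free \<eta> \<eta>' con)
  also have "exp ((?X ** th) $ 1 $ 1) * exp ?p = exp ((?X ** th) $ 1 $ 1 + ?p)"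
    by (intro exp_add_commuting[symmetric] geven_commute even) (simp add: odd)
  also have "(?X ** th) $ 1 $ 1 + ?p = (ch ** (cm P' ** ?Y)) $ 1 $ 1 + (a ** th) $ 1 $ 1"
    by (simp add: matrix_ring_simps algebra_simps)
  also have "exp \<dots> = exp ((ch ** (cm P' ** ?Y)) $ 1 $ 1) * exp ((a ** th) $ 1 $ 1)"
    by (intro exp_add_commuting geven_commute even) (simp add: odd)
  also have "top_coef (\<eta> * (exp ((ch ** (cm P' ** ?Y)) $ 1 $ 1) * exp ((a ** th) $ 1 $ 1))) =
      pdet P' * top_coef (\<eta> * (exp ((ch ** ?Y) $ 1 $ 1) * exp ((a ** th) $ 1 $ 1)))"
    by (rule frame_change_chi) (simp_all add: odd free \<eta> \<eta>' con)
  also have "exp ((ch ** ?Y) $ 1 $ 1) * exp ((a ** th) $ 1 $ 1) = exp ((ch ** ?Y) $ 1 $ 1 + (a ** th) $ 1 $ 1)"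
    by (intro exp_add_commuting[symmetric] geven_commute even) (simp add: odd)
  also have "(ch ** ?Y) $ 1 $ 1 + (a ** th) $ 1 $ 1 = Mexp a b C"
    by (simp add: Mexp_def matrix_ring_simps algebra_simps)
  finally show ?thesis using pdet_inverse[OF P] by (simp flip: mult.assoc)
qed

text \<open>The factor \<open>\<chi>\<theta>\<close> is the derivative at \<open>r = 0\<close> of the exponential with \<open>C + r\<close> in place of \<open>C\<close>.\<close>

lemma frame_change_N:
  fixes a :: "'q::{finite, linorder} gens grassmann ^ ('q::{finite, linorder}) ^ 1"
  assumes odd: "modd a" "modd b" "meven C" and free: "\<And>i. mfree (Inr i) a" "\<And>i. mfree (Inr i) b" "\<And>i. mfree (Inr i) C"
    and \<eta>: "eps_only \<eta>" "geven \<eta> \<or> godd \<eta>" and P: "P ** P' = mat 1"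
  shows "top_coef (\<eta> * (exp (Mexp (a ** cm P) (cm P' ** b) (cm P' ** C ** cm P)) * (ch ** th) $ 1 $ 1)) =
    top_coef (\<eta> * (exp (Mexp a b C) * (ch ** th) $ 1 $ 1))"
proof -
  let ?K = "(ch ** th) $ 1 $ 1 :: 'q gens grassmann"
  have P': "P' ** P = mat 1" using P matrix_left_right_inverse by blast
  have deriv: "((\<lambda>r. top_coef (\<eta> * exp (M + r *\<^sub>R ?K))) has_derivative
      (\<lambda>h. top_coef (\<eta> * (exp M * (h *\<^sub>R ?K))))) (at (0::real))" if "geven M" for M
  proof -
    have "((\<lambda>r. M + r *\<^sub>R ?K) has_derivative (\<lambda>h. h *\<^sub>R ?K)) (at (0::real))"
      by (auto intro!: derivative_eq_intros)
    from has_derivative_exp_even[OF this] that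
    have "((\<lambda>r. exp (M + r *\<^sub>R ?K)) has_derivative (\<lambda>h. exp M * (h *\<^sub>R ?K))) (at (0::real))" by simp
    then show ?thesis
      by (intro bounded_linear.has_derivative[OF bounded_linear_top_coef] has_derivative_mult_right)
  qed
  have shift: "Mexp a' b' (C' + r *\<^sub>R mat 1) = Mexp a' b' C' + r *\<^sub>R ?K" for a' b' C' r
    by (simp add: Mexp_def matrix_ring_simps)
  have conj: "cm P' ** (C + r *\<^sub>R mat 1) ** cm P = cm P' ** C ** cm P + r *\<^sub>R mat 1" for r
    using P' by (simp add: matrix_ring_simps cm_simps(1)[symmetric] cm_simps(5) del: cm_simps(1))
  have eq: "top_coef (\<eta> * exp (Mexp (a ** cm P) (cm P' ** b) (cm P' ** C ** cm P) + r *\<^sub>R ?K)) =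
      top_coef (\<eta> * exp (Mexp a b C + r *\<^sub>R ?K))" for r
    using frame_change[of a b "C + r *\<^sub>R mat 1" \<eta> P P'] assms by (simp add: conj shift)
  have "((\<lambda>r. top_coef (\<eta> * exp (Mexp a b C + r *\<^sub>R ?K))) has_derivative
      (\<lambda>h. top_coef (\<eta> * (exp (Mexp (a ** cm P) (cm P' ** b) (cm P' ** C ** cm P)) * (h *\<^sub>R ?K))))) (at (0::real))"
    using deriv[of "Mexp (a ** cm P) (cm P' ** b) (cm P' ** C ** cm P)"] odd unfolding eq by simp
  from fun_cong[OF has_derivative_unique[OF this deriv[OF geven_Mexp[OF odd]]], of 1]
  show ?thesis by simp
qed

section \<open>The forms at the base plane as Berezin integrals\<close>

text \<open>Indices in \<open>ks\<close> are forced by the top degree, and indices outside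
  \<open>ks\<close> are annihilated by \<open>\<kappa>\<close>. The full list serves
  \<open>phi_KM\<close>; a list with one index missing serves a summand of
  \<open>psi\<close>.\<close>

lemma prod_list_to_exp:
  fixes x :: "'q::{finite, linorder} \<Rightarrow> 'i::finite grassmann"
  assumes ks: "distinct ks" and x: "\<And>k. geven (x k)" "\<And>k. x k * x k = 0"
    and g: "\<And>k l. k \<noteq> l \<Longrightarrow> con (g k) (x l) = 0"
    and \<kappa>: "\<And>k. k \<in> set ks \<Longrightarrow> con (g k) \<kappa> = 0" "\<And>k. k \<notin> set ks \<Longrightarrow> \<kappa> * x k = 0" "geven \<kappa> \<or> godd \<kappa>"
    and R: "\<And>k. k \<in> set ks \<Longrightarrow> con (g k) R = 0"
  shows "top_coef (\<kappa> * (prod_list (map x ks) * R)) = top_coef (\<kappa> * (exp (\<Sum>k\<in>UNIV. x k) * R))"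
proof -
  have "(\<Sum>k\<in>UNIV. x k) = (\<Sum>k\<in>- set ks. x k) + (\<Sum>k\<in>set ks. x k)"
    by (metis finite sum.subset_diff subset_UNIV Compl_eq_Diff_UNIV)
  then have "exp (\<Sum>k\<in>UNIV. x k) = exp (\<Sum>k\<in>- set ks. x k) * exp (\<Sum>k\<in>set ks. x k)"
    by (simp add: exp_add_commuting geven_commute x)
  also have "(\<Sum>k\<in>set ks. x k) = sum_list (map x ks)"
    using ks by (simp add: sum_list_distinct_conv_sum_set)
  also have "exp (sum_list (map x ks)) = prod_list (map (\<lambda>k. 1 + x k) ks)"
    by (rule exp_sum_list) (auto simp: x)
  finally have "\<kappa> * (exp (\<Sum>k\<in>UNIV. x k) * R) = \<kappa> * exp (\<Sum>k\<in>- set ks. x k) * (prod_list (map (\<lambda>k. 1 + x k) ks) * R)"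
    by (simp add: mult.assoc)
  also have "\<kappa> * exp (\<Sum>k\<in>- set ks. x k) = \<kappa>"
    by (rule mult_exp_absorb) (simp add: sum_distrib_left \<kappa>(2))
  finally show ?thesis using keep_top[of ks x g \<kappa> R] ks x g \<kappa> R by simp
qed

lemma prod_list_mult_even:
  assumes "\<And>i. i \<in> set is \<Longrightarrow> geven (b i)"
  shows "prod_list (map (\<lambda>i. a i * b i) is) = prod_list (map a is) * prod_list (map b is)"
  using assms
proof (induction "is")
  case (Cons i "is")
  have "a i * b i * (prod_list (map a is) * prod_list (map b is)) =
      a i * (b i * prod_list (map a is)) * prod_list (map b is)" by (simp add: mult.assoc)
  also have "b i * prod_list (map a is) = prod_list (map a is) * b i"
    using Cons.prems by (intro geven_commute) simp
  finally show ?case using Cons by (simp add: mult.assoc)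
qed simp

lemma map_nth_upt: "map (\<lambda>i. f (xs ! i)) [0..<length xs] = map f xs"
  by (rule nth_equalityI) auto

lemma finite_lists_UNIV: "finite {xs :: 'a::finite list. length xs = n}"
  using finite_lists_length_eq[of "UNIV :: 'a set" n] by simp

lemma cs_two: "cs (2 * c) = 2 *\<^sub>R cs c"
  by (simp add: grassmann_eq_iff scaleR_complex)

locale form_tangent = eps_tangent es w
  for es :: "'q::{finite, linorder} gens grassmann list" and w :: "(complex ^ ('q::{finite, linorder}) ^ 'p::finite) list"
begin

text \<open>The non-Gaussian part of the exponent \<open>E\<close> at Z = 0, where
  \<open>Hmat\<close> and \<open>Gmat\<close> are the identity.\<close>

definition Mu :: "complex ^ ('p + 'q) \<Rightarrow> 'q gens grassmann" where
  "Mu y = Mexp (- 2 *\<^sub>R (cm (ct (pos_part y)) ** W)) (- 2 *\<^sub>R (Ws ** cm (pos_part y))) (- (2 / pi) *\<^sub>R (Ws ** W))"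

lemma godd_W_nth [simp]: "godd (W $ \<alpha> $ k)" "godd (Ws $ k $ \<alpha>)"
  using modd_W by (simp_all only: modd_def)

lemma con_W [simp]: "con (Inr i) (W $ \<alpha> $ k) = 0" "con (Inr i) (Ws $ k $ \<alpha>) = 0"
  using eps_only_W unfolding eps_only_def by blast+

text \<open>Chosen so that the \<chi>-linear part of the exponent is \<Sum> z_\<beta>
  \<open>Vc \<beta>\<close> (\<open>sum_Xc\<close>), the shape required by
  \<open>foldr_D_op_exp\<close>.\<close>

definition Vc :: "'p \<Rightarrow> 'q gens grassmann" where
  "Vc \<beta> = (\<Sum>k\<in>UNIV. 2 *\<^sub>R (Ws $ k $ \<beta> * gen (Inr (Inr k))))"

lemma geven_Vc [simp]: "geven (Vc \<beta>)"
  by (simp add: Vc_def)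

definition Xc :: "complex ^ ('p + 'q) \<Rightarrow> 'q \<Rightarrow> 'q gens grassmann" where
  "Xc y k = (\<Sum>\<beta>\<in>UNIV. cs (2 * y $ Inl \<beta>) * (Ws $ k $ \<beta> * gen (Inr (Inr k))))"

definition Nc :: "complex ^ ('p + 'q) \<Rightarrow> 'q \<Rightarrow> 'q gens grassmann" where
  "Nc y k = (\<Sum>\<alpha>\<in>UNIV. gen (Inr (Inl k)) * W $ \<alpha> $ k * (cs (2 * cnj (y $ Inl \<alpha>)) - (1 / pi) *\<^sub>R Vc \<alpha>))"

lemma Xc_factor: "Xc y k = (\<Sum>\<beta>\<in>UNIV. cs (2 * y $ Inl \<beta>) * Ws $ k $ \<beta>) * gen (Inr (Inr k))"
  by (simp add: Xc_def sum_distrib_right mult.assoc)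

lemma Nc_factor: "Nc y k = gen (Inr (Inl k)) * (\<Sum>\<alpha>\<in>UNIV. W $ \<alpha> $ k * (cs (2 * cnj (y $ Inl \<alpha>)) - (1 / pi) *\<^sub>R Vc \<alpha>))"
  by (simp add: Nc_def sum_distrib_left mult.assoc)

lemma sum_Xc: "(\<Sum>k\<in>UNIV. Xc y k) = (\<Sum>\<beta>\<in>UNIV. cs (y $ Inl \<beta>) * Vc \<beta>)"
  unfolding Xc_def Vc_def sum_distrib_left cs_two by (subst sum.swap) simp

lemma parity_Xc_Nc [simp]: "geven (Xc y k)" "geven (Nc y k)" "Xc y k * Xc y k = 0" "Nc y k * Nc y k = 0"
proof -
  have 1: "godd (\<Sum>\<beta>\<in>UNIV. cs (2 * y $ Inl \<beta>) * Ws $ k $ \<beta>)" by (intro godd_sum parity_mult) auto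
  have 2: "godd (\<Sum>\<alpha>\<in>UNIV. W $ \<alpha> $ k * (cs (2 * cnj (y $ Inl \<alpha>)) - (1 / pi) *\<^sub>R Vc \<alpha>))"
    by (intro godd_sum parity_mult) auto
  show "geven (Xc y k)" "Xc y k * Xc y k = 0" unfolding Xc_factor using 1 by (auto simp: odd_pair_square)
  show "geven (Nc y k)" "Nc y k * Nc y k = 0" unfolding Nc_factor using 2 by (auto simp: odd_pair_square)
qed

lemma con_Vc: "con (Inr (Inl k)) (Vc \<beta>) = 0"
  by (simp add: Vc_def con_mult_odd con_gen)

lemma con_Xc: "con (Inr (Inl k)) (Xc y l) = 0" "k \<noteq> l \<Longrightarrow> con (Inr (Inr k)) (Xc y l) = 0"
  by (simp_all add: Xc_def con_mult_even con_mult_odd con_gen)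

lemma con_Nc: "k \<noteq> l \<Longrightarrow> con (Inr (Inl k)) (Nc y l) = 0"
  by (simp add: Nc_def con_mult_even con_mult_odd con_gen con_Vc)

text \<open>Reordering each odd pair turns the factors -2 into 2. The quadratic term with
  \<chi>C\<theta> becomes the contraction -\<open>Vc\<close>/\<pi> that \<open>D_op\<close> leaves
  in \<open>foldr_D_op_exp\<close>.\<close>

lemma Mu_eq: "Mu y = (\<Sum>k\<in>UNIV. Nc y k) + (\<Sum>k\<in>UNIV. Xc y k)"
proof -
  let ?t = "\<lambda>k. gen (Inr (Inl k)) :: 'q gens grassmann" and ?c = "\<lambda>k. gen (Inr (Inr k)) :: 'q gens grassmann"
  have anti: "a * b = - (b * a)" if "godd a" "godd b" for a b :: "'q gens grassmann"
    using godd_anticommute that .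
  have "(cm (ct (pos_part y)) ** W ** th) $ 1 $ 1 = (\<Sum>k\<in>UNIV. \<Sum>\<alpha>\<in>UNIV. cs (cnj (y $ Inl \<alpha>)) * (W $ \<alpha> $ k * ?t k))"
    by (simp add: matrix_matrix_mult_def cm_nth ct_def pos_part_def th_def sum_distrib_right mult.assoc)
  then have A: "- 2 *\<^sub>R (cm (ct (pos_part y)) ** W ** th) $ 1 $ 1 =
      (\<Sum>k\<in>UNIV. \<Sum>\<alpha>\<in>UNIV. ?t k * W $ \<alpha> $ k * cs (2 * cnj (y $ Inl \<alpha>)))"
    unfolding cs_two scaleR_sum_right by (auto intro!: sum.cong simp: scaleR_sum_right anti[of "?t _" "W $ _ $ _"] cs_commute)
  have "(ch ** (Ws ** cm (pos_part y))) $ 1 $ 1 = (\<Sum>k\<in>UNIV. \<Sum>\<beta>\<in>UNIV. cs (y $ Inl \<beta>) * (?c k * Ws $ k $ \<beta>))"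
    by (simp add: matrix_matrix_mult_def cm_nth pos_part_def ch_def sum_distrib_left cs_commute flip: mult.assoc)
  then have B: "- 2 *\<^sub>R (ch ** (Ws ** cm (pos_part y))) $ 1 $ 1 = (\<Sum>k\<in>UNIV. Xc y k)"
    unfolding Xc_def cs_two scaleR_sum_right by (auto intro!: sum.cong simp: scaleR_sum_right anti[of "?c _" "Ws $ _ $ _"])
  have "(ch ** Ws ** W ** th) $ 1 $ 1 = (\<Sum>k\<in>UNIV. \<Sum>\<alpha>\<in>UNIV. \<Sum>l\<in>UNIV. ?c l * Ws $ l $ \<alpha> * W $ \<alpha> $ k * ?t k)"
    by (simp add: matrix_matrix_mult_def ch_def th_def sum_distrib_right)
  moreover have "?c l * Ws $ l $ \<alpha> * W $ \<alpha> $ k * ?t k = ?t k * W $ \<alpha> $ k * (Ws $ l $ \<alpha> * ?c l)" for k l \<alpha>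
  proof -
    have "?c l * Ws $ l $ \<alpha> * W $ \<alpha> $ k * ?t k = (?c l * Ws $ l $ \<alpha>) * (W $ \<alpha> $ k * ?t k)" by (simp add: mult.assoc)
    also have "\<dots> = (W $ \<alpha> $ k * ?t k) * (?c l * Ws $ l $ \<alpha>)" by (rule geven_commute) simp
    also have "\<dots> = ?t k * W $ \<alpha> $ k * (Ws $ l $ \<alpha> * ?c l)"
      by (simp add: anti[of "W $ _ $ _" "?t _"] anti[of "?c _" "Ws $ _ $ _"])
    finally show ?thesis .
  qed
  ultimately have "(ch ** Ws ** W ** th) $ 1 $ 1 = (\<Sum>k\<in>UNIV. \<Sum>\<alpha>\<in>UNIV. ?t k * W $ \<alpha> $ k * (\<Sum>l\<in>UNIV. Ws $ l $ \<alpha> * ?c l))"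
    by (simp add: sum_distrib_left)
  moreover have "(\<Sum>l\<in>UNIV. Ws $ l $ \<alpha> * ?c l) = (1 / 2) *\<^sub>R Vc \<alpha>" for \<alpha>
    by (simp add: Vc_def scaleR_sum_right)
  ultimately have C: "- (2 / pi) *\<^sub>R (ch ** Ws ** W ** th) $ 1 $ 1 =
      (\<Sum>k\<in>UNIV. \<Sum>\<alpha>\<in>UNIV. - (?t k * W $ \<alpha> $ k * ((1 / pi) *\<^sub>R Vc \<alpha>)))"
    by (simp add: scaleR_sum_right sum_negf)
  have "Mu y = - 2 *\<^sub>R (cm (ct (pos_part y)) ** W ** th) $ 1 $ 1 + - 2 *\<^sub>R (ch ** (Ws ** cm (pos_part y))) $ 1 $ 1
      + - (2 / pi) *\<^sub>R (ch ** Ws ** W ** th) $ 1 $ 1"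
    by (simp add: Mu_def Mexp_def matrix_ring_simps)
  also have "\<dots> = (\<Sum>k\<in>UNIV. Nc y k) + (\<Sum>k\<in>UNIV. Xc y k)"
    unfolding A B C Nc_def right_diff_distrib sum_subtractf by (simp add: sum_negf)
  finally show ?thesis .
qed

lemma form_sum_beta:
  fixes y :: "complex ^ ('p + 'q)" and ks :: "'q list"
  assumes ks: "distinct ks" and \<kappa>: "geven \<kappa> \<or> godd \<kappa>" "\<And>k. k \<in> set ks \<Longrightarrow> con (Inr (Inr k)) \<kappa> = 0"
    "\<And>k. k \<notin> set ks \<Longrightarrow> \<kappa> * gen (Inr (Inr k)) = 0"
  shows "(\<Sum>\<beta>s | length \<beta>s = length ks. top_coef (\<kappa> * prod_list (map (\<lambda>i. Ws $ (ks ! i) $ (\<beta>s ! i) * gen (Inr (Inr (ks ! i)))) [0..<length ks])) *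
      prod_list (map (\<lambda>\<beta>. 2 * y $ Inl \<beta>) \<beta>s)) = top_coef (\<kappa> * exp (\<Sum>\<beta>\<in>UNIV. cs (y $ Inl \<beta>) * Vc \<beta>))"
proof -
  let ?u = "\<lambda>i \<beta>. Ws $ (ks ! i) $ \<beta> * gen (Inr (Inr (ks ! i)))" and ?m = "length ks"
  have "top_coef (\<kappa> * prod_list (map (\<lambda>i. ?u i (\<beta>s ! i)) [0..<?m])) * prod_list (map (\<lambda>\<beta>. 2 * y $ Inl \<beta>) \<beta>s) =
      top_coef (\<kappa> * prod_list (map (\<lambda>i. cs (2 * y $ Inl (\<beta>s ! i)) * ?u i (\<beta>s ! i)) [0..<?m]))"
    if "length \<beta>s = ?m" for \<beta>s
    using map_nth_upt[of "\<lambda>\<beta>. 2 * y $ Inl \<beta>" \<beta>s] that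
    by (simp add: prod_list_cs mult_cs_left[of \<kappa>] top_coef_simps)
  then have "(\<Sum>\<beta>s | length \<beta>s = ?m. top_coef (\<kappa> * prod_list (map (\<lambda>i. ?u i (\<beta>s ! i)) [0..<?m])) *
        prod_list (map (\<lambda>\<beta>. 2 * y $ Inl \<beta>) \<beta>s)) =
      top_coef (\<kappa> * (\<Sum>\<beta>s | length \<beta>s = ?m. prod_list (map (\<lambda>i. cs (2 * y $ Inl (\<beta>s ! i)) * ?u i (\<beta>s ! i)) [0..<?m])))"
    by (simp add: sum_distrib_left top_coef_simps)
  also have "(\<Sum>\<beta>s | length \<beta>s = ?m. prod_list (map (\<lambda>i. cs (2 * y $ Inl (\<beta>s ! i)) * ?u i (\<beta>s ! i)) [0..<?m])) =
      prod_list (map (\<lambda>i. Xc y (ks ! i)) [0..<?m])"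
    using prod_list_sum[of UNIV "\<lambda>i \<beta>. cs (2 * y $ Inl \<beta>) * ?u i \<beta>" ?m] by (simp add: Xc_def)
  also have "map (\<lambda>i. Xc y (ks ! i)) [0..<?m] = map (Xc y) ks" by (rule map_nth_upt)
  also have "top_coef (\<kappa> * prod_list (map (Xc y) ks)) = top_coef (\<kappa> * exp (\<Sum>k\<in>UNIV. Xc y k))"
  proof -
    have "\<kappa> * Xc y k = 0" if "k \<notin> set ks" for k
    proof -
      have "godd (\<Sum>\<beta>\<in>UNIV. cs (2 * y $ Inl \<beta>) * Ws $ k $ \<beta>)" by (intro godd_sum parity_mult) auto
      from godd_anticommute[OF this, of "gen (Inr (Inr k))"]
      have "\<kappa> * Xc y k = - (\<kappa> * gen (Inr (Inr k)) * (\<Sum>\<beta>\<in>UNIV. cs (2 * y $ Inl \<beta>) * Ws $ k $ \<beta>))"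
        unfolding Xc_factor by (simp add: mult.assoc)
      then show ?thesis using \<kappa>(3)[OF that] by simp
    qed
    then show ?thesis
      using prod_list_to_exp[OF ks, of "Xc y" "\<lambda>k. Inr (Inr k)" \<kappa> 1] by (simp add: con_Xc \<kappa>)
  qed
  finally show ?thesis by (simp only: sum_Xc)
qed

text \<open>The generating function of the Hermite functions: summed over \<open>\<beta>s\<close>,
  the monomials form an exponential, each \<open>D_op\<close> multiplies it by a linear factor, and
  summation over \<open>\<alpha>s\<close> makes these factors exponential too.\<close>

lemma form_sum:
  fixes y :: "complex ^ ('p + 'q)" and ks :: "'q list"
  assumes ks: "distinct ks" and \<kappa>: "geven \<kappa> \<or> godd \<kappa>"
    "\<And>k. k \<in> set ks \<Longrightarrow> con (Inr (Inl k)) \<kappa> = 0" "\<And>k. k \<in> set ks \<Longrightarrow> con (Inr (Inr k)) \<kappa> = 0"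
    "\<And>k. k \<notin> set ks \<Longrightarrow> \<kappa> * gen (Inr (Inl k)) = 0" "\<And>k. k \<notin> set ks \<Longrightarrow> \<kappa> * gen (Inr (Inr k)) = 0"
  shows "(\<Sum>\<alpha>s | length \<alpha>s = length ks. \<Sum>\<beta>s | length \<beta>s = length ks. D_phi \<alpha>s \<beta>s y *
      top_coef (\<kappa> * (prod_list (map (\<lambda>i. gen (Inr (Inl (ks ! i))) * W $ (\<alpha>s ! i) $ (ks ! i)) [0..<length ks]) *
        prod_list (map (\<lambda>i. Ws $ (ks ! i) $ (\<beta>s ! i) * gen (Inr (Inr (ks ! i)))) [0..<length ks])))) =
    phi_zero y * top_coef (\<kappa> * exp (Mu y))"
proof -
  let ?m = "length ks"
  let ?t = "\<lambda>i \<alpha>. gen (Inr (Inl (ks ! i))) * W $ \<alpha> $ (ks ! i)"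
  let ?A = "\<lambda>\<alpha>s. prod_list (map (\<lambda>i. ?t i (\<alpha>s ! i)) [0..<?m])"
  let ?B = "\<lambda>\<beta>s. prod_list (map (\<lambda>i. Ws $ (ks ! i) $ (\<beta>s ! i) * gen (Inr (Inr (ks ! i)))) [0..<?m])"
  let ?q = "\<lambda>\<alpha>. cs (2 * cnj (y $ Inl \<alpha>)) - (1 / pi) *\<^sub>R Vc \<alpha>"
  let ?E = "\<lambda>y :: complex ^ ('p + 'q). exp (\<Sum>\<beta>\<in>UNIV. cs (y $ Inl \<beta>) * Vc \<beta>)"
  have evA: "geven (?A \<alpha>s)" for \<alpha>s by (intro geven_prod_list) auto
  have inner: "(\<Sum>\<beta>s | length \<beta>s = ?m. D_phi \<alpha>s \<beta>s y * top_coef (\<kappa> * (?A \<alpha>s * ?B \<beta>s))) =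
      phi_zero y * top_coef (\<kappa> * (prod_list (map (\<lambda>i. ?t i (\<alpha>s ! i) * ?q (\<alpha>s ! i)) [0..<?m]) * ?E y))"
    if len: "length \<alpha>s = ?m" for \<alpha>s
  proof -
    let ?\<kappa> = "\<kappa> * ?A \<alpha>s"
    have \<kappa>': "geven ?\<kappa> \<or> godd ?\<kappa>" using \<kappa>(1) evA[of \<alpha>s] by auto
    have conA: "con (Inr (Inr k)) ?\<kappa> = 0" if "k \<in> set ks" for k
    proof (rule con_mult_0[OF \<kappa>(3)[OF that] _ \<kappa>(1)])
      show "con (Inr (Inr k)) (?A \<alpha>s) = 0"
        by (rule con_prod_list_0) (auto simp: con_mult_odd con_gen)
    qed
    have zero: "?\<kappa> * gen (Inr (Inr k)) = 0" if "k \<notin> set ks" for k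
    proof -
      have "?\<kappa> * gen (Inr (Inr k)) = \<kappa> * (?A \<alpha>s * gen (Inr (Inr k)))" by (rule mult.assoc)
      also have "?A \<alpha>s * gen (Inr (Inr k)) = gen (Inr (Inr k)) * ?A \<alpha>s" by (rule geven_commute[OF evA])
      also have "\<kappa> * (gen (Inr (Inr k)) * ?A \<alpha>s) = \<kappa> * gen (Inr (Inr k)) * ?A \<alpha>s" by (rule mult.assoc[symmetric])
      finally show ?thesis using \<kappa>(5)[OF that] by simp
    qed
    \<comment> \<open>The coefficients do not depend on \<open>y\<close>, so the operators move
      outside the sum over \<open>\<beta>s\<close> and act on a single exponential.\<close>
    have lin: "foldr D_op \<alpha>s (\<lambda>y. \<Sum>\<beta>s\<in>{\<beta>s. length \<beta>s = ?m}. top_coef (?\<kappa> * ?B \<beta>s) * (phi_zero y * prod_list (map (\<lambda>\<beta>. 2 * y $ Inl \<beta>) \<beta>s))) =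
        (\<lambda>y :: complex ^ ('p + 'q). \<Sum>\<beta>s\<in>{\<beta>s. length \<beta>s = ?m}. top_coef (?\<kappa> * ?B \<beta>s) * foldr D_op \<alpha>s (\<lambda>y. phi_zero y * prod_list (map (\<lambda>\<beta>. 2 * y $ Inl \<beta>) \<beta>s)) y)"
      by (rule conjunct1[OF foldr_D_op_linear]) (rule polyfun_prod_list finite_lists_UNIV)+
    have "(\<Sum>\<beta>s | length \<beta>s = ?m. D_phi \<alpha>s \<beta>s y * top_coef (\<kappa> * (?A \<alpha>s * ?B \<beta>s))) =
        (\<Sum>\<beta>s | length \<beta>s = ?m. top_coef (?\<kappa> * ?B \<beta>s) * foldr D_op \<alpha>s (\<lambda>y. phi_zero y * prod_list (map (\<lambda>\<beta>. 2 * y $ Inl \<beta>) \<beta>s)) y)"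
      by (simp add: D_phi_def foldr_Dbar_op mult.assoc mult.commute)
    also have "\<dots> = foldr D_op \<alpha>s (\<lambda>y. \<Sum>\<beta>s\<in>{\<beta>s. length \<beta>s = ?m}. top_coef (?\<kappa> * ?B \<beta>s) * (phi_zero y * prod_list (map (\<lambda>\<beta>. 2 * y $ Inl \<beta>) \<beta>s))) y"
      unfolding lin ..
    also have "(\<lambda>y :: complex ^ ('p + 'q). \<Sum>\<beta>s\<in>{\<beta>s. length \<beta>s = ?m}. top_coef (?\<kappa> * ?B \<beta>s) * (phi_zero y * prod_list (map (\<lambda>\<beta>. 2 * y $ Inl \<beta>) \<beta>s))) =
        (\<lambda>y. phi_zero y * top_coef (?\<kappa> * ?E y))"
    proof
      fix y :: "complex ^ ('p + 'q)"
      have "(\<Sum>\<beta>s\<in>{\<beta>s. length \<beta>s = ?m}. top_coef (?\<kappa> * ?B \<beta>s) * (phi_zero y * prod_list (map (\<lambda>\<beta>. 2 * y $ Inl \<beta>) \<beta>s))) =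
          phi_zero y * (\<Sum>\<beta>s\<in>{\<beta>s. length \<beta>s = ?m}. top_coef (?\<kappa> * ?B \<beta>s) * prod_list (map (\<lambda>\<beta>. 2 * y $ Inl \<beta>) \<beta>s))"
        unfolding sum_distrib_left by (intro sum.cong refl mult.left_commute)
      also have "(\<Sum>\<beta>s\<in>{\<beta>s. length \<beta>s = ?m}. top_coef (?\<kappa> * ?B \<beta>s) * prod_list (map (\<lambda>\<beta>. 2 * y $ Inl \<beta>) \<beta>s)) =
          top_coef (?\<kappa> * ?E y)"
        by (rule form_sum_beta[OF ks \<kappa>' conA zero])
      finally show "(\<Sum>\<beta>s\<in>{\<beta>s. length \<beta>s = ?m}. top_coef (?\<kappa> * ?B \<beta>s) * (phi_zero y * prod_list (map (\<lambda>\<beta>. 2 * y $ Inl \<beta>) \<beta>s))) =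
          phi_zero y * top_coef (?\<kappa> * ?E y)" .
    qed
    also have "foldr D_op \<alpha>s \<dots> y = phi_zero y * top_coef (?\<kappa> * (prod_list (map ?q \<alpha>s) * ?E y))"
      unfolding foldr_D_op_exp[OF geven_Vc] ..
    also have "prod_list (map ?q \<alpha>s) = prod_list (map (\<lambda>i. ?q (\<alpha>s ! i)) [0..<?m])"
      using map_nth_upt[of ?q \<alpha>s] len by simp
    also have "?\<kappa> * (prod_list (map (\<lambda>i. ?q (\<alpha>s ! i)) [0..<?m]) * ?E y) =
        \<kappa> * (prod_list (map (\<lambda>i. ?t i (\<alpha>s ! i) * ?q (\<alpha>s ! i)) [0..<?m]) * ?E y)"
      by (subst prod_list_mult_even) (simp_all add: mult.assoc)
    finally show ?thesis .
  qed
  have "(\<Sum>\<alpha>s | length \<alpha>s = ?m. \<Sum>\<beta>s | length \<beta>s = ?m. D_phi \<alpha>s \<beta>s y * top_coef (\<kappa> * (?A \<alpha>s * ?B \<beta>s))) =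
      phi_zero y * top_coef (\<kappa> * ((\<Sum>\<alpha>s | length \<alpha>s = ?m. prod_list (map (\<lambda>i. ?t i (\<alpha>s ! i) * ?q (\<alpha>s ! i)) [0..<?m])) * ?E y))"
    by (simp add: inner sum_distrib_left sum_distrib_right top_coef_simps)
  also have "(\<Sum>\<alpha>s | length \<alpha>s = ?m. prod_list (map (\<lambda>i. ?t i (\<alpha>s ! i) * ?q (\<alpha>s ! i)) [0..<?m])) =
      prod_list (map (\<lambda>i. Nc y (ks ! i)) [0..<?m])"
    using prod_list_sum[of UNIV "\<lambda>i \<alpha>. ?t i \<alpha> * ?q \<alpha>" ?m] by (simp add: Nc_def)
  also have "map (\<lambda>i. Nc y (ks ! i)) [0..<?m] = map (Nc y) ks" by (rule map_nth_upt)
  also have "top_coef (\<kappa> * (prod_list (map (Nc y) ks) * ?E y)) = top_coef (\<kappa> * (exp (\<Sum>k\<in>UNIV. Nc y k) * ?E y))"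
  proof (rule prod_list_to_exp[OF ks, where g="\<lambda>k. Inr (Inl k)"])
    show "\<kappa> * Nc y k = 0" if "k \<notin> set ks" for k
      unfolding Nc_factor using \<kappa>(4)[OF that] by (simp flip: mult.assoc)
    show "con (Inr (Inl k)) (?E y) = 0" for k
      unfolding sum_Xc[symmetric] by (simp add: con_exp con_Xc)
  qed (simp_all add: con_Nc \<kappa>)
  also have "exp (\<Sum>k\<in>UNIV. Nc y k) * ?E y = exp (Mu y)"
    unfolding Mu_eq sum_Xc[symmetric] by (simp add: exp_add_commuting geven_commute)
  finally show ?thesis .
qed

end

section \<open>Evaluation of the base forms on lists with removed tangent vectors\<close>

lemma prod_list_move_front:
  assumes i: "i < length es" and odd: "\<And>x. x \<in> set es \<Longrightarrow> godd x"
  shows "es ! i * prod_list (take i es @ drop (Suc i) es) = cs ((-1) ^ i) * prod_list es"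
proof -
  have m: "es ! i * prod_list (take i es) = cs ((-1) ^ i) * (prod_list (take i es) * es ! i)"
    using odd_move[of "es ! i" "take i es"] odd i by (auto dest: in_set_takeD)
  have "prod_list es = prod_list (take i es @ es ! i # drop (Suc i) es)"
    using i by (simp flip: id_take_nth_drop)
  then have "cs ((-1) ^ i) * prod_list es = cs ((-1) ^ i) * (prod_list (take i es) * es ! i) * prod_list (drop (Suc i) es)"
    by (simp add: mult.assoc)
  then show ?thesis unfolding m[symmetric] by (simp add: mult.assoc)
qed

lemma prod_list_gen_move_front:
  assumes "l < length xs"
  shows "gen (f (xs ! l)) * prod_list (map (\<lambda>k. gen (f k)) (take l xs @ drop (Suc l) xs)) =
    cs ((-1) ^ l) * prod_list (map (\<lambda>k. gen (f k)) xs)"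
proof -
  have odd: "x \<in> set (map (\<lambda>k. gen (f k)) xs) \<Longrightarrow> godd x" for x by auto
  show ?thesis
    using prod_list_move_front[of l "map (\<lambda>k. gen (f k)) xs", OF _ odd] assms by (simp add: take_map drop_map)
qed

lemma mult_prod_list_cong:
  assumes "geven a" "\<And>\<xi>. \<xi> \<in> set L \<Longrightarrow> a * f \<xi> = a * g \<xi>"
  shows "a * prod_list (map f L) = a * prod_list (map g L)"
  using assms(2)
proof (induction L)
  case (Cons \<xi> L)
  have "a * (f \<xi> * prod_list (map f L)) = g \<xi> * (a * prod_list (map f L))"
    using Cons.prems geven_commute[OF assms(1), of "g \<xi>"] by (simp flip: mult.assoc)
  also have "\<dots> = g \<xi> * (a * prod_list (map g L))" using Cons by simp
  also have "\<dots> = a * (g \<xi> * prod_list (map g L))"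
    using geven_commute[OF assms(1), of "g \<xi>"] by (simp flip: mult.assoc)
  finally show ?case by simp
qed simp

text \<open>\<open>skip l\<close> numbers the indices other than \<open>l\<close> consecutively, so
  the comprehension runs through the list with its entry \<open>l\<close> deleted and the
  multi-index is read without gaps.\<close>

lemma skip_list:
  assumes l: "l < length xs"
  shows "concat (map (\<lambda>k. if k \<noteq> l then [H (skip l k) (xs ! k)] else []) [0..<length xs]) =
    map (\<lambda>i. H i ((take l xs @ drop (Suc l) xs) ! i)) [0..<length xs - 1]"
proof -
  obtain n where n: "length xs = Suc n" using l by (cases "length xs") auto
  have 1: "[0..<Suc n] = [0..<l] @ l # map Suc [l..<n]"
  proof -
    have "[0..<Suc n] = [0..<l] @ [l..<Suc n]" using l n upt_add_eq_append[of 0 l "Suc n - l"] by simp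
    also have "[l..<Suc n] = l # map Suc [l..<n]" using l n by (simp add: upt_conv_Cons map_Suc_upt del: upt_Suc)
    finally show ?thesis .
  qed
  have 2: "[0..<n] = [0..<l] @ [l..<n]" using l n upt_add_eq_append[of 0 l "n - l"] by simp
  have s: "concat (map (\<lambda>k. [f k]) ks) = map f ks" for f :: "nat \<Rightarrow> 'b" and ks by (induction ks) auto
  have "concat (map (\<lambda>k. if k \<noteq> l then [H (skip l k) (xs ! k)] else []) [0..<l]) =
      concat (map (\<lambda>k. [H k ((take l xs @ drop (Suc l) xs) ! k)]) [0..<l])"
    using l by (intro arg_cong[where f=concat] map_cong) (auto simp: skip_def nth_append)
  moreover have "concat (map (\<lambda>k. if k \<noteq> l then [H (skip l k) (xs ! k)] else []) (map Suc [l..<n])) =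
      concat (map (\<lambda>k. [H k ((take l xs @ drop (Suc l) xs) ! k)]) [l..<n])"
    unfolding map_map using l n by (intro arg_cong[where f=concat] map_cong) (auto simp: skip_def nth_append)
  ultimately show ?thesis
    unfolding n 1 by (simp add: 2 s)
qed

lemma prod_list_map_concat_pairs:
  "prod_list (map F (concat (map (\<lambda>i. [A i, B i]) is))) = prod_list (map (\<lambda>i. F (A i) * F (B i)) is)"
  by (induction "is") (auto simp: mult.assoc)

context form_tangent
begin

definition THp :: "'q list \<Rightarrow> 'q gens grassmann" where
  "THp ks = prod_list (map (\<lambda>k. gen (Inr (Inl k))) ks)"

definition CHp :: "'q list \<Rightarrow> 'q gens grassmann" where
  "CHp ks = prod_list (map (\<lambda>k. gen (Inr (Inr k))) ks)"

text \<open>The normalization of the integral in the order \<theta>, tangent variables, \<chi>. It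
  multiplies \<open>phi_KM\<close> and \<open>psi\<close> alike, so only its being nonzero
  matters.\<close>

definition c0 :: complex where
  "c0 = top_coef (THp qs * (prod_list es * CHp qs))"

lemma one_form_W:
  "(\<Sum>j<length w. es ! j * cs (xi1 \<alpha> \<mu> (w ! j))) = W $ \<alpha> $ \<mu>"
  "(\<Sum>j<length w. es ! j * cs (xi2 \<alpha> \<mu> (w ! j))) = Ws $ \<mu> $ \<alpha>"
  by (simp_all add: W_def Ws_def xi1_def xi2_def)

text \<open>Unravelling the \<theta>-pairs and the \<chi>-pairs costs the same \<open>psign\<close>,
  and its square is 1.\<close>

lemma pair_both:
  "prod_list (map (\<lambda>i. gen (Inr (Inl (ks ! i))) * W $ (\<alpha>s ! i) $ (ks ! i)) [0..<length ks]) *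
    prod_list (map (\<lambda>i. Ws $ (ks ! i) $ (\<beta>s ! i) * gen (Inr (Inr (ks ! i)))) [0..<length ks]) =
   THp ks * (prod_list (map (\<lambda>i. W $ (\<alpha>s ! i) $ (ks ! i)) [0..<length ks]) *
     prod_list (map (\<lambda>i. Ws $ (ks ! i) $ (\<beta>s ! i)) [0..<length ks]) * CHp ks)"
proof -
  let ?p = "cs (psign (length ks)) :: 'q gens grassmann"
  have pp: "?p * ?p = 1" by (simp add: cs_simps(2) flip: cs_simps(6))
  have p: "(?p * a) * (?p * b) = a * b" for a b :: "'q gens grassmann"
  proof -
    have "(?p * a) * (?p * b) = ?p * ?p * (a * b)" by (simp only: mult.assoc mult_cs_left[of a])
    then show ?thesis by (simp add: pp)
  qed
  have a: "prod_list (map (\<lambda>i. gen (Inr (Inl (ks ! i))) * W $ (\<alpha>s ! i) $ (ks ! i)) [0..<length ks]) =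
      ?p * (THp ks * prod_list (map (\<lambda>i. W $ (\<alpha>s ! i) $ (ks ! i)) [0..<length ks]))"
    using prod_list_pairs[of "[0..<length ks]" "\<lambda>i. gen (Inr (Inl (ks ! i)))" "\<lambda>i. W $ (\<alpha>s ! i) $ (ks ! i)"]
    by (simp add: THp_def map_nth_upt[of "\<lambda>k. gen (Inr (Inl k))" ks])
  have b: "prod_list (map (\<lambda>i. Ws $ (ks ! i) $ (\<beta>s ! i) * gen (Inr (Inr (ks ! i)))) [0..<length ks]) =
      ?p * (prod_list (map (\<lambda>i. Ws $ (ks ! i) $ (\<beta>s ! i)) [0..<length ks]) * CHp ks)"
    using prod_list_pairs[of "[0..<length ks]" "\<lambda>i. Ws $ (ks ! i) $ (\<beta>s ! i)" "\<lambda>i. gen (Inr (Inr (ks ! i)))"]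
    by (simp add: CHp_def map_nth_upt[of "\<lambda>k. gen (Inr (Inr k))" ks])
  show ?thesis unfolding a b p by (simp only: mult.assoc)
qed

lemma phi_formula:
  assumes n: "length w = 2 * CARD('q)"
  shows "c0 * phi_KM_base y w = 1 / 2 ^ (2 * CARD('q)) * (phi_zero y * top_coef (exp (Mu y)))"
proof -
  let ?q = "CARD('q)"
  let ?\<xi> = "\<lambda>\<alpha>s \<beta>s. [xi1 (\<alpha>s ! k) (neg_index k). k \<leftarrow> [0..<?q]] @ [xi2 (\<beta>s ! k) (neg_index k). k \<leftarrow> [0..<?q]]"
  have wc: "wedge (?\<xi> \<alpha>s \<beta>s) w * c0 =
      top_coef (1 * (prod_list (map (\<lambda>i. gen (Inr (Inl (qs ! i))) * W $ (\<alpha>s ! i) $ (qs ! i)) [0..<length (qs :: 'q list)]) *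
        prod_list (map (\<lambda>i. Ws $ (qs ! i) $ (\<beta>s ! i) * gen (Inr (Inr (qs ! i)))) [0..<length (qs :: 'q list)])))"
    for \<alpha>s \<beta>s :: "'p list"
  proof -
    have l: "length (?\<xi> \<alpha>s \<beta>s) = length w" by (simp add: n)
    have "prod_list (map (\<lambda>\<xi>. \<Sum>j<length w. es ! j * cs (\<xi> (w ! j))) (?\<xi> \<alpha>s \<beta>s)) = cs (wedge (?\<xi> \<alpha>s \<beta>s) w) * prod_list es"
      using prod_list_one_forms[of es "?\<xi> \<alpha>s \<beta>s" w] odd unfolding l by (simp add: len)
    then have "prod_list (map (\<lambda>i. W $ (\<alpha>s ! i) $ (qs ! i)) [0..<?q]) * prod_list (map (\<lambda>i. Ws $ (qs ! i) $ (\<beta>s ! i)) [0..<?q]) =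
        cs (wedge (?\<xi> \<alpha>s \<beta>s) w) * prod_list es"
      by (simp add: comp_def one_form_W neg_index_qs)
    then show ?thesis
      unfolding pair_both mult_1 by (simp add: c0_def mult.assoc mult_cs_left[of "THp qs"] top_coef_simps)
  qed
  have "c0 * phi_KM_base y w = 1 / 2 ^ (2 * ?q) *
      (\<Sum>\<alpha>s | length \<alpha>s = length (qs :: 'q list). \<Sum>\<beta>s | length \<beta>s = length (qs :: 'q list). D_phi \<alpha>s \<beta>s y *
      top_coef (1 * (prod_list (map (\<lambda>i. gen (Inr (Inl (qs ! i))) * W $ (\<alpha>s ! i) $ (qs ! i)) [0..<length (qs :: 'q list)]) *
        prod_list (map (\<lambda>i. Ws $ (qs ! i) $ (\<beta>s ! i) * gen (Inr (Inr (qs ! i)))) [0..<length (qs :: 'q list)]))))"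
    unfolding wc[symmetric] phi_KM_base_def by (simp add: sum_distrib_left mult_ac)
  then show ?thesis
    using form_sum[of qs 1 y] by simp
qed

lemma Nel_eq: "Nel = (\<Sum>k\<in>UNIV. gen (Inr (Inl k)) * gen (Inr (Inr k)))"
proof -
  have "gen (Inr (Inl k)) * gen (Inr (Inr k)) = - (gen (Inr (Inr k)) * gen (Inr (Inl k)) :: 'q gens grassmann)" for k
    by (rule godd_anticommute) auto
  then show ?thesis by (simp add: Nel_def matrix_matrix_mult_def th_def ch_def sum_negf)
qed

text \<open>\<open>remove_sum\<close> applied twice; the two prefactors are exchanged in between so
  that each stands next to the sum it acts on.\<close>

lemma remove_one_form:
  assumes i: "i < length w" and j: "j < length w - 1"
  defines "es' \<equiv> take i es @ drop (Suc i) es" and "w' \<equiv> take i w @ drop (Suc i) w"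
  defines "es'' \<equiv> take j es' @ drop (Suc j) es'" and "w'' \<equiv> take j w' @ drop (Suc j) w'"
  shows "es ! i * es' ! j * (\<Sum>r<length w''. es'' ! r * f (w'' ! r)) = es ! i * es' ! j * (\<Sum>r<length w. es ! r * f (w ! r))"
proof -
  interpret r: odd_tangent es' w' unfolding es'_def w'_def by (rule odd_tangent_remove)
  have lw': "length w' = length w - 1" using i by (simp add: w'_def)
  have j': "j < length w'" using j lw' by simp
  have 1: "es' ! j * (\<Sum>r<length w''. es'' ! r * f (w'' ! r)) = es' ! j * (\<Sum>r<length w'. es' ! r * f (w' ! r))"
    unfolding es''_def w''_def by (rule r.remove_sum[OF j'])
  have 2: "es ! i * (\<Sum>r<length w'. es' ! r * f (w' ! r)) = es ! i * (\<Sum>r<length w. es ! r * f (w ! r))"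
    unfolding es'_def w'_def by (rule remove_sum[OF i])
  have anti: "es ! i * es' ! j = - (es' ! j * es ! i)"
    by (intro godd_anticommute odd_nth[OF i] r.odd_nth[OF j'])
  have "es ! i * es' ! j * (\<Sum>r<length w''. es'' ! r * f (w'' ! r)) = es ! i * es' ! j * (\<Sum>r<length w'. es' ! r * f (w' ! r))"
    unfolding mult.assoc 1 ..
  also have "\<dots> = es ! i * es' ! j * (\<Sum>r<length w. es ! r * f (w ! r))"
    unfolding anti mult_minus_left mult.assoc 2 ..
  finally show ?thesis .
qed

text \<open>In the summand \<open>l\<close> of \<open>Omega\<close> the pair with index
  \<open>l\<close> is missing, and \<theta>_l \<chi>_l supplies it; summed over \<open>l\<close>
  this gives \<open>Nel\<close>. The sign in \<open>Omega\<close> is the one that unravels its q - 1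
  pairs, and the \<open>(-1) ^ (q - 1)\<close> in \<open>psi_base\<close> cancels the sign found in
  \<open>top\<close>.\<close>

lemma psi_formula:
  assumes n: "length w = 2 * CARD('q)" and i: "i < length w" and j: "j < length w - 1"
  defines "es' \<equiv> take i es @ drop (Suc i) es" and "w' \<equiv> take i w @ drop (Suc i) w"
  defines "w'' \<equiv> take j w' @ drop (Suc j) w'"
  shows "c0 * psi_base y w'' = (-1) ^ i * (-1) ^ j * (2 * \<i> / 2 ^ (2 * (CARD('q) - 1))) *
    (phi_zero y * top_coef (es ! i * es' ! j * (Nel * exp (Mu y))))"
proof -
  let ?q = "CARD('q)"
  define es'' where "es'' = take j es' @ drop (Suc j) es'"
  define \<eta> where "\<eta> = es ! i * es' ! j"
  define ks where "ks l = (take l qs @ drop (Suc l) qs :: 'q list)" for l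
  define L :: "nat \<Rightarrow> 'p list \<Rightarrow> 'p list \<Rightarrow> (complex ^ ('q::{finite, linorder}) ^ 'p \<Rightarrow> complex) list" where
    "L l \<alpha>s \<beta>s = concat [[xi1 (\<alpha>s ! skip l k) (neg_index k), xi2 (\<beta>s ! skip l k) (neg_index k)].
           k \<leftarrow> [0..<?q], k \<noteq> l]" for l \<alpha>s \<beta>s
  let ?A = "\<lambda>l \<alpha>s. prod_list (map (\<lambda>i. gen (Inr (Inl (ks l ! i))) * W $ (\<alpha>s ! i) $ (ks l ! i)) [0..<length (ks l)])"
  let ?B = "\<lambda>l \<beta>s. prod_list (map (\<lambda>i. Ws $ (ks l ! i) $ (\<beta>s ! i) * gen (Inr (Inr (ks l ! i)))) [0..<length (ks l)])"
  define \<kappa> where "\<kappa> l = \<eta> * (gen (Inr (Inl (qs ! l))) * gen (Inr (Inr (qs ! l))))" for l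
  interpret r: odd_tangent es' w' unfolding es'_def w'_def by (rule odd_tangent_remove)
  interpret r2: odd_tangent es'' w'' unfolding es''_def w''_def by (rule r.odd_tangent_remove)
  have j': "j < length w'" using j i by (simp add: w'_def)
  have lw'': "length w'' = 2 * (?q - 1)" using i j n by (simp add: w''_def w'_def)
  have ev: "geven \<eta>" unfolding \<eta>_def using odd_nth[OF i] r.odd_nth[OF j'] by simp
  have eo: "eps_only \<eta>" unfolding \<eta>_def
  proof (rule eps_only_mult)
    have "set es' \<subseteq> set es" unfolding es'_def by (auto dest: in_set_takeD in_set_dropD)
    moreover have "es' ! j \<in> set es'" using j' r.len by simp
    moreover have "es ! i \<in> set es" using i len by simp
    ultimately have "es ! i \<in> set es" "es' ! j \<in> set es" by auto
    then show "eps_only (es ! i)" "eps_only (es' ! j)" by (auto intro: eps_only_es)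
    show "geven (es ! i) \<or> godd (es ! i)" using odd_nth[OF i] by simp
  qed
  have lks: "length (ks l) = ?q - 1" if "l < ?q" for l
    using that by (simp add: ks_def)
  have qs_split: "qs = take l qs @ qs ! l # drop (Suc l) (qs :: 'q list)" if "l < ?q" for l
    using that by (simp flip: id_take_nth_drop)
  have dks: "distinct (ks l)" "set (ks l) = UNIV - {qs ! l}" if l: "l < ?q" for l
  proof -
    have "distinct (take l qs @ qs ! l # drop (Suc l) (qs :: 'q list))" "set (take l qs @ qs ! l # drop (Suc l) (qs :: 'q list)) = UNIV"
      using qs_split[OF l] qs_simps(1,2) by metis+
    then show "distinct (ks l)" "set (ks l) = UNIV - {qs ! l}" unfolding ks_def by auto
  qed
  have Q: "\<eta> * prod_list es'' = cs ((-1) ^ i * (-1) ^ j) * prod_list es"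
  proof -
    have "\<eta> * prod_list es'' = es ! i * (es' ! j * prod_list es'')" by (simp add: \<eta>_def mult.assoc)
    also have "es' ! j * prod_list es'' = cs ((-1) ^ j) * prod_list es'"
      unfolding es''_def by (rule prod_list_move_front) (use r.odd j' r.len in auto)
    also have "es ! i * (cs ((-1) ^ j) * prod_list es') = cs ((-1) ^ j) * (es ! i * prod_list es')"
      by (rule mult_cs_left)
    also have "es ! i * prod_list es' = cs ((-1) ^ i) * prod_list es"
      unfolding es'_def by (rule prod_list_move_front) (use odd i len in auto)
    finally show ?thesis by (simp add: cs_simps(6) mult.assoc mult_cs_left[of "cs ((-1) ^ j)"])
  qed
  \<comment> \<open>\<chi>_l passes q - 1 variables \<theta> and 2q tangent variables, which gives
    (-1)^(q-1). Inserting \<theta>_l and \<chi>_l at place \<open>l\<close> of their lists costs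
    (-1)^l twice.\<close>
  have top: "top_coef (gen (Inr (Inl (qs ! l))) * gen (Inr (Inr (qs ! l))) * (THp (ks l) * (prod_list es * CHp (ks l)))) =
      (-1) ^ (?q - 1) * c0" if l: "l < ?q" for l
  proof -
    let ?t = "gen (Inr (Inl (qs ! l))) :: 'q gens grassmann" and ?c = "gen (Inr (Inr (qs ! l))) :: 'q gens grassmann"
    have e: "(-1 :: complex) ^ (?q - 1 + 2 * ?q) = (-1) ^ (?q - 1)"
      unfolding power_add power_mult by simp
    have "?c * prod_list (map (\<lambda>k. gen (Inr (Inl k))) (ks l) @ es) =
        cs ((-1) ^ length (map (\<lambda>k. gen (Inr (Inl k)) :: 'q gens grassmann) (ks l) @ es)) * (prod_list (map (\<lambda>k. gen (Inr (Inl k))) (ks l) @ es) * ?c)"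
      by (rule odd_move) (use odd in auto)
    then have c: "?c * (THp (ks l) * prod_list es) = cs ((-1) ^ (?q - 1)) * (THp (ks l) * prod_list es * ?c)"
      by (simp only: THp_def prod_list.append length_append length_map lks[OF l] len n e)
    have t: "?t * THp (ks l) = cs ((-1) ^ l) * THp qs"
      unfolding THp_def ks_def by (rule prod_list_gen_move_front) (simp add: l)
    have c': "?c * CHp (ks l) = cs ((-1) ^ l) * CHp qs"
      unfolding CHp_def ks_def by (rule prod_list_gen_move_front) (simp add: l)
    have "?t * ?c * (THp (ks l) * (prod_list es * CHp (ks l))) = ?t * (?c * (THp (ks l) * prod_list es)) * CHp (ks l)"
      by (simp add: mult.assoc)
    also have "\<dots> = cs ((-1) ^ (?q - 1)) * ((?t * THp (ks l)) * (prod_list es * (?c * CHp (ks l))))"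
      unfolding c by (simp add: mult.assoc mult_cs_left[of ?t])
    also have "\<dots> = cs ((-1) ^ (?q - 1) * ((-1) ^ l * (-1) ^ l)) * (THp qs * (prod_list es * CHp qs))"
      unfolding t c' by (simp only: cs_simps(6) mult.assoc mult_cs_left[of "THp qs"] mult_cs_left[of "prod_list es"])
    finally show ?thesis by (simp add: c0_def top_coef_simps flip: power_mult_distrib)
  qed
  have summand: "top_coef (\<kappa> l * (?A l \<alpha>s * ?B l \<beta>s)) =
      (-1) ^ i * (-1) ^ j * (-1) ^ (?q - 1) * c0 * (psign (?q - 1) * wedge (L l \<alpha>s \<beta>s) w'')"
    if l: "l < ?q" for l and \<alpha>s \<beta>s :: "'p list"
  proof -
    let ?F = "\<lambda>\<xi>. \<Sum>r<length w. es ! r * cs (\<xi> (w ! r))"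
    let ?F'' = "\<lambda>\<xi>. \<Sum>r<length w''. es'' ! r * cs (\<xi> (w'' ! r))"
    let ?X = "prod_list (map (\<lambda>i. W $ (\<alpha>s ! i) $ (ks l ! i)) [0..<length (ks l)]) *
      prod_list (map (\<lambda>i. Ws $ (ks l ! i) $ (\<beta>s ! i)) [0..<length (ks l)])"
    have L: "L l \<alpha>s \<beta>s = concat (map (\<lambda>i. [xi1 (\<alpha>s ! i) (ks l ! i), xi2 (\<beta>s ! i) (ks l ! i)]) [0..<?q - 1])"
      using skip_list[of l "qs :: 'q list" "\<lambda>k \<mu>. [xi1 (\<alpha>s ! k) \<mu>, xi2 (\<beta>s ! k) \<mu>]"] l
      unfolding L_def ks_def neg_index_qs by (simp only: qs_simps(3))
    have "length (L l \<alpha>s \<beta>s) = 2 * (?q - 1)" unfolding L by (simp add: length_concat comp_def sum_list_triv)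
    then have ll: "length (L l \<alpha>s \<beta>s) = length w''" by (simp add: lw'')
    have w2: "prod_list (map ?F'' (L l \<alpha>s \<beta>s)) = cs (wedge (L l \<alpha>s \<beta>s) w'') * prod_list es''"
      using prod_list_one_forms[of es'' "L l \<alpha>s \<beta>s" w''] r2.odd unfolding ll by (simp add: r2.len)
    have "\<eta> * prod_list (map ?F'' (L l \<alpha>s \<beta>s)) = \<eta> * prod_list (map ?F (L l \<alpha>s \<beta>s))"
      by (rule mult_prod_list_cong[OF ev])
        (unfold \<eta>_def es''_def w''_def es'_def w'_def, rule remove_one_form[OF i j])
    also have "prod_list (map ?F (L l \<alpha>s \<beta>s)) = cs (psign (?q - 1)) * ?X"
      unfolding L prod_list_map_concat_pairs one_form_W lks[OF l] by (subst prod_list_pairs) auto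
    finally have X: "cs (psign (?q - 1)) * (\<eta> * ?X) = \<eta> * (cs (wedge (L l \<alpha>s \<beta>s) w'') * prod_list es'')"
      unfolding w2 mult_cs_left[of \<eta>] by simp
    have "\<eta> * ?X = cs (psign (?q - 1)) * (cs (psign (?q - 1)) * (\<eta> * ?X))"
      by (simp add: cs_simps(2) flip: mult.assoc cs_simps(6))
    also have "\<dots> = cs (psign (?q - 1) * wedge (L l \<alpha>s \<beta>s) w'' * ((-1) ^ i * (-1) ^ j)) * prod_list es"
      unfolding X mult_cs_left[of \<eta>] Q by (simp add: cs_simps(6) mult.assoc)
    finally have X': "\<eta> * ?X = cs (psign (?q - 1) * wedge (L l \<alpha>s \<beta>s) w'' * ((-1) ^ i * (-1) ^ j)) * prod_list es" .
    let ?tc = "gen (Inr (Inl (qs ! l))) * gen (Inr (Inr (qs ! l)))"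
    have "\<kappa> l * (?A l \<alpha>s * ?B l \<beta>s) = ?tc * (\<eta> * (THp (ks l) * (?X * CHp (ks l))))"
      unfolding \<kappa>_def pair_both using geven_commute[OF ev, of ?tc] by (simp add: mult.assoc)
    also have "\<eta> * (THp (ks l) * (?X * CHp (ks l))) = THp (ks l) * ((\<eta> * ?X) * CHp (ks l))"
      using geven_commute[OF ev, of "THp (ks l)"] by (simp flip: mult.assoc)
    also have "?tc * (THp (ks l) * ((\<eta> * ?X) * CHp (ks l))) = cs (psign (?q - 1) * wedge (L l \<alpha>s \<beta>s) w'' * ((-1) ^ i * (-1) ^ j)) *
        (?tc * (THp (ks l) * (prod_list es * CHp (ks l))))"
      unfolding X' mult.assoc mult_cs_left[of "THp (ks l)"] mult_cs_left[of "gen (Inr (Inl (qs ! l)))"]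
        mult_cs_left[of "gen (Inr (Inr (qs ! l)))"] ..
    finally show ?thesis by (simp only: top_coef_simps(6) top[OF l]) (simp only: mult_ac)
  qed
  have fs: "(\<Sum>\<alpha>s | length \<alpha>s = ?q - 1. \<Sum>\<beta>s | length \<beta>s = ?q - 1. D_phi \<alpha>s \<beta>s y *
      top_coef (\<kappa> l * (?A l \<alpha>s * ?B l \<beta>s))) = phi_zero y * top_coef (\<kappa> l * exp (Mu y))" if l: "l < ?q" for l
    unfolding lks[OF l, symmetric]
  proof (rule form_sum)
    have c\<eta>: "con (Inr k) \<eta> = 0" for k using eo by (simp add: eps_only_def)
    show "distinct (ks l)" by (rule dks[OF l])
    show "geven (\<kappa> l) \<or> godd (\<kappa> l)" using ev by (simp add: \<kappa>_def)
    show "con (Inr (Inl k)) (\<kappa> l) = 0" "con (Inr (Inr k)) (\<kappa> l) = 0" if "k \<in> set (ks l)" for k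
      using that dks(2)[OF l] ev by (auto simp: \<kappa>_def con_mult_even con_mult_odd con_gen c\<eta>)
    show "\<kappa> l * gen (Inr (Inl k)) = 0" "\<kappa> l * gen (Inr (Inr k)) = 0" if "k \<notin> set (ks l)" for k
    proof -
      let ?t = "gen (Inr (Inl k)) :: 'q gens grassmann" and ?c = "gen (Inr (Inr k)) :: 'q gens grassmann"
      have k: "qs ! l = k" using that dks(2)[OF l] by auto
      have "?t * ?c * ?t = - (?t * ?c * ?t)" by (rule odd_swap) auto
      then have "?t * ?c * ?t + ?t * ?c * ?t = 0" by (simp only: eq_neg_iff_add_eq_0)
      then have "?t * ?c * ?t = 0" by (simp flip: scaleR_2)
      then show "\<kappa> l * ?t = 0" unfolding \<kappa>_def k by (simp add: mult.assoc)
      show "\<kappa> l * ?c = 0" unfolding \<kappa>_def k by (simp add: mult.assoc)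
    qed
  qed
  have Om: "Omega \<alpha>s \<beta>s w'' = psign (?q - 1) * (\<Sum>l<?q. wedge (L l \<alpha>s \<beta>s) w'')" for \<alpha>s \<beta>s :: "'p list"
    unfolding Omega_def L_def psign_def by (simp only: diff_diff_left one_add_one)
  have sgn: "(-1) ^ (?q - 1) * ((-1) ^ (?q - 1) * c) = (c::complex)" for c
    by (simp flip: mult.assoc power_mult_distrib)
  have sgn2: "(-1) ^ i * (-1) ^ j * ((-1) ^ i * (-1) ^ j * c) = (c::complex)" for c
  proof -
    have "(-1) ^ i * (-1) ^ j * ((-1) ^ i * (-1) ^ j) = (1::complex)"
      by (simp flip: power_add mult.assoc add: algebra_simps mult_2_right[symmetric])
    then show ?thesis by (metis mult.assoc mult.left_neutral)
  qed
  have "c0 * (\<Sum>\<alpha>s | length \<alpha>s = ?q - 1. \<Sum>\<beta>s | length \<beta>s = ?q - 1. D_phi \<alpha>s \<beta>s y * Omega \<alpha>s \<beta>s w'') =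
      (\<Sum>\<alpha>s | length \<alpha>s = ?q - 1. \<Sum>\<beta>s | length \<beta>s = ?q - 1. \<Sum>l<?q. D_phi \<alpha>s \<beta>s y * (c0 * (psign (?q - 1) * wedge (L l \<alpha>s \<beta>s) w'')))"
    unfolding Om by (simp add: sum_distrib_left mult_ac)
  also have "\<dots> = (\<Sum>\<alpha>s | length \<alpha>s = ?q - 1. \<Sum>\<beta>s | length \<beta>s = ?q - 1. \<Sum>l<?q.
      (-1) ^ i * (-1) ^ j * (-1) ^ (?q - 1) * (D_phi \<alpha>s \<beta>s y * top_coef (\<kappa> l * (?A l \<alpha>s * ?B l \<beta>s))))"
  proof (intro sum.cong refl)
    fix \<alpha>s \<beta>s :: "'p list" and l assume "l \<in> {..<?q}"
    then have l: "l < ?q" by simp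
    let ?z = "psign (?q - 1) * wedge (L l \<alpha>s \<beta>s) w''"
    have "(-1) ^ i * (-1) ^ j * (-1) ^ (?q - 1) * (D_phi \<alpha>s \<beta>s y * ((-1) ^ i * (-1) ^ j * (-1) ^ (?q - 1) * c0 * ?z)) =
        (-1) ^ i * (-1) ^ j * ((-1) ^ i * (-1) ^ j * ((-1) ^ (?q - 1) * ((-1) ^ (?q - 1) * (D_phi \<alpha>s \<beta>s y * (c0 * ?z)))))"
      by (simp only: mult_ac)
    then show "D_phi \<alpha>s \<beta>s y * (c0 * ?z) =
        (-1) ^ i * (-1) ^ j * (-1) ^ (?q - 1) * (D_phi \<alpha>s \<beta>s y * top_coef (\<kappa> l * (?A l \<alpha>s * ?B l \<beta>s)))"
      unfolding summand[OF l] sgn sgn2 by simp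
  qed
  also have "\<dots> = (\<Sum>l<?q. (-1) ^ i * (-1) ^ j * (-1) ^ (?q - 1) * (\<Sum>\<alpha>s | length \<alpha>s = ?q - 1. \<Sum>\<beta>s | length \<beta>s = ?q - 1.
      D_phi \<alpha>s \<beta>s y * top_coef (\<kappa> l * (?A l \<alpha>s * ?B l \<beta>s))))"
  proof -
    have "(\<Sum>a\<in>I. \<Sum>b\<in>J. \<Sum>l<?q. f a b l) = (\<Sum>l<?q. \<Sum>a\<in>I. \<Sum>b\<in>J. f a b l)" for I J :: "'p list set" and f :: "'p list \<Rightarrow> 'p list \<Rightarrow> nat \<Rightarrow> complex"
      by (subst sum.swap[of _ "{..<?q}" J], subst sum.swap[of _ "{..<?q}" I]) (rule refl)
    then show ?thesis by (simp only: sum_distrib_left)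
  qed
  also have "\<dots> = (\<Sum>l<?q. (-1) ^ i * (-1) ^ j * (-1) ^ (?q - 1) * (phi_zero y * top_coef (\<kappa> l * exp (Mu y))))"
    using fs by (intro sum.cong) auto
  also have "\<dots> = (-1) ^ i * (-1) ^ j * (-1) ^ (?q - 1) * (phi_zero y * top_coef ((\<Sum>l<?q. \<kappa> l) * exp (Mu y)))"
    by (simp add: sum_distrib_left sum_distrib_right top_coef_simps)
  also have "(\<Sum>l<?q. \<kappa> l) = \<eta> * Nel"
    unfolding \<kappa>_def Nel_eq sum_qs_nth sum_distrib_left ..
  finally have E: "c0 * (\<Sum>\<alpha>s | length \<alpha>s = ?q - 1. \<Sum>\<beta>s | length \<beta>s = ?q - 1. D_phi \<alpha>s \<beta>s y * Omega \<alpha>s \<beta>s w'') =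
      (-1) ^ i * (-1) ^ j * (-1) ^ (?q - 1) * (phi_zero y * top_coef (\<eta> * Nel * exp (Mu y)))" .
  have "c0 * psi_base y w'' = 2 * \<i> * (-1) ^ (?q - 1) / 2 ^ (2 * (?q - 1)) *
      ((-1) ^ i * (-1) ^ j * (-1) ^ (?q - 1) * (phi_zero y * top_coef (\<eta> * Nel * exp (Mu y))))"
    unfolding psi_base_def mult.left_commute[of c0] E ..
  also have "\<dots> = (-1) ^ i * (-1) ^ j * (2 * \<i> / 2 ^ (2 * (?q - 1))) *
      ((-1) ^ (?q - 1) * ((-1) ^ (?q - 1) * (phi_zero y * top_coef (\<eta> * Nel * exp (Mu y)))))"
    by (simp add: mult_ac)
  finally show ?thesis unfolding sgn \<eta>_def by (simp add: mult.assoc)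
qed

end

section \<open>The unitary group acting on negative planes\<close>

definition hf :: "complex ^ 'n ^ 'n \<Rightarrow> complex ^ 1 ^ 'n \<Rightarrow> complex ^ 1 ^ 'n \<Rightarrow> complex" where
  "hf A u v = (ct u ** A ** v) $ 1 $ 1"

definition posdef :: "complex ^ 'n ^ 'n \<Rightarrow> bool" where
  "posdef A \<longleftrightarrow> ct A = A \<and> (\<forall>u. u \<noteq> 0 \<longrightarrow> Re (hf A u u) > 0)"

lemma hf_cnj: "ct A = A \<Longrightarrow> hf A u v = cnj (hf A v u)"
proof -
  assume "ct A = A"
  then have "ct u ** A ** v = ct (ct v ** A ** u)" by (simp add: ct_simps matrix_mul_assoc)
  then show ?thesis unfolding hf_def by (simp add: ct_def)
qed

lemma posdef_real: assumes "posdef A" shows "hf A u u = of_real (Re (hf A u u))"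
  using hf_cnj[of A u u] assms by (simp add: posdef_def complex_eq_iff)

text \<open>Gram-Schmidt, with the next vector found by a dimension count. It serves to factor
  \<open>Hmat\<close> and \<open>Gmat\<close> as a conjugate transpose times a matrix.\<close>

lemma posdef_orthonormal:
  fixes A :: "complex ^ 'n::finite ^ 'n"
  assumes A: "posdef A" shows "\<exists>P :: complex ^ 'n ^ 'n. ct P ** A ** P = mat 1"
proof -
  have "\<exists>(J :: 'n set) v. card J = m \<and> (\<forall>k\<in>J. \<forall>l\<in>J. hf A (v k) (v l) = (if k = l then 1 else 0))"
    if "m \<le> CARD('n)" for m
    using that
  proof (induction m)
    case 0
    show ?case by (intro exI[of _ "{}"]) auto
  next
    case (Suc m)
    then obtain J :: "'n set" and v :: "'n \<Rightarrow> complex ^ 1 ^ 'n"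
      where J: "card J = m" and v: "\<And>k l. k \<in> J \<Longrightarrow> l \<in> J \<Longrightarrow> hf A (v k) (v l) = (if k = l then 1 else 0)"
      by auto
    have "J \<noteq> UNIV" using J Suc.prems by auto
    then obtain j where j: "j \<notin> J" by auto
    \<comment> \<open>The row of \<open>j\<close> is zero, so \<open>M\<close> is singular; a kernel
      vector is orthogonal to all \<open>v k\<close> with \<open>k\<close> in
      \<open>J\<close>.\<close>
    define M :: "complex ^ 'n ^ 'n" where "M = (\<chi> k i. if k \<in> J then (ct (v k) ** A) $ 1 $ i else 0)"
    have "\<not> (\<exists>B :: complex ^ 'n ^ 'n. B ** M = mat 1)"
    proof
      assume "\<exists>B :: complex ^ 'n ^ 'n. B ** M = mat 1"
      then obtain B :: "complex ^ 'n ^ 'n" where "M ** B = mat 1" using matrix_left_right_inverse by blast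
      then have "(M ** B) $ j $ j = 1" by (simp add: mat_def)
      moreover have "(M ** B) $ j $ j = 0" using j by (simp add: matrix_matrix_mult_def M_def)
      ultimately show False by simp
    qed
    then obtain y' where y': "M *v y' = 0" "y' \<noteq> 0" using matrix_left_invertible_ker[of M] by blast
    define y :: "complex ^ 1 ^ 'n" where "y = (\<chi> i _. y' $ i)"
    have "y \<noteq> 0" using y'(2) by (auto simp: y_def vec_eq_iff)
    then have pos: "Re (hf A y y) > 0" using A by (simp add: posdef_def)
    have o: "hf A (v k) y = 0" if "k \<in> J" for k
    proof -
      have "(M *v y') $ k = 0" using y'(1) by simp
      then show ?thesis using that by (simp add: hf_def matrix_vector_mult_def M_def matrix_matrix_mult_def y_def)
    qed
    define e where "e = (1 / sqrt (Re (hf A y y))) *\<^sub>R y"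
    have e1: "hf A (v k) e = 0" "hf A e (v k) = 0" if "k \<in> J" for k
    proof -
      show "hf A (v k) e = 0" using o[OF that] by (simp add: hf_def e_def matrix_ring_simps)
      then show "hf A e (v k) = 0" using hf_cnj[of A e "v k"] A by (simp add: posdef_def)
    qed
    have "hf A e e = (1 / sqrt (Re (hf A y y)))\<^sup>2 *\<^sub>R hf A y y"
      by (simp add: hf_def e_def matrix_ring_simps ct_simps power2_eq_square)
    also have "\<dots> = of_real ((1 / sqrt (Re (hf A y y)))\<^sup>2 * Re (hf A y y))"
      by (subst posdef_real[OF A]) (simp add: scaleR_conv_of_real)
    also have "(1 / sqrt (Re (hf A y y)))\<^sup>2 * Re (hf A y y) = 1"
      using pos by (simp add: power_divide)
    finally have e2: "hf A e e = 1" by simp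
    show ?case
    proof (intro exI conjI ballI)
      show "card (insert j J) = Suc m" using J j by simp
      show "hf A ((v(j := e)) k) ((v(j := e)) l) = (if k = l then 1 else 0)"
        if "k \<in> insert j J" "l \<in> insert j J" for k l
        using that j e1 e2 v by auto
    qed
  qed
  from this[of "CARD('n)"] obtain J :: "'n set" and v where J: "card J = CARD('n)"
    and v: "\<And>k l. k \<in> J \<Longrightarrow> l \<in> J \<Longrightarrow> hf A (v k) (v l) = (if k = l then 1 else 0)" by auto
  have J: "J = UNIV" using J by (simp add: card_eq_UNIV_imp_eq_UNIV)
  define P :: "complex ^ 'n ^ 'n" where "P = (\<chi> i k. v k $ i $ 1)"
  have "(ct P ** A ** P) $ k $ l = hf A (v k) (v l)" for k l
    by (simp add: hf_def matrix_matrix_mult_def ct_def P_def)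
  then have "ct P ** A ** P = mat 1" using v J by (simp add: vec_eq_iff mat_def)
  then show ?thesis ..
qed

lemma posdef_det:
  fixes A :: "complex ^ 'n::finite ^ 'n"
  assumes "posdef A" shows "det A \<noteq> 0"
proof -
  obtain P :: "complex ^ 'n ^ 'n" where "ct P ** A ** P = mat 1" using posdef_orthonormal[OF assms] by blast
  then have "det (ct P) * det A * det P = 1" by (metis det_mul det_I)
  then show ?thesis by auto
qed

section \<open>Negative planes and unitary matrices in block form\<close>

definition vec_of :: "complex ^ 1 ^ 'p \<Rightarrow> complex ^ 1 ^ 'q \<Rightarrow> complex ^ ('p::finite + 'q::finite)" where
  "vec_of u v = (\<chi> r. case r of Inl \<alpha> \<Rightarrow> u $ \<alpha> $ 1 | Inr \<mu> \<Rightarrow> v $ \<mu> $ 1)"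

lemma parts_vec_of [simp]: "pos_part (vec_of u v) = u" "neg_part (vec_of u v) = v"
  by (simp_all add: pos_part_def neg_part_def vec_of_def vec_eq_iff)

lemma vec_of_parts: "vec_of (pos_part x) (neg_part x) = x"
  by (auto simp: pos_part_def neg_part_def vec_of_def vec_eq_iff split: sum.split)

lemma parts_eqI: "pos_part x = pos_part y \<Longrightarrow> neg_part x = neg_part y \<Longrightarrow> x = y"
  by (metis vec_of_parts)

lemma herm_parts: "herm x y = (ct (pos_part x) ** pos_part y - ct (neg_part x) ** neg_part y) $ 1 $ 1"
  by (simp add: herm_def matrix_matrix_mult_def ct_def pos_part_def neg_part_def)

lemma graph_parts: "x \<in> graph Z \<longleftrightarrow> pos_part x = Z ** neg_part x"
  by (simp add: graph_def pos_part_def neg_part_def vec_eq_iff matrix_matrix_mult_def)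

lemma base_plane_parts: "x \<in> base_plane \<longleftrightarrow> pos_part x = 0"
  unfolding graph_0[symmetric] graph_parts by (simp add: matrix_zero_left)

lemma herm_graph: "x \<in> graph Z \<Longrightarrow> herm x x = - hf (Kmat Z) (neg_part x) (neg_part x)"
  by (simp add: herm_parts graph_parts hf_def Kmat_def ct_simps matrix_ring_simps)

lemma ct_Kmat: "ct (Kmat Z) = Kmat Z"
  by (simp add: Kmat_def ct_simps)

lemma neg_planes_iff:
  fixes Z :: "complex ^ 'q::finite ^ 'p::finite"
  shows "graph Z \<in> neg_planes \<longleftrightarrow> posdef (Kmat Z)"
proof
  assume *: "graph Z \<in> neg_planes"
  show "posdef (Kmat Z)" unfolding posdef_def
  proof (intro conjI ct_Kmat allI impI)
    fix v :: "complex ^ 1 ^ 'q" assume v: "v \<noteq> 0"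
    let ?x = "vec_of (Z ** v) v"
    have x: "?x \<in> graph Z" by (simp add: graph_parts)
    have "?x \<noteq> 0"
    proof
      assume "?x = 0"
      then have "neg_part ?x = 0" by (simp add: neg_part_def vec_eq_iff)
      then show False using v by simp
    qed
    then have "Re (herm ?x ?x) < 0" using * x by (simp add: neg_planes_def)
    then show "0 < Re (hf (Kmat Z) v v)" using herm_graph[OF x] by simp
  qed
next
  assume *: "posdef (Kmat Z)"
  define L :: "complex ^ 'q \<Rightarrow> complex ^ ('p + 'q)" where "L v = vec_of (Z ** (\<chi> i _. v $ i)) (\<chi> i _. v $ i)" for v
  have lin: "Vector_Spaces.linear (*s) (*s) L"
    by unfold_locales
      (auto simp: L_def vec_of_def vec_eq_iff matrix_matrix_mult_def sum.distrib sum_distrib_left algebra_simps split: sum.split)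
  have inj: "inj L"
  proof (rule injI)
    fix u v assume "L u = L v"
    then have "neg_part (L u) = neg_part (L v)" by simp
    then show "u = v" by (simp add: L_def vec_eq_iff)
  qed
  have range: "range L = graph Z"
  proof
    show "range L \<subseteq> graph Z" by (auto simp: L_def graph_parts)
    show "graph Z \<subseteq> range L"
    proof
      fix x assume x: "x \<in> graph Z"
      have n: "(\<chi> i _. (\<chi> \<mu>. x $ Inr \<mu>) $ i) = neg_part x" by (simp add: neg_part_def)
      have "L (\<chi> \<mu>. x $ Inr \<mu>) = x"
        by (rule parts_eqI) (use x in \<open>simp_all only: L_def n parts_vec_of graph_parts\<close>)
      then show "x \<in> range L" by (metis rangeI)
    qed
  qed
  have sub: "vec.subspace (graph Z)"
    using vec.linear_subspace_image[OF lin, of UNIV] range by simp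
  have "vec.dim (range L) = vec.dim (UNIV :: (complex ^ 'q) set)"
    using vec.dim_image_eq[OF lin, of UNIV] inj by (simp add: inj_on_def inj_def)
  then have dim: "vec.dim (graph Z) = CARD('q)" unfolding range by (simp add: vec.dimension_def card_cart_basis)
  show "graph Z \<in> neg_planes" unfolding neg_planes_def
  proof (intro CollectI conjI sub dim ballI impI)
    fix x assume x: "x \<in> graph Z" "x \<noteq> 0"
    have "neg_part x \<noteq> 0"
    proof
      assume n: "neg_part x = 0"
      then have "pos_part x = 0" using x by (simp add: graph_parts matrix_zero_right)
      then have "x = 0" using n by (intro parts_eqI) (auto simp: pos_part_def neg_part_def vec_eq_iff)
      then show False using x by simp
    qed
    then show "Re (herm x x) < 0" using * herm_graph[OF x(1)] by (simp add: posdef_def)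
  qed
qed

lemma cmod_hf_le:
  assumes "norm v = 1" shows "cmod (hf A v v) \<le> (\<Sum>k\<in>UNIV. \<Sum>l\<in>UNIV. cmod (A $ k $ l))"
proof -
  have v: "cmod (v $ k $ 1) \<le> 1" for k
    using Finite_Cartesian_Product.norm_nth_le[of v k] Finite_Cartesian_Product.norm_nth_le[of "v $ k" 1] assms by linarith
  have "hf A v v = (\<Sum>l\<in>UNIV. \<Sum>k\<in>UNIV. cnj (v $ k $ 1) * A $ k $ l * v $ l $ 1)"
    by (simp add: hf_def matrix_matrix_mult_def ct_def sum_distrib_right)
  also have "cmod \<dots> \<le> (\<Sum>l\<in>UNIV. \<Sum>k\<in>UNIV. cmod (A $ k $ l))"
  proof (intro order.trans[OF norm_sum] sum_mono)
    fix k l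
    have "cmod (v $ k $ 1) * cmod (A $ k $ l) * cmod (v $ l $ 1) \<le> 1 * cmod (A $ k $ l) * 1"
      by (intro mult_mono v) auto
    then show "cmod (cnj (v $ k $ 1) * A $ k $ l * v $ l $ 1) \<le> cmod (A $ k $ l)"
      by (simp add: norm_mult)
  qed
  finally show ?thesis by (subst sum.swap)
qed

text \<open>On the unit sphere the form of \<open>Kmat Z\<close> has a positive minimum
  \<open>m\<close> by compactness, and a perturbation whose entries have absolute sum below
  \<open>m\<close> keeps it positive. Openness is what allows derivatives to be taken in the
  chart.\<close>

lemma open_negative: "open {Z :: complex ^ 'q::finite ^ 'p::finite. posdef (Kmat Z)}"
proof (subst open_subopen, intro ballI)
  fix Z :: "complex ^ 'q ^ 'p" assume "Z \<in> {Z. posdef (Kmat Z)}"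
  then have Z: "posdef (Kmat Z)" by simp
  let ?S = "sphere (0 :: complex ^ 1 ^ 'q) 1"
  have cont: "continuous_on ?S (\<lambda>v. Re (hf (Kmat Z) v v))"
    unfolding hf_def matrix_matrix_mult_def ct_def vec_lambda_beta by (intro continuous_intros)
  have "norm (axis undefined (axis 1 1) :: complex ^ 1 ^ 'q) = 1" by simp
  then have ne: "?S \<noteq> {}" by (metis empty_iff mem_sphere_0)
  from continuous_attains_inf[OF compact_sphere ne cont] obtain v0 where v0: "v0 \<in> ?S"
    "\<And>v. v \<in> ?S \<Longrightarrow> Re (hf (Kmat Z) v0 v0) \<le> Re (hf (Kmat Z) v v)" by auto
  define m where "m = Re (hf (Kmat Z) v0 v0)"
  have "v0 \<noteq> 0" using v0(1) by auto
  then have m: "m > 0" using Z by (simp add: m_def posdef_def)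
  define d where "d Z' = (\<Sum>k\<in>UNIV. \<Sum>l\<in>UNIV. cmod ((Kmat Z' - Kmat Z) $ k $ l))" for Z' :: "complex ^ 'q ^ 'p"
  have contd: "continuous_on UNIV d"
    unfolding d_def vector_minus_component
    by (intro continuous_on_sum continuous_on_norm continuous_on_diff continuous_on_const
        continuous_at_imp_continuous_on ballI differentiable_imp_continuous_within differentiable_Kmat)
  show "\<exists>T. open T \<and> Z \<in> T \<and> T \<subseteq> {Z. posdef (Kmat Z)}"
  proof (intro exI conjI subsetI CollectI)
    show "open {Z'. d Z' < m}" by (rule open_Collect_less[OF contd continuous_on_const])
    show "Z \<in> {Z'. d Z' < m}" using m by (simp add: d_def)
    fix Z' assume "Z' \<in> {Z'. d Z' < m}"
    then have Z': "d Z' < m" by simp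
    have sph: "Re (hf (Kmat Z') v v) > 0" if v: "norm v = 1" for v
    proof -
      have "hf (Kmat Z') v v = hf (Kmat Z) v v + hf (Kmat Z' - Kmat Z) v v"
        by (simp add: hf_def matrix_ring_simps)
      moreover have "\<bar>Re (hf (Kmat Z' - Kmat Z) v v)\<bar> \<le> d Z'"
        using cmod_hf_le[OF v, of "Kmat Z' - Kmat Z"] abs_Re_le_cmod unfolding d_def by (rule order.trans[rotated])
      moreover have "m \<le> Re (hf (Kmat Z) v v)" using v0(2)[of v] v by (simp add: m_def)
      ultimately show ?thesis using Z' by simp
    qed
    show "posdef (Kmat Z')" unfolding posdef_def
    proof (intro conjI ct_Kmat allI impI)
      fix u :: "complex ^ 1 ^ 'q" assume u: "u \<noteq> 0"
      have "norm ((1 / norm u) *\<^sub>R u) = 1" using u by simp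
      note sph[OF this]
      moreover have "hf (Kmat Z') ((1 / norm u) *\<^sub>R u) ((1 / norm u) *\<^sub>R u) = (1 / norm u)\<^sup>2 *\<^sub>R hf (Kmat Z') u u"
        by (simp add: hf_def matrix_ring_simps ct_simps power2_eq_square)
      ultimately have "0 < (1 / norm u)\<^sup>2 * Re (hf (Kmat Z') u u)" by simp
      then show "0 < Re (hf (Kmat Z') u u)" by (metis zero_le_power2 zero_less_mult_pos zero_less_mult_iff not_less)
    qed
  qed
qed

lemma matrix_eq_0I: "(\<And>u :: complex ^ 1 ^ 'n. M ** u = 0) \<Longrightarrow> M = (0 :: complex ^ 'n::finite ^ 'm)"
proof -
  assume *: "\<And>u :: complex ^ 1 ^ 'n. M ** u = 0"
  have "M $ i $ j = (M ** (\<chi> l _. if l = j then 1 else 0)) $ i $ (1::1)" for i j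
    by (simp add: matrix_matrix_mult_def if_distrib cong: if_cong)
  then show ?thesis using * by (simp add: vec_eq_iff)
qed

lemma matrix_eqI_form:
  assumes "\<And>u v. hf M u v = hf M' u v" shows "M = M'"
proof -
  have "M $ i $ j = hf M (\<chi> l _. if l = i then 1 else 0) (\<chi> l _. if l = j then 1 else 0)" for M :: "complex ^ 'a ^ 'a" and i j
    by (simp add: hf_def matrix_matrix_mult_def ct_def if_distrib if_distribR cong: if_cong)
  then show ?thesis using assms by (simp add: vec_eq_iff)
qed

lemma ct_Hmat: assumes "det (Kmat Z) \<noteq> 0" shows "ct (Hmat Z) = Hmat Z"
proof -
  have "ct (Hmat Z) ** Kmat Z = mat 1"
    using arg_cong[OF HK(1)[OF assms], of ct] by (simp add: ct_simps ct_Kmat)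
  then have "ct (Hmat Z) ** (Kmat Z ** Hmat Z) = Hmat Z" by (simp add: matrix_mul_assoc)
  then show ?thesis using HK(1)[OF assms] by simp
qed

lemma ct_Gmat: assumes "det (Kmat Z) \<noteq> 0" shows "ct (Gmat Z) = Gmat Z"
  by (simp add: Gmat_def ct_simps ct_Hmat[OF assms] matrix_mul_assoc)

lemma G_inverse:
  assumes Z: "det (Kmat Z) \<noteq> 0"
  shows "Gmat Z ** (mat 1 - Z ** ct Z) = mat 1" "(mat 1 - Z ** ct Z) ** Gmat Z = mat 1"
  by (simp_all add: Gmat_def matrix_ring_simps HZZ_left[OF Z] algebra_simps)

text \<open>The map x \<mapsto> (a m, d s) is unitary once ct(a) a = G and ct(d) d = H, because
  (x,x) = ct(m) G m - ct(s) H s; and m vanishes on \<open>graph Z\<close>.\<close>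

lemma exists_unitary:
  fixes Z :: "complex ^ 'q::finite ^ 'p::finite"
  assumes Z: "posdef (Kmat Z)"
  shows "\<exists>g \<in> unitary_group. act g (graph Z) = base_plane"
proof -
  note det = posdef_det[OF Z]
  obtain P :: "complex ^ 'q ^ 'q" where P: "ct P ** Kmat Z ** P = mat 1" using posdef_orthonormal[OF Z] by blast
  \<comment> \<open>From \<open>ct P ** Kmat Z ** P = mat 1\<close> the inverse of
    \<open>Kmat Z\<close> is \<open>P ** ct P\<close>, that is \<open>ct d ** d\<close>.\<close>
  define d where "d = ct P"
  have dK: "d ** (Kmat Z ** ct d) = mat 1" using P by (simp add: d_def ct_simps matrix_mul_assoc)
  then have "Kmat Z ** ct d ** d = mat 1" using matrix_left_right_inverse by blast
  then have "Hmat Z ** (Kmat Z ** ct d ** d) = Hmat Z" by simp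
  then have dd: "ct d ** d = Hmat Z" using HK(2)[OF det] by (simp add: matrix_mul_assoc)
  have "posdef (Gmat Z)" unfolding posdef_def
  proof (intro conjI ct_Gmat[OF det] allI impI)
    fix u :: "complex ^ 1 ^ 'p" assume u: "u \<noteq> 0"
    have sq: "Re ((ct v ** v) $ 1 $ 1) = (\<Sum>i\<in>UNIV. (cmod (v $ i $ 1))\<^sup>2)" for v :: "complex ^ 1 ^ 'n::finite"
      by (simp add: matrix_matrix_mult_def ct_def cmod_power2) (simp add: power2_eq_square)
    obtain i where "u $ i $ 1 \<noteq> 0" using u by (auto simp: vec_eq_iff)
    then have "Re ((ct u ** u) $ 1 $ 1) > 0" unfolding sq by (intro sum_pos2[of _ i]) auto
    moreover have "Re ((ct (d ** ct Z ** u) ** (d ** ct Z ** u)) $ 1 $ 1) \<ge> 0" unfolding sq by (intro sum_nonneg) auto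
    moreover have "hf (Gmat Z) u u = (ct u ** u) $ 1 $ 1 + (ct (d ** ct Z ** u) ** (d ** ct Z ** u)) $ 1 $ 1"
      by (simp add: hf_def Gmat_def dd[symmetric] ct_simps matrix_ring_simps)
    ultimately show "0 < Re (hf (Gmat Z) u u)" by simp
  qed
  then obtain Q :: "complex ^ 'p ^ 'p" where Q: "ct Q ** Gmat Z ** Q = mat 1" using posdef_orthonormal by blast
  \<comment> \<open>This is the inverse of \<open>Q\<close>, written so that
    \<open>ct a ** a\<close> collapses to \<open>Gmat Z\<close>.\<close>
  define a where "a = ct Q ** Gmat Z"
  have "Q ** a = mat 1" using Q matrix_left_right_inverse unfolding a_def by blast
  then have aa: "ct a ** a = Gmat Z"
    unfolding a_def by (simp add: ct_simps ct_Gmat[OF det] matrix_mul_assoc[symmetric])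
  define f where "f x = vec_of (a ** mv x Z) (d ** (neg_part x - ct Z ** pos_part x))" for x
  have "Vector_Spaces.linear (*s) (*s) f"
    by unfold_locales
      (auto simp: f_def vec_of_def mv_def pos_part_def neg_part_def vec_eq_iff matrix_matrix_mult_def
        sum.distrib sum_subtractf sum_distrib_left algebra_simps split: sum.split)
  then have gf: "matrix f *v x = f x" for x by (rule matrix_works)
  have "herm (f x) (f y) = herm x y" for x y
  proof -
    have A: "ct (a ** mv x Z) ** (a ** mv y Z) = ct (mv x Z) ** Gmat Z ** mv y Z"
      by (simp add: aa[symmetric] ct_simps matrix_mul_assoc)
    have B: "ct (d ** u) ** (d ** v) = ct u ** Hmat Z ** v" for u v :: "complex ^ 1 ^ 'q"
      by (simp add: dd[symmetric] ct_simps matrix_mul_assoc)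
    show ?thesis
      unfolding herm_parts f_def parts_vec_of A B
      by (simp add: mv_def Gmat_def ct_simps matrix_ring_simps HZZ_left[OF det])
  qed
  then have "matrix f \<in> unitary_group" by (simp add: unitary_group_def gf)
  moreover have "act (matrix f) (graph Z) = base_plane"
  proof
    show "act (matrix f) (graph Z) \<subseteq> base_plane"
      by (auto simp: act_def gf base_plane_parts f_def graph_parts mv_def matrix_zero_right)
    show "base_plane \<subseteq> act (matrix f) (graph Z)"
    proof
      fix y :: "complex ^ ('p + 'q)" assume y: "y \<in> base_plane"
      let ?v = "ct d ** neg_part y" let ?x = "vec_of (Z ** ?v) ?v"
      have "f ?x = y"
      proof (rule parts_eqI)
        show "pos_part (f ?x) = pos_part y" using y by (simp add: f_def mv_def base_plane_parts matrix_zero_right)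
        have "neg_part (f ?x) = d ** (Kmat Z ** ct d) ** neg_part y"
          by (simp add: f_def Kmat_def matrix_ring_simps)
        then show "neg_part (f ?x) = neg_part y" by (simp add: dK)
      qed
      moreover have "?x \<in> graph Z" by (simp add: graph_parts)
      ultimately show "y \<in> act (matrix f) (graph Z)" unfolding act_def using gf by (metis imageI)
    qed
  qed
  ultimately show ?thesis by blast
qed

text \<open>Covers every \<open>g\<close> that the choice in \<open>invariant_form\<close> could
  return. The plane and its orthogonal complement fix the block shape, and unitarity on these two
  subspaces fixes \<open>ct a ** a\<close> and \<open>ct d ** d\<close>; \<open>a\<close> and
  \<open>d\<close> themselves are not determined.\<close>

lemma unitary_normal_form:
  fixes Z :: "complex ^ 'q::finite ^ 'p::finite"
  assumes Z: "posdef (Kmat Z)" and g: "g \<in> unitary_group" "act g (graph Z) = base_plane"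
  shows "\<exists>a d. (\<forall>x. pos_part (g *v x) = a ** mv x Z \<and> neg_part (g *v x) = d ** (neg_part x - ct Z ** pos_part x)) \<and>
    ct a ** a = Gmat Z \<and> ct d ** d = Hmat Z"
proof -
  note det = posdef_det[OF Z]
  have unit: "herm (g *v x) (g *v y) = herm x y" for x y using g by (simp add: unitary_group_def)
  define a where "a = (\<chi> \<alpha> \<beta>. g $ Inl \<alpha> $ Inl \<beta>)"
  define b where "b = (\<chi> \<alpha> \<nu>. g $ Inl \<alpha> $ Inr \<nu>)"
  define c where "c = (\<chi> \<mu> \<beta>. g $ Inr \<mu> $ Inl \<beta>)"
  define d where "d = (\<chi> \<mu> \<nu>. g $ Inr \<mu> $ Inr \<nu>)"
  have sum: "(\<Sum>r\<in>UNIV. h r) = (\<Sum>\<alpha>\<in>UNIV. h (Inl \<alpha>)) + (\<Sum>\<mu>\<in>UNIV. h (Inr \<mu>))" for h :: "'p + 'q \<Rightarrow> complex"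
    by (simp add: UNIV_Plus_UNIV[symmetric] sum.Plus del: UNIV_Plus_UNIV)
  have pos: "pos_part (g *v x) = a ** pos_part x + b ** neg_part x" for x
    by (simp add: pos_part_def neg_part_def a_def b_def vec_eq_iff matrix_vector_mult_def matrix_matrix_mult_def sum)
  have neg: "neg_part (g *v x) = c ** pos_part x + d ** neg_part x" for x
    by (simp add: pos_part_def neg_part_def c_def d_def vec_eq_iff matrix_vector_mult_def matrix_matrix_mult_def sum)
  have pos0: "pos_part (g *v x) = 0" if "x \<in> graph Z" for x
    using that g(2) unfolding act_def by (metis base_plane_parts imageI)
  have "(a ** Z + b) ** v = 0" for v :: "complex ^ 1 ^ 'q"
    using pos0[of "vec_of (Z ** v) v"] by (simp add: graph_parts pos matrix_ring_simps)
  then have "a ** Z + b = 0" by (rule matrix_eq_0I)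
  then have b: "b = - (a ** Z)" by (simp add: add_eq_0_iff)
  \<comment> \<open>(u, ct(Z) u) is orthogonal to \<open>graph Z\<close>, so its image is orthogonal
    to the base plane. Pairing the image with its own negative part, lifted back to
    \<open>graph Z\<close>, shows that this part has norm zero.\<close>
  have neg0: "neg_part (g *v vec_of u (ct Z ** u)) = 0" for u
  proof -
    let ?x = "vec_of u (ct Z ** u)" let ?n = "neg_part (g *v ?x)"
    have "vec_of 0 ?n \<in> base_plane" by (simp add: base_plane_parts)
    then obtain x where x: "x \<in> graph Z" "g *v x = vec_of 0 ?n" using g(2) unfolding act_def by (metis imageE)
    have "herm x ?x = 0" using x(1) by (simp add: herm_parts graph_parts ct_simps matrix_ring_simps)
    then have "herm (vec_of 0 ?n) (g *v ?x) = 0" using unit[of x ?x] x(2) by simp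
    then have "(ct ?n ** ?n) $ 1 $ 1 = 0" by (simp add: herm_parts ct_simps matrix_zero_left)
    then have "(\<Sum>i\<in>UNIV. (cmod (?n $ i $ 1))\<^sup>2) = 0"
      unfolding matrix_matrix_mult_def ct_def
      by (simp add: complex_norm_square[symmetric] mult.commute flip: of_real_sum of_real_power)
    then have "?n $ i $ 1 = 0" for i by (simp add: sum_nonneg_eq_0_iff)
    then show ?thesis by (simp add: vec_eq_iff)
  qed
  have "(c + d ** ct Z) ** u = 0" for u :: "complex ^ 1 ^ 'p"
    using neg0[of u] by (simp add: neg matrix_ring_simps)
  then have "c + d ** ct Z = 0" by (rule matrix_eq_0I)
  then have c: "c = - (d ** ct Z)" by (simp add: add_eq_0_iff)
  have pos': "pos_part (g *v x) = a ** mv x Z" for x by (simp add: pos b mv_def matrix_ring_simps)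
  have neg': "neg_part (g *v x) = d ** (neg_part x - ct Z ** pos_part x)" for x by (simp add: neg c matrix_ring_simps)
  have "Kmat Z ** (ct d ** d) ** Kmat Z = Kmat Z"
  proof (rule matrix_eqI_form)
    fix u v :: "complex ^ 1 ^ 'q"
    let ?x = "vec_of (Z ** u) u" and ?y = "vec_of (Z ** v) v"
    have "herm (g *v ?x) (g *v ?y) = - hf (Kmat Z ** (ct d ** d) ** Kmat Z) u v"
      by (simp add: herm_parts pos' neg' mv_def hf_def Kmat_def ct_simps matrix_ring_simps)
    moreover have "herm ?x ?y = - hf (Kmat Z) u v"
      by (simp add: herm_parts hf_def Kmat_def ct_simps matrix_ring_simps)
    ultimately show "hf (Kmat Z ** (ct d ** d) ** Kmat Z) u v = hf (Kmat Z) u v" using unit[of ?x ?y] by simp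
  qed
  then have "Hmat Z ** (Kmat Z ** (ct d ** d) ** Kmat Z) ** Hmat Z = Hmat Z ** Kmat Z ** Hmat Z" by simp
  moreover have "Hmat Z ** (Kmat Z ** (ct d ** d) ** Kmat Z) ** Hmat Z = (Hmat Z ** Kmat Z) ** (ct d ** d) ** (Kmat Z ** Hmat Z)"
    by (simp add: matrix_mul_assoc)
  ultimately have dd: "ct d ** d = Hmat Z" using HK[OF det] by simp
  let ?K = "mat 1 - Z ** ct Z"
  have "?K ** (ct a ** a) ** ?K = ?K"
  proof (rule matrix_eqI_form)
    fix u v :: "complex ^ 1 ^ 'p"
    let ?x = "vec_of u (ct Z ** u)" and ?y = "vec_of v (ct Z ** v)"
    have "herm (g *v ?x) (g *v ?y) = hf (?K ** (ct a ** a) ** ?K) u v"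
      by (simp add: herm_parts pos' neg0 mv_def hf_def ct_simps matrix_ring_simps)
    moreover have "herm ?x ?y = hf ?K u v"
      by (simp add: herm_parts hf_def ct_simps matrix_ring_simps)
    ultimately show "hf (?K ** (ct a ** a) ** ?K) u v = hf ?K u v" using unit[of ?x ?y] by simp
  qed
  then have "Gmat Z ** (?K ** (ct a ** a) ** ?K) ** Gmat Z = Gmat Z ** ?K ** Gmat Z" by simp
  moreover have "Gmat Z ** (?K ** (ct a ** a) ** ?K) ** Gmat Z = (Gmat Z ** ?K) ** (ct a ** a) ** (?K ** Gmat Z)"
    by (simp only: matrix_mul_assoc)
  ultimately have aa: "ct a ** a = Gmat Z" using G_inverse[OF det] by simp
  show ?thesis using pos' neg' aa dd by blast
qed

lemma has_derivative_vec_nth: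
  fixes f :: "'b::real_normed_vector \<Rightarrow> 'a::euclidean_space ^ 'n"
  assumes "\<And>i. ((\<lambda>t. f t $ i) has_derivative (\<lambda>h. f' h $ i)) (at t)"
  shows "(f has_derivative f') (at t)"
proof (subst has_derivative_componentwise_within, rule ballI)
  fix b :: "'a ^ 'n" assume "b \<in> Basis"
  then obtain i u where b: "b = axis i u" by (auto simp: Basis_vec_def)
  show "((\<lambda>t. f t \<bullet> b) has_derivative (\<lambda>h. f' h \<bullet> b)) (at t)"
    unfolding b inner_axis using bounded_linear.has_derivative[OF bounded_linear_inner_left[of u] assms[of i]] .
qed

text \<open>In the chart \<open>g\<close> is the fractional linear map
  \<open>F Z' = a ** (Z' - Z) ** (M Z')^-1\<close>. The middle factor vanishes at \<open>Z\<close>,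
  so the derivative of the inverse does not contribute, and the inverse of \<open>M Z\<close> is
  \<open>ct d\<close>.\<close>

lemma dact_eq:
  fixes Z :: "complex ^ 'q::finite ^ 'p::finite"
  assumes Z: "posdef (Kmat Z)"
    and g: "\<And>x. pos_part (g *v x) = a ** mv x Z" "\<And>x. neg_part (g *v x) = d ** (neg_part x - ct Z ** pos_part x)"
    and dd: "ct d ** d = Hmat Z"
  shows "dact g (graph Z) = (\<lambda>h. a ** h ** ct d)"
proof -
  note det = posdef_det[OF Z]
  define M where "M Z' = d ** (mat 1 - ct Z ** Z')" for Z' :: "complex ^ 'q ^ 'p"
  define F where "F Z' = a ** (Z' - Z) ** cramer_inv (M Z')" for Z'
  have MZ: "M Z = d ** Kmat Z" by (simp add: M_def Kmat_def)
  have "ct d ** (d ** Kmat Z) = mat 1" using HK(2)[OF det] dd by (simp add: matrix_mul_assoc)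
  then have inv: "d ** Kmat Z ** ct d = mat 1" using matrix_left_right_inverse by blast
  then have "det (M Z) * det (ct d) = 1" by (metis MZ det_mul det_I)
  then have detM: "det (M Z) \<noteq> 0" by auto
  have NZ: "cramer_inv (M Z) = ct d"
  proof -
    have "cramer_inv (M Z) ** (M Z ** ct d) = ct d" using cramer_inv(2)[OF detM] by (simp add: matrix_mul_assoc)
    then show ?thesis using inv by (simp add: MZ)
  qed
  have act: "coord (act g (graph Z')) = F Z'" if Z': "det (M Z') \<noteq> 0" for Z'
  proof -
    note N = cramer_inv[OF Z']
    have pos: "pos_part (g *v vec_of (Z' ** v) v) = a ** (Z' - Z) ** v" for v
      by (simp add: g mv_def matrix_ring_simps)
    have neg: "neg_part (g *v vec_of (Z' ** v) v) = M Z' ** v" for v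
      by (simp add: g M_def matrix_ring_simps)
    have "act g (graph Z') = graph (F Z')"
    proof
      show "act g (graph Z') \<subseteq> graph (F Z')"
      proof
        fix y assume "y \<in> act g (graph Z')"
        then obtain x where x: "x \<in> graph Z'" "y = g *v x" by (auto simp: act_def)
        have "x = vec_of (Z' ** neg_part x) (neg_part x)" using x(1) vec_of_parts[of x] by (simp add: graph_parts)
        then have y: "pos_part y = a ** (Z' - Z) ** neg_part x" "neg_part y = M Z' ** neg_part x"
          unfolding x(2) using pos neg by metis+
        have "F Z' ** neg_part y = a ** (Z' - Z) ** ((cramer_inv (M Z') ** M Z') ** neg_part x)"
          by (simp add: F_def y(2) matrix_mul_assoc)
        then show "y \<in> graph (F Z')" by (simp add: graph_parts y(1) N(2))
      qed
      show "graph (F Z') \<subseteq> act g (graph Z')"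
      proof
        fix y assume y: "y \<in> graph (F Z')"
        let ?v = "cramer_inv (M Z') ** neg_part y"
        have "g *v vec_of (Z' ** ?v) ?v = y"
        proof (rule parts_eqI)
          show "pos_part (g *v vec_of (Z' ** ?v) ?v) = pos_part y"
            using y unfolding pos by (simp add: graph_parts F_def matrix_mul_assoc)
          show "neg_part (g *v vec_of (Z' ** ?v) ?v) = neg_part y"
            unfolding neg by (simp add: matrix_mul_assoc N(1))
        qed
        moreover have "vec_of (Z' ** ?v) ?v \<in> graph Z'" by (simp add: graph_parts)
        ultimately show "y \<in> act g (graph Z')" unfolding act_def by (metis imageI)
      qed
    qed
    then show ?thesis by simp
  qed
  have diffM: "(\<lambda>Z'. M Z' $ i $ j) differentiable (at Z1)" for i j Z1
  proof -
    have 1: "bounded_linear (\<lambda>Z :: complex ^ 'q ^ 'p. Z $ a $ b)" for a b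
      by (rule bounded_linear_compose[OF bounded_linear_vec_nth bounded_linear_vec_nth])
    have "(\<lambda>Z'. cnj (Z $ k $ r) * Z' $ k $ j) differentiable (at Z1)" for k r
      by (intro differentiable_mult differentiable_const bounded_linear_imp_differentiable[OF 1])
    then have s: "(\<lambda>Z'. \<Sum>k\<in>UNIV. cnj (Z $ k $ r) * Z' $ k $ j) differentiable (at Z1)" for r
      by (intro differentiable_sum) auto
    have "(\<lambda>Z'. d $ i $ r * (mat 1 $ r $ j - (\<Sum>k\<in>UNIV. cnj (Z $ k $ r) * Z' $ k $ j))) differentiable (at Z1)" for r
      by (intro differentiable_mult differentiable_const differentiable_diff s)
    then show ?thesis
      unfolding M_def ct_def matrix_matrix_mult_def vector_minus_component vec_lambda_beta
      by (intro differentiable_sum) auto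
  qed
  have "open {Z'. det (M Z') \<noteq> 0}"
    by (intro open_Collect_neq continuous_on_const continuous_at_imp_continuous_on ballI
        differentiable_imp_continuous_within differentiable_det diffM)
  have "(F has_derivative (\<lambda>h. a ** h ** ct d)) (at Z)"
  proof (intro has_derivative_vec_nth)
    fix \<alpha> k
    have N: "\<exists>D. ((\<lambda>Z'. cramer_inv (M Z') $ l $ k) has_derivative D) (at Z)" for l
      using differentiable_cramer_inv[OF diffM detM] by (simp add: differentiable_def)
    then obtain D where D: "\<And>l. ((\<lambda>Z'. cramer_inv (M Z') $ l $ k) has_derivative D l) (at Z)" by metis
    have lin: "((\<lambda>Z'. (a ** (Z' - Z)) $ \<alpha> $ l) has_derivative (\<lambda>h. (a ** h) $ \<alpha> $ l)) (at Z)" for l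
      unfolding matrix_matrix_mult_def vec_lambda_beta vector_minus_component
      by (auto intro!: derivative_eq_intros bounded_linear.has_derivative[OF bounded_linear_vec_nth])
    have "((\<lambda>Z'. \<Sum>l\<in>UNIV. (a ** (Z' - Z)) $ \<alpha> $ l * cramer_inv (M Z') $ l $ k) has_derivative
        (\<lambda>h. \<Sum>l\<in>UNIV. (a ** (Z - Z)) $ \<alpha> $ l * D l h + (a ** h) $ \<alpha> $ l * cramer_inv (M Z) $ l $ k)) (at Z)"
      by (intro has_derivative_sum has_derivative_mult lin D)
    then show "((\<lambda>Z'. F Z' $ \<alpha> $ k) has_derivative (\<lambda>h. (a ** h ** ct d) $ \<alpha> $ k)) (at Z)"
      unfolding F_def NZ by (simp add: matrix_matrix_mult_def[of "a ** (_ - _)"] matrix_matrix_mult_def[of "a ** _" "ct d"] matrix_zero_right)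
  qed
  then have "((\<lambda>Z'. coord (act g (graph Z'))) has_derivative (\<lambda>h. a ** h ** ct d)) (at Z)"
    by (rule has_derivative_transform_within_open[OF _ \<open>open {Z'. det (M Z') \<noteq> 0}\<close>]) (use detM act in auto)
  then show ?thesis
    unfolding dact_def coord_graph by (rule frechet_derivative_at[symmetric])
qed

text \<open>The choice of \<open>g\<close> depends on the plane only, so one pair \<open>a\<close>,
  \<open>d\<close> serves all \<open>F\<close>, \<open>x\<close> and \<open>w\<close>.\<close>

lemma invariant_form_eq:
  fixes Z :: "complex ^ 'q::finite ^ 'p::finite"
  assumes Z: "posdef (Kmat Z)"
  obtains a d where "ct a ** a = Gmat Z" "ct d ** d = Hmat Z"
    "\<And>F x w. invariant_form F x (graph Z) w =
      F (vec_of (a ** mv x Z) (d ** (neg_part x - ct Z ** pos_part x))) (map (\<lambda>h. a ** h ** ct d) w)"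
proof -
  define g where "g = (SOME g. g \<in> unitary_group \<and> act g (graph Z) = base_plane)"
  have "g \<in> unitary_group \<and> act g (graph Z) = base_plane"
    unfolding g_def by (rule someI_ex) (use exists_unitary[OF Z] in blast)
  then obtain a d where *: "\<And>x. pos_part (g *v x) = a ** mv x Z" "\<And>x. neg_part (g *v x) = d ** (neg_part x - ct Z ** pos_part x)"
    "ct a ** a = Gmat Z" "ct d ** d = Hmat Z" using unitary_normal_form[OF Z, of g] by blast
  have gx: "g *v x = vec_of (a ** mv x Z) (d ** (neg_part x - ct Z ** pos_part x))" for x
    by (rule parts_eqI) (simp_all add: *)
  show ?thesis
    by (rule that[OF *(3,4)])
      (simp add: invariant_form_def Let_def g_def[symmetric] gx dact_eq[OF Z *(1,2,4)])
qed

lemma mfree_minus [simp]: "mfree i A \<Longrightarrow> mfree i (- A)"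
  by (simp add: mfree_def)

section \<open>The Kudla--Millson form and its Green form as Berezin integrals\<close>

lemma matrix_sum_right: "A ** (\<Sum>j\<in>J. B j) = (\<Sum>j\<in>J. A ** (B j :: 'a::ring_1 ^ 'c ^ 'b))"
  by (induction J rule: infinite_finite_induct) (auto simp: matrix_zero_right matrix_add_ldistrib)

lemma matrix_sum_left: "(\<Sum>j\<in>J. A j) ** B = (\<Sum>j\<in>J. A j ** (B :: 'a::ring_1 ^ 'c ^ 'b))"
  by (induction J rule: infinite_finite_induct) (auto simp: matrix_zero_left matrix_add_left)

definition lm :: "'i::finite grassmann \<Rightarrow> 'i grassmann ^ 'b ^ 'a \<Rightarrow> 'i grassmann ^ 'b ^ 'a" where
  "lm e A = (\<chi> i j. e * A $ i $ j)"

lemma cm_lm: "cm A ** lm e B = lm e (cm A ** B)"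
  by (simp add: lm_def vec_eq_iff matrix_matrix_mult_def cm_nth sum_distrib_left mult_cs_left)

lemma lm_mult: "lm e A ** B = lm e (A ** B)"
  by (simp add: lm_def vec_eq_iff matrix_matrix_mult_def sum_distrib_left mult.assoc)

lemma W_lm:
  assumes "odd_tangent es w"
  shows "odd_tangent.W es w = (\<Sum>j<length w. lm (es ! j) (cm (w ! j)))"
    "odd_tangent.Ws es w = (\<Sum>j<length w. lm (es ! j) (cm (ct (w ! j))))"
  by (simp_all add: odd_tangent.W_def[OF assms] odd_tangent.Ws_def[OF assms] vec_eq_iff lm_def cm_nth ct_def)

lemma W_map:
  assumes "odd_tangent es w" "odd_tangent es (map (\<lambda>h. a ** h ** ct d) w)"
  shows "odd_tangent.W es (map (\<lambda>h. a ** h ** ct d) w) = cm a ** odd_tangent.W es w ** cm (ct d)"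
    "odd_tangent.Ws es (map (\<lambda>h. a ** h ** ct d) w) = cm d ** odd_tangent.Ws es w ** cm (ct a)"
  unfolding W_lm[OF assms(1)] W_lm[OF assms(2)]
  by (simp_all add: matrix_sum_left matrix_sum_right cm_lm lm_mult cm_simps ct_simps matrix_mul_assoc)

definition eps_gens :: "'q::{finite, linorder} gens grassmann list" where
  "eps_gens = map (\<lambda>j. gen (Inl j)) (map Inl qs @ map Inr qs)"

lemma form_tangent_eps:
  fixes w :: "(complex ^ ('q::{finite, linorder}) ^ 'p::finite) list"
  assumes "length w = 2 * CARD('q)"
  shows "form_tangent eps_gens w"
  by unfold_locales (auto simp: eps_gens_def assms)

text \<open>With \<open>eps_gens\<close> the product in \<open>c0\<close> contains every generator
  exactly once.\<close>

lemma c0_nonzero: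
  fixes w :: "(complex ^ ('q::{finite, linorder}) ^ 'p::finite) list"
  assumes "form_tangent (eps_gens :: 'q gens grassmann list) w"
  shows "form_tangent.c0 (eps_gens :: 'q gens grassmann list) \<noteq> 0"
proof -
  interpret form_tangent "eps_gens :: 'q gens grassmann list" w by (rule assms)
  let ?L = "map (\<lambda>k. Inr (Inl k)) qs @ map Inl (map Inl qs @ map Inr qs) @ map (\<lambda>k. Inr (Inr k)) qs :: 'q gens list"
  have "UNIV = set ?L"
  proof (intro equalityI subsetI)
    fix i :: "'q gens" assume "i \<in> UNIV"
    show "i \<in> set ?L" by (cases i; cases "projl i"; cases "projr i") auto
  qed simp
  moreover have "distinct ?L" by (auto simp: distinct_map inj_on_def)
  ultimately have "gcoef (prod_list (map gen ?L)) UNIV \<noteq> 0" using gcoef_prod_gen[of ?L] by simp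
  then show ?thesis
    unfolding c0_def by (simp add: THp_def CHp_def eps_gens_def top_coef_def comp_def mult.assoc)
qed

lemma nst_eq:
  assumes Z: "det (Kmat Z) \<noteq> 0" shows "nst x Z = ct (mv x Z) ** Gmat Z"
  using arg_cong[OF Gm_eq[OF Z, of x], of ct]
  by (simp add: ct_simps ct_Gmat[OF Z] nst_def tv_def sst_def ct_Hmat[OF Z] matrix_ring_simps)

lemma of_real_sum_cmod: "complex_of_real (\<Sum>i\<in>I. (cmod (f i))\<^sup>2) = (\<Sum>i\<in>I. cnj (f i) * f i)"
  by (simp add: complex_norm_square mult.commute del: of_real_power)

lemma phi_zero_parts:
  "phi_zero x = exp (- of_real pi * (ct (pos_part x) ** pos_part x + ct (neg_part x) ** neg_part x) $ 1 $ 1)"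
proof -
  have "(\<Sum>r\<in>UNIV. (cmod (x $ r))\<^sup>2) = (\<Sum>\<alpha>\<in>UNIV. (cmod (x $ Inl \<alpha>))\<^sup>2) + (\<Sum>\<mu>\<in>UNIV. (cmod (x $ Inr \<mu>))\<^sup>2)"
    by (simp add: UNIV_Plus_UNIV[symmetric] sum.Plus del: UNIV_Plus_UNIV)
  then show ?thesis
    by (simp add: phi_zero_def matrix_matrix_mult_def ct_def pos_part_def neg_part_def of_real_sum_cmod del: of_real_sum)
qed

text \<open>With y = gx, the weight contributes |y_+|^2 - |y_-|^2 and the Gaussian -|y_+|^2 -
  |y_-|^2, both times \<pi>. Only -2\<pi> |y_-|^2 survives, and |y_-|^2 = ct(s) H s.\<close>

lemma gaussian_eq:
  fixes x :: "complex ^ ('p::finite + 'q::finite)"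
  assumes Z: "det (Kmat Z) \<noteq> 0" and ad: "ct a ** a = Gmat Z" "ct d ** d = Hmat Z"
  defines "y \<equiv> vec_of (a ** mv x Z) (d ** (neg_part x - ct Z ** pos_part x))"
  shows "exp (of_real pi * herm x x) * phi_zero y = exp (- (2 * of_real pi) * (sst x Z ** tv x Z) $ 1 $ 1)"
proof -
  have A: "ct (a ** mv x Z) ** (a ** mv x Z) = ct (mv x Z) ** Gmat Z ** mv x Z"
    by (simp add: ad(1)[symmetric] ct_simps matrix_mul_assoc)
  have B: "ct (d ** u) ** (d ** v) = ct u ** Hmat Z ** v" for u v :: "complex ^ 1 ^ 'q"
    by (simp add: ad(2)[symmetric] ct_simps matrix_mul_assoc)
  have h: "herm x x = (ct (mv x Z) ** Gmat Z ** mv x Z) $ 1 $ 1 -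
      (ct (neg_part x - ct Z ** pos_part x) ** Hmat Z ** (neg_part x - ct Z ** pos_part x)) $ 1 $ 1"
    by (simp add: herm_parts mv_def Gmat_def ct_simps matrix_ring_simps HZZ_left[OF Z])
  have r: "sst x Z ** tv x Z = ct (neg_part x - ct Z ** pos_part x) ** Hmat Z ** (neg_part x - ct Z ** pos_part x)"
    by (simp add: sst_def tv_def ct_simps matrix_mul_assoc)
  show ?thesis
    unfolding phi_zero_parts y_def parts_vec_of A B exp_add[symmetric] h r by (simp add: algebra_simps)
qed

lemma (in form_tangent) mfree_av: "mfree (Inr i) (av x Z)" "mfree (Inr i) (bv x Z)" "mfree (Inr i) (Cm Z)"
proof -
  have "mfree (Inr i) W" "mfree (Inr i) Ws" by (simp_all add: mfree_def)
  then show "mfree (Inr i) (av x Z)" "mfree (Inr i) (bv x Z)" "mfree (Inr i) (Cm Z)"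
    by (simp_all add: av_def bv_def Cm_def Bm_def)
qed

lemma (in form_tangent) Eexp_Mexp:
  "exp (Eexp x Z) = cs (exp (- (2 * of_real pi) * (sst x Z ** tv x Z) $ 1 $ 1)) *
    exp (Mexp (- 2 *\<^sub>R av x Z) (- 2 *\<^sub>R bv x Z) (- (2 / pi) *\<^sub>R Cm Z))"
proof -
  have "Eexp x Z = cs (- (2 * of_real pi) * (sst x Z ** tv x Z) $ 1 $ 1) +
      Mexp (- 2 *\<^sub>R av x Z) (- 2 *\<^sub>R bv x Z) (- (2 / pi) *\<^sub>R Cm Z)"
  proof -
    have "(cs (- (2 * of_real pi) * c) :: 'q gens grassmann) = - (2 * pi) *\<^sub>R cs c" for c
      unfolding cs_scaleR[symmetric] by (simp add: scaleR_complex)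
    then show ?thesis
      by (simp add: Eexp_def Em_def Mexp_def cm_simps(1)[symmetric] cm_nth matrix_ring_simps scaleR_add_right)
  qed
  then show ?thesis by (simp add: exp_add_commuting geven_commute cs_exp)
qed

text \<open>After transport by g, the exponent at the base plane has the data a P, P'b, P'CP in
  place of a, b, C, with P = \<open>ct d\<close>. This is a change of frame, so the integral forgets
  the choice of g.\<close>

lemma unitary_frame:
  fixes w :: "(complex ^ ('q::{finite, linorder}) ^ 'p::finite) list" and Z :: "complex ^ ('q::{finite, linorder}) ^ 'p"
    and x :: "complex ^ ('p + 'q)"
  assumes Z: "det (Kmat Z) \<noteq> 0" and ad: "ct a ** a = Gmat Z" "ct d ** d = Hmat Z"
    and w: "form_tangent es w" "form_tangent es (map (\<lambda>h. a ** h ** ct d) w)"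
    and \<eta>: "eps_only \<eta>" "geven \<eta> \<or> godd \<eta>"
  defines "y \<equiv> vec_of (a ** mv x Z) (d ** (neg_part x - ct Z ** pos_part x))"
  shows "exp (of_real pi * herm x x) * (phi_zero y * top_coef (\<eta> * exp (form_tangent.Mu es (map (\<lambda>h. a ** h ** ct d) w) y))) =
      top_coef (\<eta> * exp (eps_tangent.Eexp es w x Z))"
    "exp (of_real pi * herm x x) * (phi_zero y * top_coef (\<eta> * (eps_tangent.Nel * exp (form_tangent.Mu es (map (\<lambda>h. a ** h ** ct d) w) y)))) =
      top_coef (\<eta> * (eps_tangent.Nel * exp (eps_tangent.Eexp es w x Z)))"
proof -
  let ?w' = "map (\<lambda>h. a ** h ** ct d) w"
  interpret H: form_tangent es w by (rule w)
  interpret U: form_tangent es ?w' by (rule w)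
  note Wm = W_map[OF H.odd_tangent_axioms U.odd_tangent_axioms]
  \<comment> \<open>Since \<open>ct d ** d\<close> equals \<open>Hmat Z\<close>, the inverse of
    \<open>ct d\<close> is \<open>d ** Kmat Z\<close>.\<close>
  let ?P = "ct d" let ?P' = "d ** Kmat Z"
  have P: "?P ** ?P' = mat 1" using HK(2)[OF Z] by (simp add: matrix_mul_assoc ad)
  then have P': "?P' ** ?P = mat 1" using matrix_left_right_inverse by blast
  have "?P' ** Hmat Z = ?P' ** ?P ** d" by (simp add: ad(2)[symmetric] matrix_mul_assoc)
  then have P'H: "?P' ** Hmat Z = d" by (simp only: P' matrix_mul_lid)
  have 1: "cm (ct (a ** mv x Z)) ** U.W = H.av x Z ** cm ?P"
    unfolding H.av_def nst_eq[OF Z] ad(1)[symmetric] by (simp add: Wm cm_simps ct_simps matrix_mul_assoc)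
  have cd: "(cm ?P' ** cm (Hmat Z) :: 'q gens grassmann ^ ('q::{finite, linorder}) ^ ('q::{finite, linorder})) = cm d"
    by (simp only: cm_simps(1)[symmetric] P'H)
  have G: "(cm (Gmat Z) :: 'q gens grassmann ^ 'p ^ 'p) = cm (ct a) ** cm a"
    by (simp only: cm_simps(1)[symmetric] ad(1))
  have 2: "U.Ws ** cm (a ** mv x Z) = cm ?P' ** H.bv x Z"
    unfolding H.bv_def H.Bm_def Wm G cm_simps(1)[of a] by (simp only: matrix_mul_assoc cd)
  have 3: "U.Ws ** U.W = cm ?P' ** H.Cm Z ** cm ?P"
    unfolding H.Cm_def H.Bm_def Wm G by (simp only: matrix_mul_assoc cd)
  have Mu: "U.Mu y = Mexp ((- 2 *\<^sub>R H.av x Z) ** cm ?P) (cm ?P' ** (- 2 *\<^sub>R H.bv x Z)) (cm ?P' ** (- (2 / pi) *\<^sub>R H.Cm Z) ** cm ?P)"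
    unfolding U.Mu_def y_def parts_vec_of 1 2 3 by (simp only: matrix_scaleR_left matrix_scaleR_right)
  let ?M = "Mexp (- 2 *\<^sub>R H.av x Z) (- 2 *\<^sub>R H.bv x Z) (- (2 / pi) *\<^sub>R H.Cm Z)"
  have fc: "top_coef (\<eta> * exp (U.Mu y)) = top_coef (\<eta> * exp ?M)"
    unfolding Mu by (rule frame_change) (simp_all add: H.mfree_av \<eta> P)
  have fcN: "top_coef (\<eta> * (exp (U.Mu y) * (ch ** th) $ 1 $ 1)) = top_coef (\<eta> * (exp ?M * (ch ** th) $ 1 $ 1))"
    unfolding Mu by (rule frame_change_N) (simp_all add: H.mfree_av \<eta> P)
  have N: "eps_tangent.Nel * z = - (z * (ch ** th) $ 1 $ 1)" for z :: "'q gens grassmann"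
    using geven_commute[OF H.geven_Nel, of z] by (simp add: H.Nel_def)
  let ?r = "exp (- (2 * of_real pi) * (sst x Z ** tv x Z) $ 1 $ 1)"
  have g: "exp (of_real pi * herm x x) * (phi_zero y * c) = ?r * c" for c
    using gaussian_eq[OF Z ad, of x] unfolding y_def by (simp flip: mult.assoc)
  show "exp (of_real pi * herm x x) * (phi_zero y * top_coef (\<eta> * exp (U.Mu y))) = top_coef (\<eta> * exp (H.Eexp x Z))"
    unfolding g fc H.Eexp_Mexp mult_cs_left[of \<eta>] top_coef_simps(6) ..
  show "exp (of_real pi * herm x x) * (phi_zero y * top_coef (\<eta> * (eps_tangent.Nel * exp (U.Mu y)))) =
      top_coef (\<eta> * (eps_tangent.Nel * exp (H.Eexp x Z)))"
    unfolding g N mult_minus_right top_coef_simps(4) fcN H.Eexp_Mexp mult.assoc mult_cs_left[of \<eta>] top_coef_simps(6) by simp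
qed

lemma form_tangent_map:
  "form_tangent es w \<Longrightarrow> form_tangent es (map f w)"
  unfolding form_tangent_def eps_tangent_def odd_tangent_def by simp

lemma phi_KM0_berezin:
  fixes Z :: "complex ^ ('q::{finite, linorder}) ^ 'p::finite" and w :: "(complex ^ ('q::{finite, linorder}) ^ 'p) list"
  assumes Z: "posdef (Kmat Z)" and n: "length w = 2 * CARD('q)"
  defines "c \<equiv> form_tangent.c0 (eps_gens :: 'q gens grassmann list)"
  shows "c * phi_KM0 x (graph Z) w = 1 / 2 ^ (2 * CARD('q)) * top_coef (exp (eps_tangent.Eexp eps_gens w x Z))"
proof -
  obtain a d where ad: "ct a ** a = Gmat Z" "ct d ** d = Hmat Z"
    and inv: "\<And>F x w. invariant_form F x (graph Z) w =
      F (vec_of (a ** mv x Z) (d ** (neg_part x - ct Z ** pos_part x))) (map (\<lambda>h. a ** h ** ct d) w)"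
    using invariant_form_eq[OF Z] by blast
  let ?w' = "map (\<lambda>h. a ** h ** ct d) w"
  note H = form_tangent_eps[OF n]
  note U = form_tangent_map[OF H, of "\<lambda>h. a ** h ** ct d"]
  interpret U: form_tangent eps_gens ?w' by (rule U)
  have "c * phi_KM0 x (graph Z) w = exp (of_real pi * herm x x) *
      (c * phi_KM_base (vec_of (a ** mv x Z) (d ** (neg_part x - ct Z ** pos_part x))) ?w')"
    by (simp add: phi_KM0_def phi_KM_def inv)
  also have "\<dots> = 1 / 2 ^ (2 * CARD('q)) * (exp (of_real pi * herm x x) *
      (phi_zero (vec_of (a ** mv x Z) (d ** (neg_part x - ct Z ** pos_part x))) *
       top_coef (1 * exp (U.Mu (vec_of (a ** mv x Z) (d ** (neg_part x - ct Z ** pos_part x)))))))"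
    unfolding c_def using U.phi_formula by (simp add: n)
  also have "\<dots> = 1 / 2 ^ (2 * CARD('q)) * top_coef (1 * exp (eps_tangent.Eexp eps_gens w x Z))"
    by (subst unitary_frame(1)[OF posdef_det[OF Z] ad H U]) simp_all
  finally show ?thesis by simp
qed

lemma psi0_berezin:
  fixes Z :: "complex ^ ('q::{finite, linorder}) ^ 'p::finite" and w :: "(complex ^ ('q::{finite, linorder}) ^ 'p) list"
  assumes Z: "posdef (Kmat Z)" and n: "length w = 2 * CARD('q)" and i: "i < length w" and j: "j < length w - 1"
  defines "c \<equiv> form_tangent.c0 (eps_gens :: 'q gens grassmann list)" and "es \<equiv> eps_gens :: 'q gens grassmann list"
  defines "es' \<equiv> take i es @ drop (Suc i) es" and "w' \<equiv> take i w @ drop (Suc i) w"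
  shows "c * psi0 x (graph Z) (take j w' @ drop (Suc j) w') = (-1) ^ i * (-1) ^ j * (2 * \<i> / 2 ^ (2 * (CARD('q) - 1))) *
    top_coef (es ! i * es' ! j * (eps_tangent.Nel * exp (eps_tangent.Eexp es w x Z)))"
proof -
  obtain a d where ad: "ct a ** a = Gmat Z" "ct d ** d = Hmat Z"
    and inv: "\<And>F x w. invariant_form F x (graph Z) w =
      F (vec_of (a ** mv x Z) (d ** (neg_part x - ct Z ** pos_part x))) (map (\<lambda>h. a ** h ** ct d) w)"
    using invariant_form_eq[OF Z] by blast
  let ?f = "\<lambda>h. a ** h ** ct d" let ?y = "vec_of (a ** mv x Z) (d ** (neg_part x - ct Z ** pos_part x))"
  note H = form_tangent_eps[OF n, folded es_def]
  note U = form_tangent_map[OF H, of ?f]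
  interpret H: form_tangent es w by (rule H)
  interpret U: form_tangent es "map ?f w" by (rule U)
  interpret r: odd_tangent es' w' unfolding es'_def w'_def by (rule H.odd_tangent_remove)
  have j': "j < length w'" using j i by (simp add: w'_def)
  have "set es' \<subseteq> set es" unfolding es'_def by (auto dest: in_set_takeD in_set_dropD)
  then have e: "eps_only (es ! i)" "eps_only (es' ! j)"
    using H.eps_only_es i j' H.len r.len by (metis nth_mem subsetD)+
  have o: "godd (es ! i)" "godd (es' ! j)" using H.odd_nth[OF i] r.odd_nth[OF j'] .
  have \<eta>: "eps_only (es ! i * es' ! j)" "geven (es ! i * es' ! j) \<or> godd (es ! i * es' ! j)"
    using e o by (auto intro!: eps_only_mult)
  have "c * psi0 x (graph Z) (take j w' @ drop (Suc j) w') = exp (of_real pi * herm x x) *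
      (c * psi_base ?y (take j (take i (map ?f w) @ drop (Suc i) (map ?f w)) @ drop (Suc j) (take i (map ?f w) @ drop (Suc i) (map ?f w))))"
    by (simp add: psi0_def psi_def inv w'_def take_map drop_map)
  also have "\<dots> = (-1) ^ i * (-1) ^ j * (2 * \<i> / 2 ^ (2 * (CARD('q) - 1))) * (exp (of_real pi * herm x x) *
      (phi_zero ?y * top_coef (es ! i * es' ! j * (eps_tangent.Nel * exp (U.Mu ?y)))))"
    using U.psi_formula[of i j ?y] i j n unfolding c_def es_def[symmetric] es'_def by (simp add: mult_ac)
  also have "\<dots> = (-1) ^ i * (-1) ^ j * (2 * \<i> / 2 ^ (2 * (CARD('q) - 1))) *
      top_coef (es ! i * es' ! j * (eps_tangent.Nel * exp (H.Eexp x Z)))"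
    by (subst unitary_frame(2)[OF posdef_det[OF Z] ad H U \<eta>]) (rule refl)
  finally show ?thesis .
qed

text \<open>\<open>del_delbar_eq\<close> is applied twice: inside with one tangent variable as
  prefactor (\<open>dW_level1\<close>), outside with none (\<open>dW_level2\<close>). The scalar
  \<open>b\<close> is carried along so that compatibility with scalars can be read off the
  formula.\<close>

lemma ddc_psi0:
  fixes Z :: "complex ^ ('q::{finite, linorder}) ^ 'p::finite" and w :: "(complex ^ ('q::{finite, linorder}) ^ 'p) list"
  assumes Z: "posdef (Kmat Z)" and n: "length w = 2 * CARD('q)"
  defines "c \<equiv> form_tangent.c0 (eps_gens :: 'q gens grassmann list)" and "es \<equiv> eps_gens :: 'q gens grassmann list"
  shows "ext_d (ext_dc (\<lambda>z w. b * psi0 x z w)) (graph Z) w =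
    - b / (2 ^ (2 * CARD('q)) * c) * top_coef (eps_tangent.Rel es w x Z * exp (eps_tangent.Eexp es w x Z))"
proof -
  let ?q = "CARD('q)"
  note H = form_tangent_eps[OF n, folded es_def]
  interpret H: form_tangent es w by (rule H)
  have c: "c \<noteq> 0" unfolding c_def by (rule c0_nonzero[OF form_tangent_eps[OF n]])
  define k where "k = b * (2 * \<i> / 2 ^ (2 * (?q - 1))) / c"
  let ?S = "{Z :: complex ^ ('q::{finite, linorder}) ^ 'p. posdef (Kmat Z)}"
  let ?F = "\<lambda>Z. H.Nel * exp (H.Eexp x Z)" and ?F2 = "\<lambda>Z. (H.Y1 x Z - H.Y2 x Z) * exp (H.Eexp x Z)"
  define k2 where "k2 = 1 / (4 * of_real pi * \<i>) * (k * (- of_real pi))"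
  \<comment> \<open>Needed on all of the open set \<open>?S\<close>, because the outer derivative
    acts on this value as a function of the point.\<close>
  have dc: "ext_dc (\<lambda>z w. b * psi0 x z w) (graph Z1) (take i w @ drop (Suc i) w) = (-1) ^ i * (k2 * top_coef (es ! i * ?F2 Z1))"
    if Z1: "Z1 \<in> ?S" and i: "i < length w" for Z1 i
  proof -
    define es' where "es' = take i es @ drop (Suc i) es"
    define w' where "w' = take i w @ drop (Suc i) w"
    interpret r: odd_tangent es' w' unfolding es'_def w'_def by (rule H.odd_tangent_remove)
    define L where "L y = (-1) ^ i * k * top_coef (es ! i * y)" for y
    have det: "det (Kmat Z1) \<noteq> 0" using Z1 by (simp add: posdef_det)
    have "es ! i \<in> set es" using i H.len by simp
    then have \<eta>: "eps_only (es ! i)" "geven (es ! i) \<or> godd (es ! i)" using H.eps_only_es H.odd by auto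
    obtain u v where uv: "H.dW ?F Z1 u v"
      "top_coef (es ! i * u) = - pi * top_coef (es ! i * (H.Y1 x Z1 * exp (H.Eexp x Z1)))"
      "top_coef (es ! i * v) = - pi * top_coef (es ! i * (H.Y2 x Z1 * exp (H.Eexp x Z1)))"
      using H.dW_level1[OF det \<eta>, of x] by blast
    then obtain D where D: "(?F has_derivative D) (at Z1)" "H.dpm (-\<i>) D = u" "H.dpm \<i> D = v"
      unfolding H.dW_def by blast
    have dW': "r.dW ?F (coord (graph Z1)) (r.dpm (-\<i>) D) (r.dpm \<i> D)"
      unfolding r.dW_def coord_graph using D(1) by blast
    have rm: "es ! i * r.dpm s D = es ! i * H.dpm s D" for s
      unfolding es'_def w'_def by (rule H.remove_dpm[OF i])
    have lw': "length w' = length w - 1" using i by (simp add: w'_def)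
    have psi: "b * psi0 x (graph Z2) (take j w' @ drop (Suc j) w') = (-1) ^ j * L (es' ! j * ?F Z2)"
      if Z2: "Z2 \<in> ?S" and j: "j < length w'" for Z2 j
    proof -
      have "c * psi0 x (graph Z2) (take j w' @ drop (Suc j) w') = (-1) ^ i * (-1) ^ j * (2 * \<i> / 2 ^ (2 * (?q - 1))) *
          top_coef (es ! i * es' ! j * (H.Nel * exp (H.Eexp x Z2)))"
        unfolding c_def es'_def w'_def es_def by (rule psi0_berezin) (use Z2 n i j lw' in auto)
      then show ?thesis using c by (simp add: L_def k_def mult.assoc field_simps)
    qed
    have L: "bounded_linear L" "\<And>c x. L (cs c * x) = c * L x"
    proof -
      show "bounded_linear L"
        unfolding L_def by (intro bounded_linear_compose[OF bounded_linear_mult_right]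
            bounded_linear_compose[OF bounded_linear_top_coef] bounded_linear_mult_right)
      show "L (cs c * x) = c * L x" for c x by (simp add: L_def mult_cs_left[of "es ! i"] top_coef_simps)
    qed
    have S: "open ?S" "coord (graph Z1) \<in> ?S" using open_negative Z1 by auto
    have "del (\<lambda>z w. b * psi0 x z w) (graph Z1) w' = L (r.dpm (-\<i>) D)" "delbar (\<lambda>z w. b * psi0 x z w) (graph Z1) w' = L (r.dpm \<i> D)"
      by (rule r.del_delbar_eq[OF dW' S L]; use psi in blast)+
    then show ?thesis
      unfolding ext_dc_def w'_def[symmetric] L_def rm D(2,3) uv(2,3) k2_def
      by (simp add: left_diff_distrib right_diff_distrib top_coef_simps mult_ac)
  qed
  have det: "det (Kmat Z) \<noteq> 0" by (rule posdef_det[OF Z])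
  obtain u v where uv: "H.dW ?F2 Z u v" "top_coef (u + v) = top_coef (H.Rel x Z * exp (H.Eexp x Z))"
    using H.dW_level2[OF det, of x] by blast
  have uv': "H.dW ?F2 (coord (graph Z)) u v" using uv(1) by simp
  have S: "open ?S" "coord (graph Z) \<in> ?S" using open_negative Z by auto
  have L: "bounded_linear (\<lambda>y. k2 * top_coef y)" "\<And>c x. k2 * top_coef (cs c * x) = c * (k2 * top_coef x)"
    by (intro bounded_linear_compose[OF bounded_linear_mult_right] bounded_linear_top_coef)
      (simp add: top_coef_simps)
  have "del (ext_dc (\<lambda>z w. b * psi0 x z w)) (graph Z) w = k2 * top_coef u"
    "delbar (ext_dc (\<lambda>z w. b * psi0 x z w)) (graph Z) w = k2 * top_coef v"
    by (rule H.del_delbar_eq[OF uv' S L]; use dc in blast)+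
  then have "ext_d (ext_dc (\<lambda>z w. b * psi0 x z w)) (graph Z) w = 1 / 2 * k2 * top_coef (u + v)"
    by (simp add: ext_d_def top_coef_simps algebra_simps)
  \<comment> \<open>2\<i> from \<open>psi\<close>, -\<pi> from the integration by parts,
    1/(4\<pi>\<i>) from \<open>ext_dc\<close> and 1/2 from \<open>ext_d\<close> combine to -1/4,
    which turns the 2^(2(q-1)) of \<open>psi\<close> into the 2^(2q) of
    \<open>phi_KM\<close>.\<close>
  also have "1 / 2 * k2 = - b / (2 ^ (2 * ?q) * c)"
  proof -
    have "(2::complex) ^ (2 * ?q) = 4 * 2 ^ (2 * (?q - 1))"
    proof -
      have "?q \<noteq> 0" by simp
      then obtain m where m: "?q = Suc m" by (metis not0_implies_Suc)
      show ?thesis unfolding m by simp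
    qed
    then show ?thesis using c by (simp add: k2_def k_def field_simps)
  qed
  finally show ?thesis unfolding uv(2) .
qed

lemma (in form_tangent) scale_data:
  "av (r *\<^sub>R x) Z = r *\<^sub>R av x Z" "bv (r *\<^sub>R x) Z = r *\<^sub>R bv x Z"
  "sst (r *\<^sub>R x) Z = r *\<^sub>R sst x Z" "tv (r *\<^sub>R x) Z = r *\<^sub>R tv x Z"
proof -
  have p: "pos_part (r *\<^sub>R x) = r *\<^sub>R pos_part x" "neg_part (r *\<^sub>R x) = r *\<^sub>R neg_part x"
    by (simp_all add: pos_part_def neg_part_def vec_eq_iff)
  show s: "sst (r *\<^sub>R x) Z = r *\<^sub>R sst x Z" "tv (r *\<^sub>R x) Z = r *\<^sub>R tv x Z"
    by (simp_all add: sst_def tv_def p ct_simps matrix_ring_simps scaleR_diff_right)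
  show "av (r *\<^sub>R x) Z = r *\<^sub>R av x Z" "bv (r *\<^sub>R x) Z = r *\<^sub>R bv x Z"
    by (simp_all add: av_def bv_def nst_def mv_def s p ct_simps cm_simps matrix_ring_simps scaleR_diff_right)
qed

text \<open>The exponent at r x is -r^2 A - 2 r B - C. For r = \<surd>v its derivative, multiplied
  by v, is -(v A + \<surd>v B), which is -\<open>Rel\<close> at \<surd>v x.\<close>

lemma phi_KM0_derivative:
  fixes Z :: "complex ^ ('q::{finite, linorder}) ^ 'p::finite" and w :: "(complex ^ ('q::{finite, linorder}) ^ 'p) list"
  assumes Z: "posdef (Kmat Z)" and n: "length w = 2 * CARD('q)" and v: "v > 0"
  shows "((\<lambda>v. phi_KM0 (sqrt v *\<^sub>R x) (graph Z) w) has_vector_derivative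
    (1 / v) *\<^sub>R ext_d (ext_dc (psi0 (sqrt v *\<^sub>R x))) (graph Z) w) (at v)"
proof -
  define es where "es = (eps_gens :: 'q gens grassmann list)"
  note H = form_tangent_eps[OF n, folded es_def]
  interpret H: form_tangent es w by (rule H)
  define c where "c = form_tangent.c0 es"
  have c: "c \<noteq> 0" unfolding c_def es_def by (rule c0_nonzero[OF form_tangent_eps[OF n]])
  define A :: "'q gens grassmann" where "A = (2 * pi) *\<^sub>R (cm (sst x Z) ** cm (tv x Z)) $ 1 $ 1"
  define B where "B = (H.av x Z ** th + ch ** H.bv x Z) $ 1 $ 1"
  define C where "C = (2 / pi) *\<^sub>R (ch ** H.Cm Z ** th) $ 1 $ 1"
  have E: "H.Eexp (r *\<^sub>R x) Z = - (r * r) *\<^sub>R A - (2 * r) *\<^sub>R B - C" for r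
    by (simp add: H.Eexp_def H.Em_def H.scale_data cm_simps matrix_ring_simps A_def B_def C_def algebra_simps)
  have R: "H.Rel (r *\<^sub>R x) Z = (r * r) *\<^sub>R A + r *\<^sub>R B" for r
    by (simp add: H.Rel_def H.scale_data cm_simps matrix_ring_simps A_def B_def algebra_simps)
  define k where "k = 1 / (2 ^ (2 * CARD('q)) * c)"
  have phi: "phi_KM0 (sqrt v *\<^sub>R x) (graph Z) w = k * top_coef (exp (H.Eexp (sqrt v *\<^sub>R x) Z))" for v
    using phi_KM0_berezin[OF Z n, of "sqrt v *\<^sub>R x", folded es_def, folded c_def] c
    by (simp add: k_def field_simps)
  have s: "((\<lambda>v. sqrt v) has_derivative (\<lambda>h. h * (1 / (2 * sqrt v)))) (at v)"
    using v by (auto intro!: derivative_eq_intros simp: field_simps)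
  have "((\<lambda>v. H.Eexp (sqrt v *\<^sub>R x) Z) has_derivative
      (\<lambda>h. - (sqrt v * (h * (1 / (2 * sqrt v))) + h * (1 / (2 * sqrt v)) * sqrt v) *\<^sub>R A - (2 * (h * (1 / (2 * sqrt v)))) *\<^sub>R B)) (at v)"
  proof -
    have "((\<lambda>v. - (f v * f v) *\<^sub>R A - (2 * f v) *\<^sub>R B - C) has_derivative
        (\<lambda>h. - (f v * f' h + f' h * f v) *\<^sub>R A - (2 * f' h) *\<^sub>R B)) (at v)"
      if "(f has_derivative f') (at v)" for f f'
      by (auto intro!: derivative_eq_intros that)
    from this[OF s] show ?thesis unfolding E .
  qed
  then have dE: "((\<lambda>v. H.Eexp (sqrt v *\<^sub>R x) Z) has_derivative (\<lambda>h. h *\<^sub>R (- A - (1 / sqrt v) *\<^sub>R B))) (at v)"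
    by (rule has_derivative_eq_rhs) (use v in \<open>auto simp: fun_eq_iff algebra_simps\<close>)
  let ?e = "exp (H.Eexp (sqrt v *\<^sub>R x) Z)"
  have "((\<lambda>v. k * top_coef (exp (H.Eexp (sqrt v *\<^sub>R x) Z))) has_derivative
      (\<lambda>h. k * top_coef (?e * (h *\<^sub>R (- A - (1 / sqrt v) *\<^sub>R B))))) (at v)"
    by (intro has_derivative_mult_right bounded_linear.has_derivative[OF bounded_linear_top_coef]
        has_derivative_exp_even[OF dE] H.geven_Eexp)
  moreover have "k * top_coef (?e * (h *\<^sub>R (- A - (1 / sqrt v) *\<^sub>R B))) =
      h *\<^sub>R ((1 / v) *\<^sub>R ext_d (ext_dc (psi0 (sqrt v *\<^sub>R x))) (graph Z) w)" for h
  proof -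
    have "ext_d (ext_dc (psi0 (sqrt v *\<^sub>R x))) (graph Z) w = - k * top_coef (H.Rel (sqrt v *\<^sub>R x) Z * ?e)"
      using ddc_psi0[OF Z n, of 1 "sqrt v *\<^sub>R x", folded es_def, folded c_def] by (simp add: k_def)
    also have "H.Rel (sqrt v *\<^sub>R x) Z * ?e = ?e * H.Rel (sqrt v *\<^sub>R x) Z"
      by (rule geven_commute[OF geven_exp[OF H.geven_Eexp], symmetric])
    also have "H.Rel (sqrt v *\<^sub>R x) Z = - (v *\<^sub>R (- A - (1 / sqrt v) *\<^sub>R B))"
      unfolding R using v by (simp add: algebra_simps real_div_sqrt)
    finally show ?thesis using v by (simp add: top_coef_simps scaleR_complex)
  qed
  ultimately show ?thesis
    unfolding has_vector_derivative_def phi by simp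
qed

section \<open>Lists of tangent vectors of the wrong length\<close>

lemma wedge_length_neq: "length w \<noteq> length \<xi>s \<Longrightarrow> wedge \<xi>s w = 0"
  by (simp add: wedge_def)

lemma phi_KM0_eq_0:
  fixes x :: "complex ^ ('p::finite + 'q::{finite, linorder})"
  assumes "length w \<noteq> 2 * CARD('q)"
  shows "phi_KM0 x z w = 0"
  using assms by (simp add: phi_KM0_def phi_KM_def invariant_form_def phi_KM_base_def wedge_length_neq mult_2)

lemma psi0_eq_0:
  fixes x :: "complex ^ ('p::finite + 'q::{finite, linorder})"
  assumes "length w \<noteq> 2 * (CARD('q) - 1)"
  shows "psi0 x z w = 0"
proof -
  have "length (concat [[xi1 (\<alpha>s ! skip j k) (neg_index k), xi2 (\<beta>s ! skip j k) (neg_index k)].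
      k \<leftarrow> [0..<CARD('q)], k \<noteq> j] :: (complex ^ ('q::{finite, linorder}) ^ 'p \<Rightarrow> complex) list) = 2 * (CARD('q) - 1)"
    if "j < CARD('q)" for j and \<alpha>s \<beta>s :: "'p list"
    using skip_list[of j "qs :: 'q list" "\<lambda>k \<mu>. [xi1 (\<alpha>s ! k) \<mu>, xi2 (\<beta>s ! k) \<mu>]"] that
    unfolding neg_index_qs by (simp add: length_concat comp_def sum_list_triv qs_simps)
  then have "(Omega \<alpha>s \<beta>s :: ('p, 'q) covector) w' = 0" if "length w' = length w" for \<alpha>s \<beta>s w'
    unfolding Omega_def using assms that by (intro mult_zero_right[THEN trans[rotated]] arg_cong2[where f="(*)"] refl sum.neutral ballI wedge_length_neq) auto
  then show ?thesis
    by (simp add: psi0_def psi_def invariant_form_def psi_base_def Let_def)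
qed

lemma del_delbar_eq_0:
  assumes "\<And>z u. length u = length w - 1 \<Longrightarrow> \<omega> z u = 0"
  shows "del \<omega> z w = 0" "delbar \<omega> z w = 0"
proof -
  have "frechet_derivative (\<lambda>Z. \<omega> (graph Z) (take i w @ drop (Suc i) w)) (at (coord z)) = (\<lambda>h. 0)"
    if "i < length w" for i
    using that by (subst assms) auto
  then show "del \<omega> z w = 0" "delbar \<omega> z w = 0"
    by (simp_all add: del_def delbar_def)
qed

lemma ddc_psi0_eq_0:
  fixes x :: "complex ^ ('p::finite + 'q::{finite, linorder})"
  assumes "length w \<noteq> 2 * CARD('q)"
  shows "ext_d (ext_dc (\<lambda>z w. b * psi0 x z w)) z w = 0"
proof -
  have "w = [] \<or> length w = 1 \<or> length w \<ge> 2" by (cases w; cases "tl w") auto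
  moreover have "ext_dc (\<lambda>z w. b * psi0 x z w) z u = 0" if "length u = length w - 1" "length w \<ge> 1" for z u
  \<comment> \<open>The empty list is separate: \<open>length u - 1\<close> truncates to 0, which
    for q = 1 is the degree of \<open>psi0\<close>; there \<open>ext_dc\<close> vanishes as an empty
    sum.\<close>
  proof (cases u)
    case Nil
    then show ?thesis by (simp add: ext_dc_def del_def delbar_def)
  next
    case (Cons a us)
    have "length u - 1 \<noteq> 2 * (CARD('q) - 1)"
    proof -
      have "CARD('q) \<noteq> 0" by simp
      moreover have "length w \<ge> 2" using that Cons by simp
      ultimately show ?thesis using assms that by linarith
    qed
    then show ?thesis
      unfolding ext_dc_def by (simp add: del_delbar_eq_0 psi0_eq_0)
  qed
  ultimately show ?thesis
    by (cases w) (auto simp: ext_d_def del_delbar_eq_0 del_def[of _ _ "[]"] delbar_def[of _ _ "[]"])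
qed

text \<open>Scalars are pulled out by comparing the closed formula of \<open>ddc_psi0\<close> for
  \<open>b\<close> and for 1, which avoids a separate differentiability argument.\<close>

lemma ddc_psi0_scale:
  fixes x :: "complex ^ ('p::finite + 'q::{finite, linorder})"
  assumes z: "z \<in> neg_planes"
  shows "ext_d (ext_dc (\<lambda>z w. b * psi0 x z w)) z w = b * ext_d (ext_dc (psi0 x)) z w"
proof (cases "length w = 2 * CARD('q)")
  case True
  obtain Z where Z: "graph Z = z" using neg_plane_is_graph[OF z] by blast
  with z have "posdef (Kmat Z)" using neg_planes_iff by blast
  from ddc_psi0[OF this True, of b x] ddc_psi0[OF this True, of 1 x] show ?thesis
    by (simp add: Z)
next
  case False
  then show ?thesis using ddc_psi0_eq_0[OF False, of b x z] ddc_psi0_eq_0[OF False, of 1 x z] by simp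
qed

lemma phi_KM0_has_vector_derivative:
  fixes x :: "complex ^ ('p::finite + 'q::{finite, linorder})"
  assumes z: "z \<in> neg_planes" and v: "v > 0"
  shows "((\<lambda>v. phi_KM0 (sqrt v *\<^sub>R x) z w) has_vector_derivative
    (1 / v) *\<^sub>R ext_d (ext_dc (psi0 (sqrt v *\<^sub>R x))) z w) (at v)"
proof (cases "length w = 2 * CARD('q)")
  case True
  obtain Z where Z: "graph Z = z" using neg_plane_is_graph[OF z] by blast
  with z have "posdef (Kmat Z)" using neg_planes_iff by blast
  from phi_KM0_derivative[OF this True v, of x] show ?thesis by (simp add: Z)
next
  case False
  have "ext_d (ext_dc (psi0 (sqrt v *\<^sub>R x))) z w = 0"
    using ddc_psi0_eq_0[OF False, of 1 "sqrt v *\<^sub>R x" z] by simp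
  with False show ?thesis by (simp add: phi_KM0_eq_0)
qed

text \<open>The exponential is holomorphic and passes through the operator; g(Im \<tau>) contributes
  (\<i>/2) g', and -2\<i> v^2 times \<i>/2 is v^2.\<close>

lemma lowering_mult_exp:
  assumes g: "(g has_vector_derivative g') (at (Im \<tau>))"
  shows "lowering (\<lambda>\<sigma>. g (Im \<sigma>) * exp (a * \<sigma>)) \<tau> = of_real ((Im \<tau>)\<^sup>2) * g' * exp (a * \<tau>)"
proof -
  have "((\<lambda>\<sigma>. g (Im \<sigma>)) has_derivative (\<lambda>h. Im h *\<^sub>R g')) (at \<tau>)"
    using has_derivative_compose[OF bounded_linear_imp_has_derivative[OF bounded_linear_Im], of g _ \<tau> UNIV] g
    by (simp add: has_vector_derivative_def)
  moreover have "((\<lambda>\<sigma>. exp (a * \<sigma>)) has_derivative (\<lambda>h. exp (a * \<tau>) * a * h)) (at \<tau>)"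
    by (rule has_field_derivative_imp_has_derivative) (auto intro!: derivative_eq_intros)
  ultimately have "((\<lambda>\<sigma>. g (Im \<sigma>) * exp (a * \<sigma>)) has_derivative
      (\<lambda>h. g (Im \<tau>) * (exp (a * \<tau>) * a * h) + Im h *\<^sub>R g' * exp (a * \<tau>))) (at \<tau>)"
    by (rule has_derivative_mult)
  from frechet_derivative_at[OF this, symmetric] show ?thesis
    by (simp add: lowering_def algebra_simps power2_eq_square)
qed

theorem theorem3p3:
  fixes x :: "complex ^ ('p::finite + 'q::{finite, linorder})" and \<tau> :: complex
    and z :: "(complex ^ ('p + 'q)) set"
  assumes "Im \<tau> > 0" and "z \<in> neg_planes"
  shows "(\<lambda>w. lowering (\<lambda>\<sigma>. phi_KM_tau x \<sigma> z w) \<tau>) = ext_d (ext_dc (psi_tau x \<tau>)) z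
    \<and> (\<lambda>w. of_real (Im \<tau>) * vector_derivative (\<lambda>v. phi_KM0 (sqrt v *\<^sub>R x) z w) (at (Im \<tau>)))
        = ext_d (ext_dc (psi0 (sqrt (Im \<tau>) *\<^sub>R x))) z"
proof (intro conjI ext)
  fix w
  note D = phi_KM0_has_vector_derivative[OF assms(2,1), of x w]
  let ?X = "ext_d (ext_dc (psi0 (sqrt (Im \<tau>) *\<^sub>R x))) z w"
  let ?e = "exp (of_real pi * \<i> * herm x x * \<tau>)"
  show "of_real (Im \<tau>) * vector_derivative (\<lambda>v. phi_KM0 (sqrt v *\<^sub>R x) z w) (at (Im \<tau>)) = ?X"
    using vector_derivative_at[OF D] assms(1) by (simp add: scaleR_conv_of_real)
  have "psi_tau x \<tau> = (\<lambda>z w. (of_real (Im \<tau>) * ?e) * psi0 (sqrt (Im \<tau>) *\<^sub>R x) z w)"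
    by (simp add: psi_tau_def fun_eq_iff)
  then have "ext_d (ext_dc (psi_tau x \<tau>)) z w = of_real (Im \<tau>) * ?e * ?X"
    using ddc_psi0_scale[OF assms(2)] by simp
  \<comment> \<open>The v^2 of the lowering operator meets the 1/v of \<open>D\<close>; the
    remaining v is the factor built into \<open>psi_tau\<close>.\<close>
  moreover have "lowering (\<lambda>\<sigma>. phi_KM_tau x \<sigma> z w) \<tau> = of_real (Im \<tau>) * ?e * ?X"
    unfolding phi_KM_tau_def lowering_mult_exp[OF D]
    using assms(1) by (simp add: scaleR_conv_of_real power2_eq_square)
  ultimately show "lowering (\<lambda>\<sigma>. phi_KM_tau x \<sigma> z w) \<tau> = ext_d (ext_dc (psi_tau x \<tau>)) z w"
    by simp
qed

end
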